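(* Consider the billiard in the plane with $\mathbb{Z}^2$-periodic rectangular obstacles with sides $a,b\in(0,1)$, in the direction $\pi/4$, under the small obstacles condition $a+b\le1$. For almost every (Lebesgue) ratio $a/b$ of the lengths of the sides of the obstacles, there is a sequence of positive integers $(L_n)$ such that $n^{-\frac12}S(L_n,\Psi)$ converges in distribution, as $n\to\infty$, to a non-degenerate $2$-dimensional normal law (with the uniform measure on a rectangular obstacle as initial distribution). Moreover, under the assumption $$n^{-\frac12}\sum_{j=1}^{[\ln n]}a_{j+1}\longrightarrow0\quad(n\to\infty)$$ on the partial quotients $(a_j)$ of $\alpha=\frac{a}{a+b}$, also $n^{-\frac12}X^{c\,L_n}$ converges in distribution to a non-degenerate normal law.
   Context: Model. Let $0<a,b<1$. For $(m,n)\in\mathbb{Z}^2$ let $R_{(m,n)}(a,b)\subset\mathbb{R}^2$ be the $a\times b$ rectangle centered at $(m,n)$ with sides parallel to the coordinate axes. A point ball moves in $\mathbb{R}^2\setminus\bigcup_{(m,n)}R_{(m,n)}(a,b)$ with unit speed along straight lines between obstacles and is reflected according to the usual law (angle of incidence equals angle of reflection) when it hits the boundary of an obstacle. We consider the directional flow with angle $\eta=\pi/4$: velocities have directions in $\{\pm\eta,\pi\pm\eta\}$. Assume $a+b\le1$ (small obstacles condition) and set $\alpha=\frac{a}{a+b}=[0;a_1,a_2,\dots]$ (continued fraction expansion, with partial quotients $a_j$). Initial conditions. The ball starts on the boundary $ABCD$ of a rectangular obstacle, with an outward pointing velocity. The set of such configurations is identified with two copies of the boundary of the rectangle: one copy carries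 the outward pointing vectors in direction $\eta$ or $\pi+\eta$, the other one the outward pointing vectors in direction $\pi-\eta$ or $2\pi-\eta$. Each copy is identified with the circle $\mathbb{T}^1=\mathbb{R}/\mathbb{Z}$, the uniform measure on the boundary corresponding to Lebesgue measure on $\mathbb{T}^1$. Fix one of these copies; the starting point is a point $x$ of it, chosen according to the uniform measure. Displacement. Let $\Psi:\mathbb{T}^1\to\mathbb{Z}^2$ be given by $$\Psi(x)=\begin{cases}(0,1)& x\in\,]0,\frac12-\frac{\alpha}{2}[,\\ (1,0)& x\in\,]\frac12-\frac{\alpha}{2},\frac12[,\\ (0,-1)& x\in\,]\frac12,1-\frac{\alpha}{2}[,\\ (-1,0)& x\in\,]1-\frac{\alpha}{2},1[,\end{cases}$$ and $S(n,\Psi)(x)=\sum_{j=0}^{n-1}\Psi(x+j\alpha)$. (In the paper the square of the Poincaré map of the billiard is represented as two copies of the skew product $(x,z)\mapsto(x+\alpha,z+\Psi(x))$ on $\mathbb{T}^1\times\mathbb{Z}^2$, and $S(n,\Psi)(x)$ is interpreted as the label in $\mathbb{Z}^2$ of the cell containing the ball after $2n$ reflections.) Times. $\psi(x)$ is the length of the path of the ball starting from $x$ up to its collision with a second obstacle (i.e. until its second collision), $c=\int_{\mathbb{T}^1}\psi(x)\,dx$, and $X^t(x)\in\mathbb{R}^2$ is the position at time $t$ of the ball starting from $x$. *)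

theory Defs
  imports "HOL-Analysis.Analysis"
begin

section \<open>Normal laws on the plane and convergence in distribution\<close>

definition normal_density2 :: "real^2 \<Rightarrow> real^2^2 \<Rightarrow> real^2 \<Rightarrow> real" where
  "normal_density2 \<mu> C y =
     exp (- ((y - \<mu>) \<bullet> (matrix_inv C *v (y - \<mu>))) / 2) / (2 * pi * sqrt (det C))"

definition nondegenerate_normal_law :: "(real^2) measure \<Rightarrow> bool" where
  "nondegenerate_normal_law N \<longleftrightarrow>
     (\<exists>\<mu> C. transpose C = C \<and> (\<forall>y. y \<noteq> 0 \<longrightarrow> 0 < y \<bullet> (C *v y)) \<and>
            N = density lborel (\<lambda>y. ennreal (normal_density2 \<mu> C y)))"

text \<open>The library notion of weak convergence of measures is restricted to the real line.\<close>

definition converges_in_distribution ::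
    "'a measure \<Rightarrow> (nat \<Rightarrow> 'a \<Rightarrow> 'b::topological_space) \<Rightarrow> 'b measure \<Rightarrow> bool" where
  "converges_in_distribution M Y N \<longleftrightarrow>
     (\<forall>n. Y n \<in> borel_measurable M) \<and>
     (\<forall>f :: 'b \<Rightarrow> real. continuous_on UNIV f \<and> bounded (range f) \<longrightarrow>
        (\<lambda>n. \<integral>x. f (Y n x) \<partial>M) \<longlonglongrightarrow> (\<integral>y. f y \<partial>N))"

section \<open>Continued fractions\<close>

text \<open>For irrational \<open>x\<close>, \<open>partial_quotient x n\<close> is the coefficient \<open>a\<^sub>n\<close> of
  \<open>x = [a\<^sub>0; a\<^sub>1, a\<^sub>2, \<dots>]\<close>.  Rational \<open>x\<close> give meaningless values beyond the end of the expansion.\<close>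

fun complete_quotient :: "real \<Rightarrow> nat \<Rightarrow> real" where
  "complete_quotient x 0 = x"
| "complete_quotient x (Suc n) = 1 / frac (complete_quotient x n)"

definition partial_quotient :: "real \<Rightarrow> nat \<Rightarrow> int" where
  "partial_quotient x n = \<lfloor>complete_quotient x n\<rfloor>"

section \<open>The circle and the displacement cocycle\<close>

text \<open>Points of \<open>\<real>/\<int>\<close> are represented in \<open>[0,1)\<close>.\<close>

definition circle :: "real measure" where
  "circle = lebesgue_on {0..<1}"

text \<open>The value \<open>0\<close> at the finitely many points where \<open>\<Psi>\<close> is not specified is arbitrary.\<close>

definition \<Psi> :: "real \<Rightarrow> real \<Rightarrow> int^2" where
  "\<Psi> \<alpha> x =
     (let y = frac x in
      if 0 < y \<and> y < 1/2 - \<alpha>/2 then vector [0, 1]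
      else if 1/2 - \<alpha>/2 < y \<and> y < 1/2 then vector [1, 0]
      else if 1/2 < y \<and> y < 1 - \<alpha>/2 then vector [0, -1]
      else if 1 - \<alpha>/2 < y \<and> y < 1 then vector [-1, 0]
      else 0)"

definition ergodic_sum :: "real \<Rightarrow> nat \<Rightarrow> (real \<Rightarrow> int^2) \<Rightarrow> real \<Rightarrow> int^2" where
  "ergodic_sum \<alpha> n \<Phi> x = (\<Sum>j<n. \<Phi> (x + real j * \<alpha>))"

definition real_vec :: "int^2 \<Rightarrow> real^2" where
  "real_vec z = (\<chi> i. real_of_int (z $ i))"

section \<open>The billiard\<close>

definition obstacle :: "real \<Rightarrow> real \<Rightarrow> int^2 \<Rightarrow> (real^2) set" where
  "obstacle a b m =
     {p. \<bar>p $ 1 - real_of_int (m $ 1)\<bar> \<le> a/2 \<and> \<bar>p $ 2 - real_of_int (m $ 2)\<bar> \<le> b/2}"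

definition on_vertical_side :: "real \<Rightarrow> real \<Rightarrow> real^2 \<Rightarrow> bool" where
  "on_vertical_side a b p \<longleftrightarrow> (\<exists>m. p \<in> obstacle a b m \<and> \<bar>p $ 1 - real_of_int (m $ 1)\<bar> = a/2)"

definition on_horizontal_side :: "real \<Rightarrow> real \<Rightarrow> real^2 \<Rightarrow> bool" where
  "on_horizontal_side a b p \<longleftrightarrow> (\<exists>m. p \<in> obstacle a b m \<and> \<bar>p $ 2 - real_of_int (m $ 2)\<bar> = b/2)"

text \<open>At a corner, where the reflection law is undefined, both components are reversed; almost no
  orbit meets a corner.\<close>

definition reflect :: "real \<Rightarrow> real \<Rightarrow> real^2 \<Rightarrow> real^2 \<Rightarrow> real^2" where
  "reflect a b p v =
     vector [if on_vertical_side a b p then - v $ 1 else v $ 1,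
             if on_horizontal_side a b p then - v $ 2 else v $ 2]"

text \<open>A state is a position on the boundary of an obstacle with a unit velocity pointing out of that
  obstacle, so that the times \<open>t\<close> below are bounded away from \<open>0\<close> and the infimum is attained.\<close>

type_synonym state = "(real^2) \<times> (real^2)"

definition free_time :: "real \<Rightarrow> real \<Rightarrow> state \<Rightarrow> real" where
  "free_time a b s = Inf {t. 0 < t \<and> fst s + t *\<^sub>R snd s \<in> (\<Union>m. obstacle a b m)}"

definition poincare_map :: "real \<Rightarrow> real \<Rightarrow> state \<Rightarrow> state" where
  "poincare_map a b s =
     (let q = fst s + free_time a b s *\<^sub>R snd s in (q, reflect a b q (snd s)))"

definition collision_time :: "real \<Rightarrow> real \<Rightarrow> state \<Rightarrow> nat \<Rightarrow> real" where
  "collision_time a b s k = (\<Sum>j<k. free_time a b ((poincare_map a b ^^ j) s))"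

definition billiard_position :: "real \<Rightarrow> real \<Rightarrow> state \<Rightarrow> real \<Rightarrow> real^2" where
  "billiard_position a b s t =
     (let k = (LEAST k. t < collision_time a b s (Suc k));
          s' = (poincare_map a b ^^ k) s
      in fst s' + (t - collision_time a b s k) *\<^sub>R snd s')"

subsection \<open>Initial conditions\<close>

definition direction :: "real \<Rightarrow> real^2" where
  "direction \<theta> = vector [cos \<theta>, sin \<theta>]"

text \<open>Parametrisation of the boundary of the obstacle at the origin, clockwise from its upper left
  corner and proportional to arc length.\<close>

definition boundary_point :: "real \<Rightarrow> real \<Rightarrow> real \<Rightarrow> real^2" where
  "boundary_point a b x =
     (let s = 2 * (a + b) * x in
      if s < a then vector [- a/2 + s, b/2]
      else if s < a + b then vector [a/2, b/2 - (s - a)]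
      else if s < 2 * a + b then vector [a/2 - (s - (a + b)), - b/2]
      else vector [- a/2, - b/2 + (s - (2 * a + b))])"

text \<open>The copy \<open>Main_Dirs\<close> carries the outward vectors in the directions \<open>\<eta>\<close> (top and right sides,
  \<open>x < 1/2\<close>) and \<open>\<pi> + \<eta>\<close> (bottom and left sides).  The copy \<open>Mirror_Dirs\<close> carries those in the
  directions \<open>\<pi> - \<eta>\<close> (top and left sides) and \<open>2\<pi> - \<eta>\<close> (bottom and right sides); there the circle
  is run through anticlockwise from the upper right corner, so that the square of the Poincare map
  is the rotation by \<open>+\<alpha>\<close> on both copies.\<close>

datatype copy = Main_Dirs | Mirror_Dirs

fun initial_state :: "real \<Rightarrow> real \<Rightarrow> copy \<Rightarrow> real \<Rightarrow> state" where
  "initial_state a b Main_Dirs x =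
     (boundary_point a b x,
      if x < 1/2 then direction (pi/4) else direction (pi + pi/4))"
| "initial_state a b Mirror_Dirs x =
     (vector [- (boundary_point a b x $ 1), boundary_point a b x $ 2],
      if x < 1/2 then direction (pi - pi/4) else direction (2 * pi - pi/4))"

definition \<psi> :: "real \<Rightarrow> real \<Rightarrow> copy \<Rightarrow> real \<Rightarrow> real" where
  "\<psi> a b \<kappa> x = collision_time a b (initial_state a b \<kappa> x) 2"

definition mean_time :: "real \<Rightarrow> real \<Rightarrow> copy \<Rightarrow> real" where
  "mean_time a b \<kappa> = (\<integral>x. \<psi> a b \<kappa> x \<partial>circle)"

definition X :: "real \<Rightarrow> real \<Rightarrow> copy \<Rightarrow> real \<Rightarrow> real \<Rightarrow> real^2" where
  "X a b \<kappa> t x = billiard_position a b (initial_state a b \<kappa> x) t"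

end

theory Submission
  imports Defs "HOL-Probability.Probability" "HOL-Real_Asymp.Real_Asymp"
begin

text \<open>
  The sequence \<open>L\<close> may be chosen freely, so it is enough to know the rotation by \<open>\<alpha>\<close> along times at
  which it is almost periodic.  For almost every \<open>\<alpha>\<close> there are, for either parity of \<open>p\<close>, fractions
  \<open>p/q\<close> in lowest terms with \<open>q\<close> odd and \<open>q\<^sup>2 \<bar>\<alpha> - p/q\<bar>\<close> as small as desired
  (\<open>negligible_badly_approximable\<close>, a density argument).  Over such a block of \<open>q\<close> steps the
  displacement is that of the rotation by \<open>p/q\<close>, except for \<open>x\<close> in a small set.  Writing \<open>\<Psi>\<close> with floor
  functions, Hermite's identity evaluates it: the block moves the cell by one unit, vertically if \<open>p\<close>
  is even and horizontally if \<open>p\<close> is odd, and the sign is a square wave of \<open>q x\<close>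
  (\<open>sums_along_good_approximation\<close>).

  If \<open>q\<close> is large compared with the length of what precedes the block, then moving \<open>x\<close> by \<open>1/(2q)\<close>
  reverses the sign of the block and leaves the previous sum unchanged outside a small set; thus the
  sign is nearly a fair coin independent of the past (\<open>append_block\<close>).  Concatenating \<open>n\<close> blocks of
  each kind gives a length \<open>L\<^sub>n\<close> for which the law of \<open>S(L\<^sub>n,\<Psi>)\<close> is, up to an error \<open>1/n\<close>, that of
  two independent simple random walks of \<open>n\<close> steps, one per coordinate (\<open>sums_mimic_walk\<close>), and the
  central limit theorem for these walks yields the normal law.

  For the billiard, a ball leaving an obstacle diagonally meets next the diagonally adjacent obstacle.
  In the parametrisation of the boundary this collision is the rotation by \<open>\<alpha>/2\<close> together with an
  exchange of the two copies, and two of them move the ball by \<open>2 \<Psi>\<close>, up to a reflection of the first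
  coordinate on the mirror copy (\<open>orbit_state_step\<close>, \<open>cell_even\<close>).  The flight time is a constant plus
  a second difference, along that rotation, of a bounded periodic function
  (\<open>flight_time_second_difference\<close>).  Hence collision times telescope: the \<open>k\<close>-th one differs from
  \<open>k\<close> times a constant by at most \<open>1\<close>, uniformly in the starting point.  As the ball has unit speed, its
  position at time \<open>c L\<close> stays at bounded distance from \<open>2 S(L,\<Psi>)\<close> (\<open>position_follows_cocycle\<close>), and
  the bounded error disappears after division by \<open>\<surd>n\<close>.
\<close>

section \<open>Good rational approximations in a parity class\<close>

text \<open>Every point of \<open>S\<close> is the centre of arbitrarily small balls of which a fixed fraction is missing
  from \<open>S\<close>.  Choose an open \<open>U \<supseteq> S\<close> of measure close to that of \<open>S\<close>, and by Vitali disjoint such balls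
  in \<open>U\<close> that cover almost all of \<open>S\<close>: in each of them \<open>S\<close> loses the fraction \<open>c\<close>, so the measure of \<open>S\<close>
  is at most \<open>1 - c\<close> times that of \<open>U\<close>.\<close>

lemma porous_set_negligible:
  fixes S :: "real set" and c :: real
  assumes S: "S \<in> sets lebesgue" "bounded S" and c: "0 < c" "c < 1"
    and porous: "\<And>x d. x \<in> S \<Longrightarrow> 0 < d \<Longrightarrow>
      \<exists>r y. 0 < r \<and> r < d \<and> ball y (c * r) \<subseteq> ball x r - S"
  shows "negligible S"
proof (rule ccontr)
  assume "\<not> negligible S"
  have Sm: "S \<in> lmeasurable"
    using S by (simp add: bounded_set_imp_lmeasurable)
  define m where "m = measure lebesgue S"
  have "m > 0"
    using \<open>\<not> negligible S\<close> Sm by (simp add: m_def negligible_iff_measure zero_less_measure_iff)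
  have "0 < m * c / (1 - c)" using \<open>m > 0\<close> c by simp
  then obtain U where U: "open U" "S \<subseteq> U" "(U - S) \<in> lmeasurable"
      "emeasure lebesgue (U - S) < ennreal (m * c / (1 - c))"
    using sets_lebesgue_outer_open[OF S(1)] by metis
  have UU: "U = S \<union> (U - S)" using U by auto
  have Um: "U \<in> lmeasurable"
    by (subst UU) (use Sm U in \<open>intro fmeasurable.Un\<close>)
  have "measure lebesgue (U - S) < m * c / (1 - c)"
    using U(3,4) \<open>0 < m * c / (1 - c)\<close> by (simp add: emeasure_eq_measure2 ennreal_less_iff)
  moreover have "measure lebesgue U \<le> m + measure lebesgue (U - S)"
    unfolding m_def by (subst (1) UU) (use Sm U in \<open>intro measure_Un_le, auto\<close>)
  ultimately have "measure lebesgue U < m + m * c / (1 - c)" by linarith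
  also have "\<dots> = m / (1 - c)" using c by (simp add: field_simps)
  finally have mU: "(1 - c) * measure lebesgue U < m"
    using c by (simp add: field_simps)
  \<comment> \<open>balls in \<open>U\<close> with a hole of relative size \<open>c\<close>\<close>
  define K where "K = {(x, r). x \<in> S \<and> 0 < r \<and> ball x r \<subseteq> U \<and>
    (\<exists>y. ball y (c * r) \<subseteq> ball x r - S)}"
  obtain C where C: "countable C" "C \<subseteq> K"
     "pairwise (\<lambda>i j. disjnt (ball (fst i) (snd i)) (ball (fst j) (snd j))) C"
     "negligible (S - (\<Union>i \<in> C. ball (fst i) (snd i)))"
  proof (rule Vitali_covering_theorem_balls[of S K fst snd])
    fix x d :: real assume x: "x \<in> S" "0 < d"
    obtain k where k: "k > 0" "ball x k \<subseteq> U"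
      using x U by (meson openE subsetD)
    obtain r y where r: "0 < r" "r < min d k" "ball y (c * r) \<subseteq> ball x r - S"
      using porous[of x "min d k"] x k by auto
    then have "ball x r \<subseteq> U" using k by (meson ball_subset_ball_iff less_eq_real_def min_less_iff_conj order_trans subset_ball)
    then show "\<exists>i. i \<in> K \<and> x \<in> ball (fst i) (snd i) \<and> snd i < d"
      using r x by (intro exI[of _ "(x, r)"]) (auto simp: K_def)
  qed
  define B where "B i = ball (fst i) (snd i)" for i :: "real \<times> real"
  have loss: "emeasure lebesgue (S \<inter> B i) \<le> ennreal (1 - c) * emeasure lebesgue (B i)" if "i \<in> C" for i
  proof -
    obtain x r where i: "i = (x, r)" by fastforce
    obtain y where y: "0 < r" "ball y (c * r) \<subseteq> ball x r - S"
      using \<open>i \<in> C\<close> C(2) i unfolding K_def by blast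
    have "emeasure lebesgue (S \<inter> B i) \<le> emeasure lebesgue (ball x r - ball y (c * r))"
      using y S by (intro emeasure_mono) (auto simp: B_def i)
    also have "\<dots> = emeasure lebesgue (ball x r) - emeasure lebesgue (ball y (c * r))"
      using y c by (intro emeasure_Diff) (auto simp: ball_eq_greaterThanLessThan)
    also have "\<dots> = ennreal (2 * r) - ennreal (2 * (c * r))"
      using y c by (simp add: ball_eq_greaterThanLessThan)
    also have "\<dots> = ennreal (1 - c) * ennreal (2 * r)"
      using y c by (simp add: ennreal_minus flip: ennreal_mult) (simp add: algebra_simps)
    finally show ?thesis using y by (simp add: B_def i ball_eq_greaterThanLessThan)
  qed
  have dj: "disjoint_family_on B C"
    using C(3) unfolding disjoint_family_on_def pairwise_def disjnt_def B_def by metis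
  then have dj': "disjoint_family_on (\<lambda>i. S \<inter> B i) C"
    unfolding disjoint_family_on_def by blast
  have meas: "B i \<in> sets lebesgue" for i by (simp add: B_def)
  have sub: "S \<subseteq> (S - (\<Union>i\<in>C. B i)) \<union> (\<Union>i\<in>C. S \<inter> B i)" by auto
  have N0: "S - (\<Union>i\<in>C. B i) \<in> null_sets lebesgue"
    using C(4) by (simp add: B_def negligible_iff_null_sets)
  have SU: "(\<Union>i\<in>C. S \<inter> B i) \<in> sets lebesgue"
    using C(1) meas S(1) by (intro sets.countable_UN'') auto
  have "emeasure lebesgue S \<le> emeasure lebesgue ((S - (\<Union>i\<in>C. B i)) \<union> (\<Union>i\<in>C. S \<inter> B i))"
    using sub N0 SU by (intro emeasure_mono) auto
  also have "\<dots> = emeasure lebesgue (\<Union>i\<in>C. S \<inter> B i)"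
    using N0 SU by (subst Un_commute, subst emeasure_Un_null_set) auto
  also have "\<dots> = (\<integral>\<^sup>+i. emeasure lebesgue (S \<inter> B i) \<partial>count_space C)"
    using C(1) meas S(1) dj' by (intro emeasure_UN_countable) auto
  also have "\<dots> \<le> (\<integral>\<^sup>+i. ennreal (1 - c) * emeasure lebesgue (B i) \<partial>count_space C)"
    using loss by (intro nn_integral_mono) auto
  also have "\<dots> = ennreal (1 - c) * (\<integral>\<^sup>+i. emeasure lebesgue (B i) \<partial>count_space C)"
    by (intro nn_integral_cmult) auto
  also have "\<dots> = ennreal (1 - c) * emeasure lebesgue (\<Union>i\<in>C. B i)"
    using C(1) meas dj by (subst emeasure_UN_countable) auto
  also have "\<dots> \<le> ennreal (1 - c) * emeasure lebesgue U"
  proof (intro mult_left_mono emeasure_mono)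
    show "(\<Union>i\<in>C. B i) \<subseteq> U" using C(2) unfolding K_def B_def by fastforce
  qed (use Um in auto)
  also have "\<dots> = ennreal ((1 - c) * measure lebesgue U)"
    using c Um by (simp add: emeasure_eq_measure2 ennreal_mult)
  also have "\<dots> < ennreal m" using mU \<open>m > 0\<close> by (simp add: ennreal_less_iff c less_imp_le)
  also have "\<dots> = emeasure lebesgue S"
    using Sm by (simp add: m_def emeasure_eq_measure2)
  finally show False by simp
qed

text \<open>Dirichlet's theorem gives \<open>p/q\<close>, of uncontrolled parity, with \<open>q\<close> large.  A solution \<open>p', q'\<close> of
  \<open>q' p - p' q = 1\<close> with \<open>q' < q\<close> approximates almost as well.  The two pairs are linearly independent
  modulo \<open>2\<close>, so every parity class other than (even, even) is met by \<open>(p, q)\<close>,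
  \<open>(p' + p, q' + q)\<close> or \<open>(p' + 2 p, q' + 2 q)\<close>.\<close>

lemma approximation_in_parity_class:
  fixes \<alpha> :: real and s t :: int and N :: nat
  assumes irr: "\<alpha> \<notin> \<rat>" and st: "odd s \<or> odd t"
  shows "\<exists>p q. coprime p q \<and> q > int N \<and> even (p - s) \<and> even (q - t) \<and>
    \<bar>\<alpha> - of_int p / of_int q\<bar> \<le> 12 / (of_int q)\<^sup>2"
proof -
  \<comment> \<open>an approximation finer than \<open>Min D\<close> forces the denominator to exceed \<open>N\<close>\<close>
  define D where "D = (\<lambda>k::nat. \<bar>real k * \<alpha> - of_int (round (real k * \<alpha>))\<bar>) ` {1..N+1}"
  have D0: "d > 0" if "d \<in> D" for d
  proof -
    from that obtain k where "k \<in> {1..N+1}" and k': "d = \<bar>real k * \<alpha> - of_int (round (real k * \<alpha>))\<bar>"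
      unfolding D_def by (rule imageE)
    then have k: "k \<ge> 1" "d = \<bar>real k * \<alpha> - of_int (round (real k * \<alpha>))\<bar>" by auto
    have "real k * \<alpha> \<noteq> of_int (round (real k * \<alpha>))"
    proof
      assume "real k * \<alpha> = of_int (round (real k * \<alpha>))"
      then have "\<alpha> = of_int (round (real k * \<alpha>)) / real k" using k by (simp add: field_simps)
      then show False using irr by (metis Rats_divide Rats_of_int Rats_of_nat)
    qed
    then show ?thesis using k by simp
  qed
  have finD: "finite D" "D \<noteq> {}" by (auto simp: D_def)
  define M where "M = nat \<lceil>1 / Min D\<rceil> + 1"
  have M: "M > 0" "1 / real M \<le> Min D"
  proof -
    have "Min D > 0" using finD D0 by auto
    moreover have "real M \<ge> 1 / Min D" unfolding M_def by linarith
    moreover have "real M > 0" by (simp add: M_def)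
    ultimately show "1 / real M \<le> Min D" by (simp add: field_simps)
  qed (simp add: M_def)
  obtain p q where pq: "coprime p q" "0 < q" "q \<le> int M" "\<bar>of_int q * \<alpha> - of_int p\<bar> < 1 / real M"
    using Dirichlet_approx_coprime[OF M(1)] by metis
  have qN: "q > int N"
  proof (rule ccontr)
    assume "\<not> q > int N"
    then have "\<bar>real (nat q) * \<alpha> - of_int (round (real (nat q) * \<alpha>))\<bar> \<in> D"
      unfolding D_def using pq by (intro imageI) auto
    then have "Min D \<le> \<bar>real (nat q) * \<alpha> - of_int (round (real (nat q) * \<alpha>))\<bar>"
      using finD by auto
    also have "\<dots> \<le> \<bar>of_int q * \<alpha> - of_int p\<bar>"
      using round_diff_minimal[of "of_int q * \<alpha>" p] pq(2) by (simp add: abs_minus_commute)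
    finally show False using pq(4) M(2) by linarith
  qed
  have qa: "\<bar>of_int q * \<alpha> - of_int p\<bar> < 1 / of_int q"
  proof -
    have "1 / real M \<le> 1 / of_int q" using pq by (intro divide_left_mono) auto
    then show ?thesis using pq(4) by linarith
  qed
  \<comment> \<open>the companion of \<open>p/q\<close>, reduced modulo \<open>q\<close>\<close>
  obtain u0 v0 where uv0: "u0 * p + v0 * q = 1"
    using pq(1) using bezout_int[of p q] by (auto simp: coprime_iff_gcd_eq_1)
  define q' p' where "q' = u0 mod q" and "p' = - v0 - p * (u0 div q)"
  have det: "q' * p - p' * q = 1"
  proof -
    have "q' = u0 - q * (u0 div q)" by (simp add: q'_def minus_mult_div_eq_mod)
    then have "q' * p - p' * q = (u0 - q * (u0 div q)) * p - p' * q" by simp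
    also have "\<dots> = u0 * p + v0 * q" unfolding p'_def by (simp add: algebra_simps)
    finally show ?thesis using uv0 by simp
  qed
  have q': "0 \<le> q'" "q' < q" using pq by (auto simp: q'_def)
  have q'a: "\<bar>of_int q' * \<alpha> - of_int p'\<bar> \<le> 2 / of_int q"
  proof -
    have e: "of_int q * (of_int q' * \<alpha> - of_int p') = of_int q' * (of_int q * \<alpha> - of_int p) + (1::real)"
    proof -
      have "of_int q' * of_int p - of_int p' * of_int q = (1::real)"
        using det by (metis of_int_1 of_int_diff of_int_mult)
      then show ?thesis by (simp add: algebra_simps)
    qed
    have "of_int q' * \<bar>of_int q * \<alpha> - of_int p\<bar> \<le> of_int q * (1 / of_int q)"
      using q' qa pq by (intro mult_mono) auto
    then have "of_int q' * \<bar>of_int q * \<alpha> - of_int p\<bar> \<le> 1" using pq by simp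
    then have "\<bar>of_int q' * (of_int q * \<alpha> - of_int p)\<bar> \<le> 1" using q' by (simp add: abs_mult)
    then have "\<bar>of_int q * (of_int q' * \<alpha> - of_int p')\<bar> \<le> 2" using e by linarith
    then have "of_int q * \<bar>of_int q' * \<alpha> - of_int p'\<bar> \<le> 2" using pq(2) by (simp only: abs_mult)
    then show ?thesis using pq(2) by (simp add: pos_le_divide_eq mult.commute)
  qed
  have comb: ?thesis if i: "i \<in> {1,2}" and par: "even (p' + i * p - s)" "even (q' + i * q - t)" for i
  proof (intro exI conjI)
    show "coprime (p' + i * p) (q' + i * q)"
    proof (rule coprimeI)
      fix c assume "c dvd p' + i * p" "c dvd q' + i * q"
      then have "c dvd (q' + i * q) * p - (p' + i * p) * q" by (intro dvd_diff dvd_mult2)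
      also have "\<dots> = 1" using det by (simp add: algebra_simps)
      finally show "is_unit c" .
    qed
    have ge: "q' + i * q \<ge> q" "q' + i * q \<le> 3 * q" using i q' pq by auto
    then show "q' + i * q > int N" using qN by linarith
    have "\<bar>of_int (q' + i * q) * \<alpha> - of_int (p' + i * p)\<bar> =
        \<bar>(of_int q' * \<alpha> - of_int p') + of_int i * (of_int q * \<alpha> - of_int p)\<bar>"
      by (simp add: algebra_simps)
    also have "\<dots> \<le> \<bar>of_int q' * \<alpha> - of_int p'\<bar> + \<bar>of_int i * (of_int q * \<alpha> - of_int p)\<bar>"
      by linarith
    also have "\<bar>of_int i * (of_int q * \<alpha> - of_int p)\<bar> \<le> 2 * \<bar>of_int q * \<alpha> - of_int p\<bar>"
      using i by (auto simp: abs_mult)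
    finally have "\<bar>of_int (q' + i * q) * \<alpha> - of_int (p' + i * p)\<bar> \<le> 4 / of_int q"
      using q'a qa by (simp add: field_simps)
    also have "\<dots> \<le> 12 / of_int (q' + i * q)"
    proof -
      have "real_of_int (q' + i * q) \<le> 3 * of_int q" using ge(2) by (metis of_int_le_iff of_int_mult of_int_numeral)
      moreover have "real_of_int (q' + i * q) > 0" "real_of_int q > 0" using ge(1) pq(2) by linarith+
      ultimately show ?thesis by (simp add: pos_divide_le_eq pos_le_divide_eq)
    qed
    finally have *: "\<bar>of_int (q' + i * q) * \<alpha> - of_int (p' + i * p)\<bar> \<le> 12 / of_int (q' + i * q)" .
    define Q P where "Q = real_of_int (q' + i * q)" and "P = real_of_int (p' + i * p)"
    have "Q > 0" using ge pq unfolding Q_def by linarith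
    have "\<alpha> - P / Q = (Q * \<alpha> - P) / Q" using \<open>Q > 0\<close> by (simp add: field_simps)
    then have "\<bar>\<alpha> - P / Q\<bar> = \<bar>Q * \<alpha> - P\<bar> / Q" using \<open>Q > 0\<close> by (simp add: abs_divide)
    also have "\<dots> \<le> (12 / Q) / Q"
      using * \<open>Q > 0\<close> unfolding Q_def P_def by (intro divide_right_mono) auto
    finally show "\<bar>\<alpha> - of_int (p' + i * p) / of_int (q' + i * q)\<bar> \<le> 12 / (of_int (q' + i * q))\<^sup>2"
      by (simp add: Q_def P_def power2_eq_square)
  qed (use par in auto)
  have d2: "odd (q' * p - p' * q)" using det by simp
  consider "even (p - s)" "even (q - t)" | "even (p' + 1 * p - s)" "even (q' + 1 * q - t)"
    | "even (p' + 2 * p - s)" "even (q' + 2 * q - t)"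
  proof -
    have "odd q' \<and> odd p \<or> odd p' \<and> odd q" "\<not> (odd q' \<and> odd p \<and> odd p' \<and> odd q)"
      using d2 by auto
    then show thesis using st that by (simp add: even_diff) satx
  qed
  then show ?thesis
  proof cases
    case 1
    have "\<alpha> - of_int p / of_int q = (of_int q * \<alpha> - of_int p) / of_int q" using pq(2) by (simp add: field_simps)
    then have "\<bar>\<alpha> - of_int p / of_int q\<bar> = \<bar>of_int q * \<alpha> - of_int p\<bar> / of_int q"
      using pq(2) by (simp add: abs_divide)
    also have "\<dots> \<le> (12 / of_int q) / of_int q"
    proof (intro divide_right_mono)
      have "1 / real_of_int q \<le> 12 / of_int q" using pq(2) by (intro divide_right_mono) auto
      then show "\<bar>of_int q * \<alpha> - of_int p\<bar> \<le> 12 / of_int q" using qa by linarith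
    qed (use pq in auto)
    finally show ?thesis using 1 pq(1) qN by (intro exI[of _ p] exI[of _ q]) (auto simp: power2_eq_square)
  qed (use comb[of 1] comb[of 2] in auto)
qed

text \<open>Only the parities of \<open>s\<close> and \<open>t\<close> matter: they prescribe those of numerator and denominator.\<close>

definition very_well_approximable :: "int \<Rightarrow> int \<Rightarrow> real \<Rightarrow> bool" where
  "very_well_approximable s t \<alpha> \<longleftrightarrow> (\<forall>\<epsilon>>0. \<forall>N::nat. \<exists>p q. coprime p q \<and> q > int N \<and> even (p - s) \<and> even (q - t) \<and>
    \<bar>\<alpha> - of_int p / of_int q\<bar> < \<epsilon> / (of_int q)\<^sup>2)"

text \<open>The exceptional set is a countable union of porous sets: by \<open>approximation_in_parity_class\<close> each
  irrational \<open>x\<close> has fractions \<open>p/q\<close> of the required class at distance at most \<open>12/q\<^sup>2\<close>, and the ball of radius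
  \<open>\<epsilon>/q\<^sup>2\<close> around \<open>p/q\<close>, whose points are approximated to the accuracy in question, fills a fixed fraction of the
  ball of radius \<open>13/q\<^sup>2\<close> around \<open>x\<close>.\<close>

lemma negligible_badly_approximable:
  fixes s t :: int
  assumes st: "odd s \<or> odd t"
  shows "negligible {\<alpha>. \<not> very_well_approximable s t \<alpha>}"
proof -
  define good where "good \<epsilon> N = (\<Union>(p, q) \<in> {(p, q). coprime p q \<and> q > int N \<and> even (p - s) \<and> even (q - t)}.
     ball (of_int p / of_int q :: real) (\<epsilon> / (of_int q)\<^sup>2))" for \<epsilon> :: real and N :: nat
  have op: "open (good \<epsilon> N)" for \<epsilon> N unfolding good_def by auto
  have main: "negligible (ball 0 (real k) - \<rat> - good \<epsilon> N)" if \<epsilon>: "0 < \<epsilon>" "\<epsilon> < 1" for \<epsilon> N k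
  proof (rule porous_set_negligible[where c = "\<epsilon> / 13"])
    have "(\<rat>::real set) \<in> sets lebesgue" 
      using countable_imp_null_set_lborel[OF countable_rat] by (meson null_setsD2 sets_completionI_sets sets_lborel)
    then show "ball 0 (real k) - \<rat> - good \<epsilon> N \<in> sets lebesgue"
      using op by (intro sets.Diff) auto
    show "bounded (ball 0 (real k) - \<rat> - good \<epsilon> N)" by (meson Diff_subset bounded_ball bounded_subset)
    show "0 < \<epsilon> / 13" "\<epsilon> / 13 < 1" using \<epsilon> by auto
    fix x d :: real
    assume x: "x \<in> ball 0 (real k) - \<rat> - good \<epsilon> N" and d: "0 < d"
    obtain M where M: "real M > 13 / d + real N" using reals_Archimedean2 by blast
    have MN: "real M > 13 / d" "N \<le> M"
    proof -
      have "13 / d > 0" using d by simp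
      then show "real M > 13 / d" "N \<le> M" using M by linarith+
    qed
    obtain p q where pq: "coprime p q" "q > int M" "even (p - s)" "even (q - t)"
        "\<bar>x - of_int p / of_int q\<bar> \<le> 12 / (of_int q)\<^sup>2"
      using approximation_in_parity_class[OF _ st, of x M] x by auto
    define Q where "Q = real_of_int q"
    have "q \<ge> 1" using pq(2) by linarith
    have "real M < Q" unfolding Q_def using pq(2) by linarith
    then have Q: "Q > 13 / d" using MN by linarith
    have "Q \<ge> 1" unfolding Q_def using \<open>q \<ge> 1\<close> by linarith
    have "13 / Q\<^sup>2 \<le> 13 / Q" using \<open>Q \<ge> 1\<close> by (intro divide_left_mono) (auto simp: power2_eq_square)
    also have "\<dots> < d" using Q d \<open>Q \<ge> 1\<close> by (simp add: field_simps)
    finally have "13 / Q\<^sup>2 < d" .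
    moreover have "ball (of_int p / Q) (\<epsilon> / 13 * (13 / Q\<^sup>2)) \<subseteq> good \<epsilon> N"
      unfolding good_def Q_def using pq MN by (intro subsetI UN_I[of "(p, q)"]) auto
    moreover have "ball (of_int p / Q) (\<epsilon> / 13 * (13 / Q\<^sup>2)) \<subseteq> ball x (13 / Q\<^sup>2)"
    proof
      fix z assume "z \<in> ball (of_int p / Q) (\<epsilon> / 13 * (13 / Q\<^sup>2))"
      then have "\<bar>of_int p / Q - z\<bar> < \<epsilon> / Q\<^sup>2" by (simp add: dist_real_def)
      moreover have "\<epsilon> / Q\<^sup>2 < 1 / Q\<^sup>2" using \<epsilon> \<open>Q \<ge> 1\<close> by (intro divide_strict_right_mono) auto
      ultimately have "\<bar>x - z\<bar> < 12 / Q\<^sup>2 + 1 / Q\<^sup>2" using pq(5) unfolding Q_def by linarith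
      then show "z \<in> ball x (13 / Q\<^sup>2)" by (simp add: dist_real_def)
    qed
    ultimately show "\<exists>r y. 0 < r \<and> r < d \<and>
        ball y (\<epsilon> / 13 * r) \<subseteq> ball x r - (ball 0 (real k) - \<rat> - good \<epsilon> N)"
      using \<open>Q \<ge> 1\<close> by (intro exI[of _ "13 / Q\<^sup>2"] exI[of _ "of_int p / Q"]) auto
  qed
  have "{\<alpha>. \<not> very_well_approximable s t \<alpha>} \<subseteq>
    \<rat> \<union> (\<Union>(k, j, N) \<in> UNIV. ball 0 (real k) - \<rat> - good (1 / real (j + 2)) N)"
  proof
    fix \<alpha> assume "\<alpha> \<in> {\<alpha>. \<not> very_well_approximable s t \<alpha>}"
    then have "\<not> very_well_approximable s t \<alpha>" by simp
    then obtain \<epsilon> N where eN: "\<epsilon> > 0" "\<And>p q. coprime p q \<Longrightarrow> q > int N \<Longrightarrow> even (p - s) \<Longrightarrow> even (q - t) \<Longrightarrow>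
      \<not> \<bar>\<alpha> - of_int p / of_int q\<bar> < \<epsilon> / (of_int q)\<^sup>2"
      unfolding very_well_approximable_def by blast
    obtain j where j: "1 / \<epsilon> < real j" using reals_Archimedean2 by blast
    then have "1 < real j * \<epsilon>" using eN(1) by (simp add: field_simps)
    then have j': "1 / real (j + 2) < \<epsilon>" using eN(1) by (simp add: field_simps)
    obtain k where k: "\<bar>\<alpha>\<bar> < real k" using reals_Archimedean2 by blast
    have "\<alpha> \<notin> good (1 / real (j + 2)) N"
    proof
      assume "\<alpha> \<in> good (1 / real (j + 2)) N"
      then obtain p q where pq: "coprime p q" "q > int N" "even (p - s)" "even (q - t)"
        "dist (of_int p / of_int q) \<alpha> < 1 / real (j + 2) / (of_int q)\<^sup>2"
        by (auto simp: good_def)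
      have "1 / real (j + 2) / (of_int q)\<^sup>2 \<le> \<epsilon> / (of_int q)\<^sup>2" using j' by (intro divide_right_mono) auto
      then have "\<bar>\<alpha> - of_int p / of_int q\<bar> < \<epsilon> / (of_int q)\<^sup>2"
        using pq(5) by (simp add: dist_real_def abs_minus_commute)
      then show False using eN(2) pq by blast
    qed
    then show "\<alpha> \<in> \<rat> \<union> (\<Union>(k, j, N) \<in> UNIV. ball 0 (real k) - \<rat> - good (1 / real (j + 2)) N)"
      using k by (intro UnCI UN_I[of "(k, j, N)"]) auto
  qed
  moreover have "negligible (\<rat> \<union> (\<Union>(k, j, N) \<in> UNIV. ball 0 (real k) - \<rat> - good (1 / real (j + 2)) N))"
  proof (rule negligible_Un)
    show "negligible (\<rat>::real set)" using countable_imp_null_set_lborel[OF countable_rat] unfolding negligible_iff_null_sets by (rule null_sets_completionI)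
    show "negligible (\<Union>(k, j, N) \<in> UNIV. ball 0 (real k) - \<rat> - good (1 / real (j + 2)) N)"
      by (rule negligible_countable_Union) (auto intro!: main)
  qed
  ultimately show ?thesis by (rule negligible_subset[rotated])
qed

text \<open>The map \<open>\<alpha> \<mapsto> \<alpha>/(1 - \<alpha>)\<close>, inverse to \<open>r \<mapsto> r/(1 + r)\<close>, is differentiable away from \<open>1\<close> and so
  preserves null sets.\<close>

lemma AE_very_well_approximable_ratio:
  assumes st: "odd s \<or> odd t"
  shows "AE r :: real in lborel. 0 < r \<longrightarrow> very_well_approximable s t (r / (1 + r))"
proof -
  define N where "N = {\<alpha>. \<not> very_well_approximable s t \<alpha>}"
  define f where "f \<alpha> = \<alpha> / (1 - \<alpha>)" for \<alpha> :: real
  have "negligible (N - {1})"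
    using negligible_badly_approximable[OF st] by (simp add: N_def negligible_subset)
  then have "negligible (f ` (N - {1}))"
  proof (rule negligible_differentiable_image_negligible[rotated])
    show "f differentiable_on N - {1}"
      unfolding f_def differentiable_on_def
      by (auto intro!: derivative_intros)
  qed simp
  then have "AE r in lebesgue. r \<notin> f ` (N - {1})"
    by (simp add: negligible_iff_null_sets AE_not_in)
  then have "AE r in lebesgue. 0 < r \<longrightarrow> very_well_approximable s t (r / (1 + r))"
  proof (rule AE_mp, intro AE_I2 impI)
    fix r :: real assume r: "r \<notin> f ` (N - {1})" "0 < r"
    have "f (r / (1 + r)) = r" "r / (1 + r) \<noteq> 1" using r by (auto simp: f_def field_simps)
    then have "r / (1 + r) \<notin> N" using r by (metis DiffI imageI singletonD)
    then show "very_well_approximable s t (r / (1 + r))" by (simp add: N_def)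
  qed
  then show ?thesis by (simp add: AE_completion_iff)
qed

section \<open>The displacement along rational and nearly rational rotations\<close>

text \<open>Hermite's identity: with \<open>n = \<lfloor>q x\<rfloor>\<close> the summands are \<open>(n + j) div q\<close>.\<close>

lemma sum_floor_add_over:
  fixes x :: real and q :: nat
  assumes "q > 0"
  shows "(\<Sum>j<q. \<lfloor>x + real j / real q\<rfloor>) = \<lfloor>real q * x\<rfloor>"
proof -
  define n where "n = \<lfloor>real q * x\<rfloor>"
  have fl: "\<lfloor>x + real j / real q\<rfloor> = (n + int j) div int q" for j
  proof -
    have "x + real j / real q = (real q * x + real j) / real q" using assms by (simp add: field_simps)
    then have "\<lfloor>x + real j / real q\<rfloor> = \<lfloor>real q * x + real j\<rfloor> div int q"
      using floor_divide_real_eq_div[of "int q" "real q * x + real j"] by simp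
    also have "\<lfloor>real q * x + real j\<rfloor> = n + int j" by (simp add: n_def)
    finally show ?thesis .
  qed
  define a b where "a = n div int q" and "b = n mod int q"
  have b: "0 \<le> b" "b < int q" "n = int q * a + b" using assms by (auto simp: a_def b_def)
  have dv: "(n + int j) div int q = a + (if int q \<le> b + int j then 1 else 0)" if "j < q" for j
  proof (cases "int q \<le> b + int j")
    case True
    have "n + int j = int q * (a + 1) + (b + int j - int q)" using b by (simp add: algebra_simps)
    moreover have "0 \<le> b + int j - int q" "b + int j - int q < int q" using True b that by auto
    ultimately have "(n + int j) div int q = a + 1" by (rule int_div_pos_eq)
    then show ?thesis using True by simp
  next
    case False
    have "(n + int j) div int q = a"
      by (rule int_div_pos_eq[of _ _ _ "b + int j"]) (use False b in auto)
    then show ?thesis using False by simp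
  qed
  have "(\<Sum>j<q. \<lfloor>x + real j / real q\<rfloor>) = (\<Sum>j<q. a + (if int q \<le> b + int j then 1 else 0))"
    by (rule sum.cong) (auto simp: fl dv)
  also have "\<dots> = int q * a + int (card {j. j < q \<and> int q \<le> b + int j})"
    by (simp add: sum.distrib sum.If_cases Int_def)
  also have "{j. j < q \<and> int q \<le> b + int j} = {q - nat b..<q}" using b by auto
  also have "int q * a + int (card {q - nat b..<q}) = n" using b by auto
  finally show ?thesis by (simp add: n_def)
qed

text \<open>As \<open>p\<close> is invertible modulo \<open>q\<close>, the orbit of the rotation by \<open>p/q\<close> is the orbit of the rotation by
  \<open>1/q\<close> in another order.\<close>

lemma sum_over_rational_rotation:
  fixes g :: "real \<Rightarrow> 'a::comm_monoid_add" and p :: int and q :: nat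
  assumes q: "q > 0" and cop: "coprime p (int q)" and per: "\<And>y n. g (y + of_int n) = g y"
  shows "(\<Sum>j<q. g (x + real j * (of_int p / real q))) = (\<Sum>j<q. g (x + real j / real q))"
proof -
  define f where "f j = nat ((int j * p) mod int q)" for j
  have "(\<Sum>j<q. g (x + real j * (of_int p / real q))) = (\<Sum>j<q. g (x + real (f j) / real q))"
  proof (rule sum.cong)
    fix j
    have "int j * p = int q * ((int j * p) div int q) + int (f j)" using q by (simp add: f_def)
    then have "real j * of_int p = real q * of_int ((int j * p) div int q) + real (f j)"
      by (metis of_int_add of_int_mult of_int_of_nat_eq)
    then have "x + real j * (of_int p / real q) = (x + real (f j) / real q) + of_int ((int j * p) div int q)"
      using q by (simp add: field_simps)
    then show "g (x + real j * (of_int p / real q)) = g (x + real (f j) / real q)" using per by metis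
  qed simp
  also have "\<dots> = (\<Sum>j<q. g (x + real j / real q))"
  proof (rule sum.reindex_bij_betw)
    have inj: "inj_on f {..<q}"
    proof (rule inj_onI)
      fix i j assume ij: "i \<in> {..<q}" "j \<in> {..<q}" "f i = f j"
      then have "(int i * p) mod int q = (int j * p) mod int q"
        using q unfolding f_def by (subst (asm) eq_nat_nat_iff) auto
      then have "int q dvd (int i - int j) * p" by (simp add: mod_eq_dvd_iff algebra_simps)
      then have "int q dvd int i - int j" using cop by (metis coprime_commute coprime_dvd_mult_left_iff)
      then show "i = j" using ij zdvd_imp_le[of "int q" "int i - int j"] zdvd_imp_le[of "int q" "int j - int i"]
        by (cases i j rule: linorder_cases) (auto simp: dvd_diff_commute)
    qed
    moreover have "f ` {..<q} = {..<q}"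
      using inj q by (intro endo_inj_surj) (auto simp: f_def nat_less_iff)
    ultimately show "bij_betw f {..<q} {..<q}" by (simp add: bij_betw_def)
  qed
  finally show ?thesis .
qed

definition square_wave :: "real \<Rightarrow> int" where
  "square_wave y = 2 * \<lfloor>y\<rfloor> - 2 * \<lfloor>y - 1/2\<rfloor> - 1"

text \<open>The indicator function of \<open>[0,c)\<close> modulo \<open>1\<close> is \<open>\<lfloor>y\<rfloor> - \<lfloor>y - c\<rfloor>\<close>.  In this way the coordinates of \<open>\<Psi>\<close>
  become combinations of floor functions, to which Hermite's identity applies, and the sum of the two
  coordinates is a square wave that does not depend on \<open>\<alpha>\<close>.\<close>

definition horizontal_step :: "real \<Rightarrow> real \<Rightarrow> int" where
  "horizontal_step \<alpha> y = \<lfloor>y - 1/2 + \<alpha>/2\<rfloor> - \<lfloor>y - 1/2\<rfloor> - \<lfloor>y + \<alpha>/2\<rfloor> + \<lfloor>y\<rfloor>"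

definition vertical_step :: "real \<Rightarrow> real \<Rightarrow> int" where
  "vertical_step \<alpha> y = square_wave y - horizontal_step \<alpha> y"

lemma square_wave_values: "square_wave y = 1 \<or> square_wave y = -1"
proof -
  have "\<lfloor>y - 1/2\<rfloor> = \<lfloor>y\<rfloor> \<or> \<lfloor>y - 1/2\<rfloor> = \<lfloor>y\<rfloor> - 1" by linarith
  then show ?thesis by (auto simp: square_wave_def)
qed

lemma square_wave_half_shift: "square_wave (y + 1/2) = - square_wave y"
proof -
  have "\<lfloor>y + 1/2\<rfloor> = \<lfloor>y - 1/2\<rfloor> + 1" by linarith
  then show ?thesis by (simp add: square_wave_def)
qed

lemma square_wave_periodic: "square_wave (y + of_int n) = square_wave y"
proof -
  have "\<lfloor>y + of_int n - 1/2\<rfloor> = \<lfloor>y - 1/2\<rfloor> + n" by linarith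
  then show ?thesis by (simp add: square_wave_def)
qed

lemma horizontal_step_periodic: "horizontal_step \<alpha> (y + of_int n) = horizontal_step \<alpha> y"
proof -
  have "\<lfloor>y + of_int n - 1/2\<rfloor> = \<lfloor>y - 1/2\<rfloor> + n" "\<lfloor>y + of_int n - 1/2 + \<alpha>/2\<rfloor> = \<lfloor>y - 1/2 + \<alpha>/2\<rfloor> + n"
    "\<lfloor>y + of_int n + \<alpha>/2\<rfloor> = \<lfloor>y + \<alpha>/2\<rfloor> + n" by linarith+
  then show ?thesis by (simp add: horizontal_step_def)
qed

definition horizontal_sum :: "real \<Rightarrow> nat \<Rightarrow> real \<Rightarrow> int" where
  "horizontal_sum \<alpha> L x = (\<Sum>j<L. horizontal_step \<alpha> (x + real j * \<alpha>))"

definition vertical_sum :: "real \<Rightarrow> nat \<Rightarrow> real \<Rightarrow> int" where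
  "vertical_sum \<alpha> L x = (\<Sum>j<L. vertical_step \<alpha> (x + real j * \<alpha>))"

text \<open>Hermite's identity replaces \<open>y\<close> by \<open>q x\<close> and the break points \<open>1/2\<close>, \<open>\<alpha>/2\<close> by \<open>q/2\<close>, \<open>p/2\<close>.  For odd
  \<open>q\<close> the former is a half-integer, and modulo \<open>1\<close> the latter is \<open>0\<close> or \<open>1/2\<close> according to the parity of
  \<open>p\<close>; in the first case the four floors cancel.\<close>

lemma rational_rotation_sums:
  fixes p :: int and q :: nat
  assumes q: "q > 0" "odd q" and cop: "coprime p (int q)"
  shows "(\<Sum>j<q. square_wave (x + real j * (of_int p / real q))) = square_wave (real q * x)"
    and "(\<Sum>j<q. horizontal_step (of_int p / real q) (x + real j * (of_int p / real q))) =
           (if even p then 0 else square_wave (real q * x))"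
proof -
  obtain k where k: "q = 2 * k + 1" using q(2) by (elim oddE)
  have fs: "(\<Sum>j<q. \<lfloor>x + real j / real q + c\<rfloor>) = \<lfloor>real q * x + real q * c\<rfloor>" for c
    using sum_floor_add_over[OF q(1), of "x + c"] by (simp add: algebra_simps)
  have half: "\<lfloor>real q * x - real q / 2\<rfloor> = \<lfloor>real q * x - 1/2\<rfloor> - int k"
  proof -
    have "real q * x - real q / 2 = (real q * x - 1/2) - of_int (int k)" by (simp add: k field_simps)
    then show ?thesis by (simp only: floor_diff_of_int)
  qed
  have "(\<Sum>j<q. square_wave (x + real j * (of_int p / real q))) = (\<Sum>j<q. square_wave (x + real j / real q))"
    by (rule sum_over_rational_rotation[OF q(1) cop square_wave_periodic])
  also have "\<dots> = 2 * (\<Sum>j<q. \<lfloor>x + real j / real q + 0\<rfloor>) - 2 * (\<Sum>j<q. \<lfloor>x + real j / real q + (-1/2)\<rfloor>) - int q"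
    by (simp add: square_wave_def sum_subtractf sum_distrib_left)
  also have "\<dots> = square_wave (real q * x)"
    unfolding fs using half by (simp add: square_wave_def k)
  finally show "(\<Sum>j<q. square_wave (x + real j * (of_int p / real q))) = square_wave (real q * x)" .
  define c where "c = of_int p / real q"
  have qc: "real q * c = of_int p" using q by (simp add: c_def)
  have "(\<Sum>j<q. horizontal_step c (x + real j * (of_int p / real q))) = (\<Sum>j<q. horizontal_step c (x + real j / real q))"
    by (rule sum_over_rational_rotation[OF q(1) cop horizontal_step_periodic])
  also have "\<dots> = (\<Sum>j<q. \<lfloor>x + real j / real q + (-1/2 + c/2)\<rfloor>) - (\<Sum>j<q. \<lfloor>x + real j / real q + (-1/2)\<rfloor>)
      - (\<Sum>j<q. \<lfloor>x + real j / real q + c/2\<rfloor>) + (\<Sum>j<q. \<lfloor>x + real j / real q + 0\<rfloor>)"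
    by (simp add: horizontal_step_def sum_subtractf sum.distrib algebra_simps)
  also have "\<dots> = \<lfloor>real q * x - real q / 2 + of_int p / 2\<rfloor> - \<lfloor>real q * x - real q / 2\<rfloor>
      - \<lfloor>real q * x + of_int p / 2\<rfloor> + \<lfloor>real q * x\<rfloor>"
  proof -
    have 1: "real q * x + real q * (-1/2 + c/2) = real q * x - real q / 2 + of_int p / 2"
      "real q * x + real q * (-1/2) = real q * x - real q / 2" "real q * x + real q * (c/2) = real q * x + of_int p / 2"
      "real q * x + real q * 0 = real q * x"
      using qc by (auto simp: algebra_simps)
    show ?thesis unfolding fs 1 ..
  qed
  also have "\<dots> = (if even p then 0 else square_wave (real q * x))"
  proof (cases "even p")
    case True
    then obtain l where l: "p = 2 * l" by (elim evenE)
    have "\<lfloor>real q * x - real q / 2 + of_int p / 2\<rfloor> = \<lfloor>real q * x - real q / 2\<rfloor> + l"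
      "\<lfloor>real q * x + of_int p / 2\<rfloor> = \<lfloor>real q * x\<rfloor> + l" unfolding l by simp_all
    then show ?thesis using True by simp
  next
    case False
    then obtain l where l: "p = 2 * l + 1" by (elim oddE)
    define z where "z = real q * x"
    have 1: "\<lfloor>z - real q / 2 + of_int p / 2\<rfloor> = \<lfloor>z\<rfloor> - int k + l"
    proof -
      have "z - real q / 2 + of_int p / 2 = z + of_int (l - int k)" by (simp add: l k field_simps)
      then show ?thesis by linarith
    qed
    have 2: "\<lfloor>z + of_int p / 2\<rfloor> = \<lfloor>z - 1/2\<rfloor> + l + 1"
    proof -
      have "z + of_int p / 2 = (z - 1/2) + of_int (l + 1)" by (simp add: l field_simps)
      then show ?thesis by (simp only: floor_add_int) simp
    qed
    have 3: "\<lfloor>z - real q / 2\<rfloor> = \<lfloor>z - 1/2\<rfloor> - int k" using half by (simp add: z_def)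
    show ?thesis unfolding z_def[symmetric] 1 2 3 square_wave_def using False by simp
  qed
  finally show "(\<Sum>j<q. horizontal_step (of_int p / real q) (x + real j * (of_int p / real q))) =
           (if even p then 0 else square_wave (real q * x))" by (simp add: c_def)
qed

text \<open>The points \<open>x + j \<alpha>\<close> and \<open>x + j p/q\<close>, \<open>j < q\<close>, differ by less than \<open>\<epsilon>/q\<close>, and the discontinuities
  of the rational displacement along the orbit are at the points \<open>x\<close> with \<open>2 q x\<close> an integer.  Away from
  these the two displacements agree term by term.\<close>

lemma sums_along_good_approximation:
  fixes p :: int and q :: nat
  assumes q: "q > 0" "odd q" and cop: "coprime p (int q)"
    and approx: "\<bar>\<alpha> - of_int p / real q\<bar> < \<epsilon> / (real q)\<^sup>2"
    and far: "\<And>i::int. 2 * \<epsilon> \<le> \<bar>2 * real q * x - of_int i\<bar>"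
  shows "horizontal_sum \<alpha> q x = (if even p then 0 else square_wave (real q * x))"
    and "vertical_sum \<alpha> q x = (if even p then square_wave (real q * x) else 0)"
proof -
  define c where "c = of_int p / real q"
  have qc: "real q * c = of_int p" using q by (simp add: c_def)
  have eps: "\<epsilon> > 0" 
  proof -
    have "0 < \<epsilon> / (real q)\<^sup>2" using approx by linarith
    then show ?thesis using q(1) by (simp add: zero_less_divide_iff)
  qed
  have fl: "\<lfloor>x + real j * \<alpha> + d\<rfloor> = \<lfloor>x + real j * c + d'\<rfloor>"
    if j: "j < q" and d: "\<bar>d - d'\<bar> \<le> \<bar>\<alpha> - c\<bar> / 2" and m: "2 * real q * d' = of_int m" for j d d' m
  proof (rule ccontr)
    assume ne: "\<lfloor>x + real j * \<alpha> + d\<rfloor> \<noteq> \<lfloor>x + real j * c + d'\<rfloor>"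
    define u v where "u = x + real j * \<alpha> + d" and "v = x + real j * c + d'"
    have "u - v = real j * (\<alpha> - c) + (d - d')" by (simp add: u_def v_def algebra_simps)
    then have "\<bar>u - v\<bar> \<le> \<bar>real j * (\<alpha> - c)\<bar> + \<bar>d - d'\<bar>" by linarith
    also have "\<dots> \<le> (real j + 1/2) * \<bar>\<alpha> - c\<bar>" using d by (simp only: abs_mult distrib_right)
    also have "\<dots> \<le> real q * \<bar>\<alpha> - c\<bar>" using j by (intro mult_right_mono) auto
    also have "\<dots> < real q * (\<epsilon> / (real q)\<^sup>2)" using approx q(1) unfolding c_def by (intro mult_strict_left_mono) auto
    also have "\<dots> = \<epsilon> / real q" using q(1) by (simp add: power2_eq_square)
    finally have uv: "\<bar>u - v\<bar> < \<epsilon> / real q" .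
    have "\<exists>i::int. \<bar>v - of_int i\<bar> \<le> \<bar>u - v\<bar>"
    proof (cases "\<lfloor>u\<rfloor> < \<lfloor>v\<rfloor>")
      case True
      then have "u < of_int \<lfloor>v\<rfloor>" "of_int \<lfloor>v\<rfloor> \<le> v" by linarith+
      then show ?thesis by (intro exI[of _ "\<lfloor>v\<rfloor>"]) linarith
    next
      case False
      then have "\<lfloor>v\<rfloor> < \<lfloor>u\<rfloor>" using ne by (simp add: u_def v_def)
      then have "v < of_int \<lfloor>u\<rfloor>" "of_int \<lfloor>u\<rfloor> \<le> u" by linarith+
      then show ?thesis by (intro exI[of _ "\<lfloor>u\<rfloor>"]) linarith
    qed
    then obtain i :: int where i: "\<bar>v - of_int i\<bar> < \<epsilon> / real q" using uv by (meson le_less_trans)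
    have "2 * real q * (v - of_int i) = 2 * real q * x - of_int (2 * int q * i - 2 * int j * p - m)"
      using m qc by (simp add: v_def algebra_simps)
    moreover have "\<bar>2 * real q * (v - of_int i)\<bar> < 2 * \<epsilon>"
    proof -
      have "\<bar>2 * real q * (v - of_int i)\<bar> = 2 * real q * \<bar>v - of_int i\<bar>" by (simp add: abs_mult)
      also have "\<dots> < 2 * real q * (\<epsilon> / real q)" using i q(1) by (intro mult_strict_left_mono) auto
      finally show ?thesis using q(1) by simp
    qed
    ultimately show False using far[of "2 * int q * i - 2 * int j * p - m"] by linarith
  qed
  have sw: "square_wave (x + real j * \<alpha>) = square_wave (x + real j * c)" if "j < q" for j
    using fl[OF that, of 0 0 0] fl[OF that, of "-1/2" "-1/2" "- int q"] by (simp add: square_wave_def)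
  have hs: "horizontal_step \<alpha> (x + real j * \<alpha>) = horizontal_step c (x + real j * c)" if "j < q" for j
  proof -
    have d: "\<bar>\<alpha>/2 - c/2\<bar> \<le> \<bar>\<alpha> - c\<bar> / 2" "\<bar>(\<alpha>/2 - 1/2) - (c/2 - 1/2)\<bar> \<le> \<bar>\<alpha> - c\<bar> / 2"
      by (auto simp: abs_if)
    have m: "2 * real q * (c/2) = of_int p" "2 * real q * (c/2 - 1/2) = of_int (p - int q)"
      using qc by (simp_all add: algebra_simps)
    show ?thesis
      using fl[OF that, of 0 0 0] fl[OF that, of "-1/2" "-1/2" "- int q"] fl[OF that d(1) m(1)] fl[OF that d(2) m(2)]
      by (simp add: horizontal_step_def algebra_simps)
  qed
  show h: "horizontal_sum \<alpha> q x = (if even p then 0 else square_wave (real q * x))"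
    unfolding rational_rotation_sums(2)[OF q cop, symmetric] horizontal_sum_def c_def[symmetric]
    by (intro sum.cong) (auto simp: hs)
  have "vertical_sum \<alpha> q x = (\<Sum>j<q. square_wave (x + real j * \<alpha>)) - horizontal_sum \<alpha> q x"
    by (simp add: vertical_sum_def vertical_step_def horizontal_sum_def sum_subtractf)
  also have "(\<Sum>j<q. square_wave (x + real j * \<alpha>)) = square_wave (real q * x)"
    unfolding rational_rotation_sums(1)[OF q cop, symmetric] c_def[symmetric]
    by (intro sum.cong) (auto simp: sw)
  finally show "vertical_sum \<alpha> q x = (if even p then square_wave (real q * x) else 0)"
    by (simp add: h)
qed

section \<open>Integration on the circle\<close>

lemma space_circle: "space circle = {0..<1}"
  by (simp add: circle_def)

lemma borel_measurable_circle: "f \<in> borel_measurable borel \<Longrightarrow> f \<in> borel_measurable circle"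
  unfolding circle_def
  by (intro measurable_restrict_space1 measurable_completion) simp

lemma prob_space_circle: "prob_space circle"
proof
  have "emeasure circle (space circle) = emeasure lebesgue ({0..<1}::real set)"
    unfolding space_circle unfolding circle_def by (subst emeasure_restrict_space) auto
  then show "emeasure circle (space circle) = 1" by simp
qed

interpretation circle: prob_space circle by (rule prob_space_circle)

lemma sets_circle_borel: "A \<in> sets borel \<Longrightarrow> A \<subseteq> {0..<1} \<Longrightarrow> A \<in> sets circle"
  unfolding circle_def by (auto simp: sets_restrict_space image_iff intro!: bexI[of _ A])

lemma measure_circle: "A \<in> sets borel \<Longrightarrow> A \<subseteq> {0..<1} \<Longrightarrow> measure circle A = measure lebesgue A"
  unfolding circle_def by (subst measure_restrict_space) auto

lemma integral_circle:
  fixes f :: "real \<Rightarrow> real"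
  assumes "f \<in> borel_measurable borel"
  shows "integral\<^sup>L circle f = (LINT x:{0..<1}|lborel. f x)"
proof -
  have "integral\<^sup>L circle f = (LINT x|lebesgue. indicator {0..<1} x *\<^sub>R f x)"
    unfolding circle_def by (subst integral_restrict_space) auto
  also have "\<dots> = (LINT x|lborel. indicator {0..<1} x *\<^sub>R f x)"
    using assms by (intro integral_completion) auto
  finally show ?thesis by (simp add: set_lebesgue_integral_def)
qed

lemma integrable_circle_bounded:
  fixes f :: "real \<Rightarrow> real"
  assumes "f \<in> borel_measurable borel" "\<And>x. \<bar>f x\<bar> \<le> B"
  shows "integrable circle f"
  using assms by (intro circle.integrable_const_bound[of _ B]) (auto intro: borel_measurable_circle)

text \<open>Invariance of Lebesgue measure under rotation, for periodic functions on the line.\<close>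

lemma integral_circle_rotate:
  fixes g :: "real \<Rightarrow> real"
  assumes g: "g \<in> borel_measurable borel" and per: "\<And>x. g (x + 1) = g x"
    and bd: "\<And>x. \<bar>g x\<bar> \<le> B" and h: "0 \<le> h" "h \<le> 1"
  shows "(\<integral>x. g (x + h) \<partial>circle) = (\<integral>x. g x \<partial>circle)"
proof -
  have [measurable]: "g \<in> borel_measurable borel" by (rule g)
  have int: "set_integrable lborel {c..<d} g" for c d
  proof -
    have ind: "integrable lborel (indicator {c..<d} :: real \<Rightarrow> real)"
      by (cases "c \<le> d") (auto intro!: integrable_real_indicator)
    have "integrable lborel (\<lambda>x. indicator {c..<d} x *\<^sub>R g x)"
      by (rule Bochner_Integration.integrable_bound[OF integrable_mult_right[OF ind, of B]])
         (use bd in \<open>auto simp: abs_mult indicator_def intro: order_trans[OF _ abs_ge_self]\<close>)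
    then show ?thesis by (simp add: set_integrable_def)
  qed
  have tr: "(LINT x:{c..<d}|lborel. g (x + s)) = (LINT x:{c+s..<d+s}|lborel. g x)" for c d s
  proof -
    have "(LINT x:{c+s..<d+s}|lborel. g x) = \<bar>1\<bar> *\<^sub>R (LINT x|lborel. indicator {c+s..<d+s} (s + 1 * x) *\<^sub>R g (s + 1 * x))"
      unfolding set_lebesgue_integral_def by (rule lborel_integral_real_affine) simp
    also have "\<dots> = (LINT x:{c..<d}|lborel. g (x + s))"
      unfolding set_lebesgue_integral_def
      by (auto intro!: Bochner_Integration.integral_cong simp: indicator_def add.commute)
    finally show ?thesis by simp
  qed
  have "(\<integral>x. g (x + h) \<partial>circle) = (LINT x:{h..<1+h}|lborel. g x)"
    using tr[of 0 1 h] by (subst integral_circle) auto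
  also have "\<dots> = (LINT x:{h..<1} \<union> {1..<1+h}|lborel. g x)"
    using h by (intro arg_cong[where f = "\<lambda>A. set_lebesgue_integral lborel A g"]) auto
  also have "\<dots> = (LINT x:{h..<1}|lborel. g x) + (LINT x:{1..<1+h}|lborel. g x)"
    by (rule set_integral_Un) (auto intro: int)
  also have "(LINT x:{1..<1+h}|lborel. g x) = (LINT x:{0..<h}|lborel. g x)"
    using tr[of 0 h 1] per by (simp add: add.commute)
  also have "(LINT x:{h..<1}|lborel. g x) + \<dots> = (LINT x:{0..<h} \<union> {h..<1}|lborel. g x)"
    by (subst set_integral_Un) (auto intro: int)
  also have "{0..<h} \<union> {h..<1} = {0..<1}" using h by auto
  finally show ?thesis using g by (simp add: integral_circle)
qed

text \<open>The starting points excluded in the comparison with a random walk form finite unions of such sets,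
  namely points near the preimages of a discontinuity under an affine map of the circle.\<close>

definition near_integer_set :: "real \<Rightarrow> real \<Rightarrow> real \<Rightarrow> real set" where
  "near_integer_set N d \<eta> = {x \<in> {0..<1}. \<exists>i::int. \<bar>N * x + d - of_int i\<bar> \<le> \<eta>}"

lemma near_integer_set_borel: "near_integer_set N d \<eta> \<in> sets borel"
proof -
  have "near_integer_set N d \<eta> = {0..<1} \<inter> (\<Union>i::int. {x. \<bar>N * x + d - of_int i\<bar> \<le> \<eta>})"
    by (auto simp: near_integer_set_def)
  moreover have "{x. \<bar>N * x + d - of_int i\<bar> \<le> \<eta>} \<in> sets borel" for i :: int
    by (intro borel_closed closed_Collect_le continuous_intros)
  ultimately show ?thesis by auto
qed

text \<open>At most \<open>N + 2\<close> integers lie within \<open>\<eta>\<close> of the interval \<open>[d, d + N]\<close>, and each of them accounts for an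
  interval of length \<open>2 \<eta>/N\<close>.\<close>

lemma measure_near_integer_set:
  assumes N: "N \<ge> 1" and \<eta>: "0 \<le> \<eta>" "\<eta> \<le> 1/2"
  shows "measure circle (near_integer_set N d \<eta>) \<le> 6 * \<eta>"
proof -
  define I where "I = {\<lceil>d - \<eta>\<rceil>..\<lfloor>N + d + \<eta>\<rfloor>}"
  define J where "J i = {(of_int i - d - \<eta>) / N..(of_int i - d + \<eta>) / N}" for i :: int
  have sub: "near_integer_set N d \<eta> \<subseteq> (\<Union>i\<in>I. J i)"
  proof
    fix x assume "x \<in> near_integer_set N d \<eta>"
    then obtain i :: int where x: "0 \<le> x" "x < 1" "\<bar>N * x + d - of_int i\<bar> \<le> \<eta>"
      by (auto simp: near_integer_set_def)
    have "0 \<le> N * x" "N * x \<le> N" using x N by (auto simp: mult_left_le)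
    then have "i \<in> I" using x(3) unfolding I_def by (auto simp: ceiling_le_iff le_floor_iff)
    moreover have "x \<in> J i" using x(3) N by (auto simp: J_def field_simps abs_le_iff)
    ultimately show "x \<in> (\<Union>i\<in>I. J i)" by blast
  qed
  have "measure circle (near_integer_set N d \<eta>) = measure lebesgue (near_integer_set N d \<eta>)"
    by (rule measure_circle[OF near_integer_set_borel]) (auto simp: near_integer_set_def)
  also have "\<dots> \<le> measure lebesgue (\<Union>i\<in>I. J i)"
    using near_integer_set_borel
    by (intro measure_mono_fmeasurable[OF sub]) (auto simp: I_def J_def intro!: fmeasurable.finite_UN)
  also have "\<dots> \<le> (\<Sum>i\<in>I. measure lebesgue (J i))"
    by (rule measure_UNION_le) (auto simp: I_def J_def)
  also have "\<dots> = real (card I) * (2 * \<eta> / N)"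
    using N \<eta> by (simp add: J_def divide_right_mono diff_divide_distrib[symmetric])
  also have "\<dots> \<le> (N + 2) * (2 * \<eta> / N)"
  proof (intro mult_right_mono)
    have "real (card I) \<le> max 0 (of_int (\<lfloor>N + d + \<eta>\<rfloor> - \<lceil>d - \<eta>\<rceil> + 1))" by (simp add: I_def)
    also have "\<dots> \<le> N + 2" using N \<eta> by linarith
    finally show "real (card I) \<le> N + 2" .
  qed (use N \<eta> in auto)
  also have "\<dots> \<le> 6 * \<eta>"
  proof -
    have "(N + 2) * (2 * \<eta>) \<le> (3 * N) * (2 * \<eta>)" using N \<eta> by (intro mult_right_mono) auto
    then show ?thesis using N by (simp add: field_simps)
  qed
  finally show ?thesis .
qed

section \<open>Displacement sums that mimic a random walk\<close>

definition displace_argument :: "bool \<Rightarrow> int \<Rightarrow> (int \<Rightarrow> int \<Rightarrow> real) \<Rightarrow> int \<Rightarrow> int \<Rightarrow> real" where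
  "displace_argument b s F u v = (if b then F (u + s) v else F u (v + s))"

text \<open>The expectation of \<open>F\<close> at the end point of a planar walk with independent fair \<open>\<plusminus>1\<close> steps,
  where the list tells for every step whether it is horizontal.  The
  recursion displaces the argument of \<open>F\<close>, which is also how a further block acts on \<open>sums_mean\<close>.\<close>

fun walk_mean :: "bool list \<Rightarrow> (int \<Rightarrow> int \<Rightarrow> real) \<Rightarrow> real" where
  "walk_mean [] F = F 0 0"
| "walk_mean (b # d) F = (walk_mean d (displace_argument b 1 F) + walk_mean d (displace_argument b (-1) F)) / 2"

lemma horizontal_sum_add: "horizontal_sum \<alpha> (L + q) x = horizontal_sum \<alpha> L x + horizontal_sum \<alpha> q (x + real L * \<alpha>)"
  by (induction q) (auto simp: horizontal_sum_def algebra_simps)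

lemma vertical_sum_add: "vertical_sum \<alpha> (L + q) x = vertical_sum \<alpha> L x + vertical_sum \<alpha> q (x + real L * \<alpha>)"
  by (induction q) (auto simp: vertical_sum_def algebra_simps)

lemma measurable_horizontal_sum: "horizontal_sum \<alpha> L \<in> measurable borel (count_space UNIV)"
proof -
  have [measurable]: "horizontal_step \<alpha> \<in> measurable borel (count_space UNIV)"
    unfolding horizontal_step_def[abs_def] by measurable
  show ?thesis
  proof (induction L)
    case (Suc L)
    have "horizontal_sum \<alpha> (Suc L) = (\<lambda>x. horizontal_sum \<alpha> L x + horizontal_step \<alpha> (x + real L * \<alpha>))"
      by (simp add: horizontal_sum_def fun_eq_iff)
    then show ?case using Suc[measurable] by simp
  qed (simp add: horizontal_sum_def[abs_def])
qed

lemma measurable_vertical_sum: "vertical_sum \<alpha> L \<in> measurable borel (count_space UNIV)"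
proof -
  have [measurable]: "vertical_step \<alpha> \<in> measurable borel (count_space UNIV)"
    unfolding vertical_step_def[abs_def] horizontal_step_def[abs_def] square_wave_def[abs_def] by measurable
  show ?thesis
  proof (induction L)
    case (Suc L)
    have "vertical_sum \<alpha> (Suc L) = (\<lambda>x. vertical_sum \<alpha> L x + vertical_step \<alpha> (x + real L * \<alpha>))"
      by (simp add: vertical_sum_def fun_eq_iff)
    then show ?case using Suc[measurable] by simp
  qed (simp add: vertical_sum_def[abs_def])
qed

lemma measurable_of_sums:
  fixes F :: "int \<Rightarrow> int \<Rightarrow> real"
  shows "(\<lambda>x. F (horizontal_sum \<alpha> L x) (vertical_sum \<alpha> L x)) \<in> borel_measurable borel"
proof (rule measurable_compose_countable[OF _ measurable_horizontal_sum])
  show "(\<lambda>x. F u (vertical_sum \<alpha> L x)) \<in> borel_measurable borel" for u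
    by (rule measurable_compose_countable[OF _ measurable_vertical_sum]) (rule measurable_const, simp)
qed

lemma horizontal_sum_periodic: "horizontal_sum \<alpha> L (x + 1) = horizontal_sum \<alpha> L x"
  using horizontal_step_periodic[of \<alpha> _ 1] by (simp add: horizontal_sum_def add.assoc add.commute[of 1]) (simp add: add.assoc[symmetric])

lemma vertical_sum_periodic: "vertical_sum \<alpha> L (x + 1) = vertical_sum \<alpha> L x"
  using horizontal_step_periodic[of \<alpha> _ 1] square_wave_periodic[of _ 1] 
  by (simp add: vertical_sum_def vertical_step_def add.assoc add.commute[of 1]) (simp add: add.assoc[symmetric])

text \<open>The sum of length \<open>L\<close> is a step function of \<open>x\<close>; it changes between \<open>x\<close> and \<open>x + h\<close> only if one of
  its finitely many break points lies between them.\<close>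

lemma sums_locally_constant:
  assumes x: "x \<in> {0..<1}" and h: "0 \<le> h"
    and far: "\<And>j c. j < L \<Longrightarrow> c \<in> {0, -1/2, \<alpha>/2, \<alpha>/2 - 1/2} \<Longrightarrow> x \<notin> near_integer_set 1 (real j * \<alpha> + c) h"
  shows "horizontal_sum \<alpha> L (x + h) = horizontal_sum \<alpha> L x"
    and "vertical_sum \<alpha> L (x + h) = vertical_sum \<alpha> L x"
proof -
  have fl: "\<lfloor>x + h + real j * \<alpha> + c\<rfloor> = \<lfloor>x + real j * \<alpha> + c\<rfloor>" if "j < L" "c \<in> {0, -1/2, \<alpha>/2, \<alpha>/2 - 1/2}" for j c
  proof (rule ccontr)
    assume ne: "\<lfloor>x + h + real j * \<alpha> + c\<rfloor> \<noteq> \<lfloor>x + real j * \<alpha> + c\<rfloor>"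
    define i where "i = \<lfloor>x + h + real j * \<alpha> + c\<rfloor>"
    have "\<lfloor>x + real j * \<alpha> + c\<rfloor> \<le> i" unfolding i_def using h by (intro floor_mono) auto
    then have "\<lfloor>x + real j * \<alpha> + c\<rfloor> < i" using ne by (simp add: i_def)
    then have "x + real j * \<alpha> + c < of_int i" by linarith
    moreover have "of_int i \<le> x + h + real j * \<alpha> + c" by (simp add: i_def)
    ultimately have "\<bar>1 * x + (real j * \<alpha> + c) - of_int i\<bar> \<le> h" by linarith
    then show False using far[OF that] x unfolding near_integer_set_def by blast
  qed
  have st: "horizontal_step \<alpha> (x + h + real j * \<alpha>) = horizontal_step \<alpha> (x + real j * \<alpha>)"
    "square_wave (x + h + real j * \<alpha>) = square_wave (x + real j * \<alpha>)" if "j < L" for j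
    using fl[OF that, of 0] fl[OF that, of "-1/2"] fl[OF that, of "\<alpha>/2"] fl[OF that, of "\<alpha>/2 - 1/2"]
    by (auto simp: horizontal_step_def square_wave_def algebra_simps)
  show "horizontal_sum \<alpha> L (x + h) = horizontal_sum \<alpha> L x"
    and "vertical_sum \<alpha> L (x + h) = vertical_sum \<alpha> L x"
    by (auto simp: horizontal_sum_def vertical_sum_def vertical_step_def st)
qed

definition sums_mean :: "real \<Rightarrow> nat \<Rightarrow> (int \<Rightarrow> int \<Rightarrow> real) \<Rightarrow> real" where
  "sums_mean \<alpha> L F = (\<integral>x. F (horizontal_sum \<alpha> L x) (vertical_sum \<alpha> L x) \<partial>circle)"

text \<open>Let \<open>g\<close> be \<open>F\<close> of the sum of length \<open>L + q\<close>.  Its integral equals that of its translate by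
  \<open>h = 1/(2q)\<close>.  Outside a small set the block contributes \<open>w\<close> times a unit vector at \<open>x\<close> and \<open>- w\<close> times
  it at \<open>x + h\<close>, with \<open>w = \<plusminus>1\<close>, while the sum of length \<open>L\<close> is the same at both points; so
  \<open>g x + g (x + h)\<close> is the sum of the two displaced values of \<open>F\<close>, whatever the sign of \<open>w\<close>.  The bound is
  uniform in \<open>F\<close>, that is, it controls the total variation distance of the laws.\<close>

lemma append_block:
  assumes vwa: "very_well_approximable (if b then 1 else 0) 1 \<alpha>" and \<eta>: "\<eta> > 0"
  shows "\<exists>q>0. \<forall>F. (\<forall>u v. \<bar>F u v\<bar> \<le> 1) \<longrightarrow>
    \<bar>sums_mean \<alpha> (L + q) F - (sums_mean \<alpha> L (displace_argument b 1 F) + sums_mean \<alpha> L (displace_argument b (-1) F)) / 2\<bar> \<le> \<eta>"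
proof -
  \<comment> \<open>the two exceptional sets have measure at most \<open>12 \<epsilon>\<close> and \<open>24 L h\<close>, and enter twice\<close>
  define \<epsilon> where "\<epsilon> = min (1/4) (\<eta>/48)"
  have \<epsilon>: "0 < \<epsilon>" "\<epsilon> \<le> 1/4" "48 * \<epsilon> \<le> \<eta>" using \<eta> by (auto simp: \<epsilon>_def)
  obtain N :: nat where N: "48 * real L / \<eta> < real N" using reals_Archimedean2 by blast
  obtain p q' where pq: "coprime p q'" "q' > int N" "even (p - (if b then 1 else 0))" "even (q' - 1)"
      "\<bar>\<alpha> - of_int p / of_int q'\<bar> < \<epsilon> / (of_int q')\<^sup>2"
    using vwa \<epsilon>(1) unfolding very_well_approximable_def by blast
  define q where "q = nat q'"
  have q: "q > 0" "odd q" "coprime p (int q)" "\<bar>\<alpha> - of_int p / real q\<bar> < \<epsilon> / (real q)\<^sup>2" "q > N"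
    and b: "b \<longleftrightarrow> odd p"
    using pq by (auto simp: q_def even_nat_iff split: if_splits)
  define h where "h = 1 / (2 * real q)"
  have h: "0 < h" "h \<le> 1/2" using q(1) by (auto simp: h_def field_simps)
  define C where "C = {0, -1/2, \<alpha>/2, \<alpha>/2 - 1/2}"
  \<comment> \<open>on \<open>bad1\<close> the block may differ from its rational model; on \<open>bad2\<close> the previous sum may change\<close>
  define bad1 where "bad1 = near_integer_set (2 * real q) (2 * real q * (real L * \<alpha>)) (2 * \<epsilon>)"
  define bad2 where "bad2 = (\<Union>(j, c)\<in>{..<L} \<times> C. near_integer_set 1 (real j * \<alpha> + c) h)"
  have [measurable]: "bad1 \<in> sets borel" "bad2 \<in> sets borel"
    unfolding bad1_def bad2_def C_def by (auto simp: near_integer_set_borel)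
  have sub: "bad1 \<subseteq> {0..<1}" "bad2 \<subseteq> {0..<1}" by (auto simp: bad1_def bad2_def near_integer_set_def)
  have m1: "measure circle bad1 \<le> 12 * \<epsilon>"
    using measure_near_integer_set[of "2 * real q" "2 * \<epsilon>" "2 * real q * (real L * \<alpha>)"] q(1) \<epsilon> by (simp add: bad1_def)
  have m2: "measure circle bad2 \<le> 24 * real L * h"
  proof -
    have "measure circle bad2 \<le> (\<Sum>(j, c)\<in>{..<L} \<times> C. measure circle (near_integer_set 1 (real j * \<alpha> + c) h))"
      unfolding bad2_def case_prod_unfold
      by (rule measure_UNION_le) (auto simp: C_def near_integer_set_def intro!: sets_circle_borel near_integer_set_borel[unfolded near_integer_set_def])
    also have "\<dots> \<le> (\<Sum>(j, c)\<in>{..<L} \<times> C. 6 * h)"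
      by (intro sum_mono) (use h in \<open>auto intro!: measure_near_integer_set\<close>)
    also have "\<dots> = real L * real (card C) * (6 * h)" by (simp add: card_cartesian_product)
    also have "\<dots> \<le> real L * 4 * (6 * h)"
    proof -
      have "card C \<le> 4" unfolding C_def by (simp add: card_insert_if)
      then show ?thesis using h by (intro mult_right_mono mult_left_mono) auto
    qed
    finally show ?thesis by simp
  qed
  define bad where "bad = bad1 \<union> bad2"
  have badset: "bad \<in> sets circle" using sub by (auto simp: bad_def intro!: sets.Un sets_circle_borel)
  have mbad: "2 * measure circle bad \<le> \<eta>"
  proof -
    have "measure circle bad \<le> measure circle bad1 + measure circle bad2"
      unfolding bad_def using sub by (intro measure_Un_le sets_circle_borel) auto
    moreover have "48 * real L * h \<le> \<eta> / 2"
    proof -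
      have "48 * real L / \<eta> \<le> real q" using N q(5) by linarith
      then show ?thesis using \<eta> q(1) by (simp add: h_def field_simps)
    qed
    ultimately show ?thesis using m1 m2 \<epsilon>(3) by linarith
  qed
  have "\<bar>sums_mean \<alpha> (L + q) F - (sums_mean \<alpha> L (displace_argument b 1 F) + sums_mean \<alpha> L (displace_argument b (-1) F)) / 2\<bar> \<le> \<eta>"
    if F: "\<And>u v. \<bar>F u v\<bar> \<le> 1" for F
  proof -
    define g where "g x = F (horizontal_sum \<alpha> (L + q) x) (vertical_sum \<alpha> (L + q) x)" for x
    define G where "G s x = displace_argument b s F (horizontal_sum \<alpha> L x) (vertical_sum \<alpha> L x)" for s x
    have gm: "g \<in> borel_measurable borel" unfolding g_def[abs_def] by (rule measurable_of_sums)
    have Gm: "G s \<in> borel_measurable borel" for s unfolding G_def[abs_def] by (rule measurable_of_sums)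
    have g1: "\<bar>g x\<bar> \<le> 1" "\<bar>G s x\<bar> \<le> 1" for x s using F by (auto simp: g_def G_def displace_argument_def)
    have gm': "(\<lambda>x. g (x + h)) \<in> borel_measurable borel" using gm by measurable
    have int: "integrable circle g" "integrable circle (\<lambda>x. g (x + h))" "integrable circle (G s)" for s
      using gm gm' Gm g1 by (auto intro!: integrable_circle_bounded[where B = 1])
    have rot: "(\<integral>x. g (x + h) \<partial>circle) = (\<integral>x. g x \<partial>circle)"
      using g1 h by (intro integral_circle_rotate[OF gm, where B = 1])
        (simp_all add: g_def horizontal_sum_periodic vertical_sum_periodic)
    have good: "g x + g (x + h) = G 1 x + G (-1) x" if x: "x \<in> {0..<1}" "x \<notin> bad" for x
    proof -
      define y where "y = x + real L * \<alpha>"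
      define w where "w = square_wave (real q * y)"
      have far: "2 * \<epsilon> \<le> \<bar>2 * real q * y - of_int i\<bar>" for i :: int
      proof -
        have "\<not> \<bar>2 * real q * x + 2 * real q * (real L * \<alpha>) - of_int i\<bar> \<le> 2 * \<epsilon>"
          using x unfolding bad_def bad1_def near_integer_set_def by blast
        then show ?thesis by (simp add: y_def algebra_simps)
      qed
      have qh: "2 * real q * (y + h) = 2 * real q * y + 1" "real q * (y + h) = real q * y + 1/2"
        using q(1) by (simp_all add: h_def field_simps)
      have far': "2 * \<epsilon> \<le> \<bar>2 * real q * (y + h) - of_int i\<bar>" for i :: int
        using far[of "i - 1"] unfolding qh by (simp add: algebra_simps)
      have w': "square_wave (real q * (y + h)) = - w"
        unfolding qh w_def by (rule square_wave_half_shift)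
      note blk = sums_along_good_approximation[OF q(1-4) far] sums_along_good_approximation[OF q(1-4) far']
      have nb: "x \<notin> near_integer_set 1 (real j * \<alpha> + c) h" if "j < L" "c \<in> C" for j c
        using that x(2) unfolding bad_def bad2_def by blast
      have loc: "horizontal_sum \<alpha> L (x + h) = horizontal_sum \<alpha> L x" "vertical_sum \<alpha> L (x + h) = vertical_sum \<alpha> L x"
        using sums_locally_constant[OF x(1) less_imp_le[OF h(1)], of L \<alpha>] nb unfolding C_def by blast+
      have yh: "x + h + real L * \<alpha> = y + h" by (simp add: y_def)
      then have "g x = G w x" "g (x + h) = G (- w) x"
        using b by (auto simp: g_def G_def horizontal_sum_add vertical_sum_add loc blk w' yh displace_argument_def w_def y_def[symmetric])
      then show ?thesis using square_wave_values[of "real q * y"] unfolding w_def[symmetric] by auto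
    qed
    define D where "D x = g x + g (x + h) - (G 1 x + G (-1) x)" for x
    have D: "\<bar>D x\<bar> \<le> 4 * indicator bad x" if "x \<in> {0..<1}" for x
    proof (cases "x \<in> bad")
      case True
      then show ?thesis using g1(1)[of x] g1(1)[of "x + h"] g1(2)[of 1 x] g1(2)[of "-1" x] by (simp add: D_def)
    next
      case False
      then show ?thesis using good[OF that] by (simp add: D_def)
    qed
    have "(\<integral>x. D x \<partial>circle) = 2 * (sums_mean \<alpha> (L + q) F - (sums_mean \<alpha> L (displace_argument b 1 F) + sums_mean \<alpha> L (displace_argument b (-1) F)) / 2)"
      using int rot by (simp add: D_def[abs_def] sums_mean_def g_def[symmetric] G_def[symmetric] field_simps)
    moreover have "\<bar>\<integral>x. D x \<partial>circle\<bar> \<le> (\<integral>x. 4 * indicator bad x \<partial>circle)"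
    proof -
      have "norm (\<integral>x. D x \<partial>circle) \<le> (\<integral>x. 4 * indicator bad x \<partial>circle)"
        using D int badset
        by (intro Bochner_Integration.integral_norm_bound_integral integrable_mult_right integrable_real_indicator)
          (auto simp: circle.emeasure_finite less_top[symmetric] D_def[abs_def] space_circle)
      then show ?thesis by simp
    qed
    moreover have "(\<integral>x. 4 * indicator bad x \<partial>circle) = 4 * measure circle bad"
      using badset by simp
    ultimately have "\<bar>2 * (sums_mean \<alpha> (L + q) F - (sums_mean \<alpha> L (displace_argument b 1 F) + sums_mean \<alpha> L (displace_argument b (-1) F)) / 2)\<bar> \<le> 2 * \<eta>"
      using mbad by linarith
    then show ?thesis by (simp only: abs_mult) simp
  qed
  then show ?thesis using q(1) by blast
qed

text \<open>Induction on the number of steps of the walk: the next block is chosen after, and depending on, the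
  length reached so far.\<close>

lemma sums_mimic_walk:
  assumes vwa: "\<And>b. very_well_approximable (if b then 1 else 0) 1 \<alpha>" and \<eta>: "\<eta> > 0"
  shows "\<exists>L. (d \<noteq> [] \<longrightarrow> L > 0) \<and> (\<forall>F. (\<forall>u v. \<bar>F u v\<bar> \<le> 1) \<longrightarrow> \<bar>sums_mean \<alpha> L F - walk_mean d F\<bar> \<le> \<eta>)"
  using \<eta>
proof (induction d arbitrary: \<eta>)
  case Nil
  have "sums_mean \<alpha> 0 F = walk_mean [] F" for F
    by (simp add: sums_mean_def horizontal_sum_def vertical_sum_def circle.prob_space)
  then show ?case using Nil by (intro exI[of _ 0]) simp
next
  case (Cons b d)
  obtain L where L: "\<And>F. (\<And>u v. \<bar>F u v\<bar> \<le> 1) \<Longrightarrow> \<bar>sums_mean \<alpha> L F - walk_mean d F\<bar> \<le> \<eta>/2"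
    using Cons.IH[of "\<eta>/2"] Cons.prems by auto
  obtain q where q: "q > 0" "\<And>F. (\<And>u v. \<bar>F u v\<bar> \<le> 1) \<Longrightarrow>
    \<bar>sums_mean \<alpha> (L + q) F - (sums_mean \<alpha> L (displace_argument b 1 F) + sums_mean \<alpha> L (displace_argument b (-1) F)) / 2\<bar> \<le> \<eta>/2"
    using append_block[OF vwa, of "\<eta>/2" L b] Cons.prems by auto
  have "\<bar>sums_mean \<alpha> (L + q) F - walk_mean (b # d) F\<bar> \<le> \<eta>" if F: "\<And>u v. \<bar>F u v\<bar> \<le> 1" for F
  proof -
    have "\<bar>displace_argument b s F u v\<bar> \<le> 1" for s u v using F by (simp add: displace_argument_def)
    then have "\<bar>sums_mean \<alpha> L (displace_argument b s F) - walk_mean d (displace_argument b s F)\<bar> \<le> \<eta>/2" for s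
      by (rule L)
    from this[of 1] this[of "-1"] q(2)[of F, OF F] show ?thesis unfolding walk_mean.simps by argo
  qed
  then show ?case using q(1) by (intro exI[of _ "L + q"]) auto
qed

section \<open>The central limit theorem for planar walks\<close>

primrec walk_pmf :: "nat \<Rightarrow> int pmf" where
  "walk_pmf 0 = return_pmf 0"
| "walk_pmf (Suc n) = pmf_of_set {1, -1} \<bind> (\<lambda>s. map_pmf (\<lambda>i. i + s) (walk_pmf n))"

lemma finite_walk_pmf: "finite (set_pmf (walk_pmf n))"
  by (induction n) auto

lemma expectation_walk_pmf_Suc:
  fixes h :: "int \<Rightarrow> 'c::{banach, second_countable_topology}"
  shows "measure_pmf.expectation (walk_pmf (Suc n)) h =
    (1/2) *\<^sub>R (measure_pmf.expectation (walk_pmf n) (\<lambda>i. h (i + 1)) + measure_pmf.expectation (walk_pmf n) (\<lambda>i. h (i - 1)))"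
proof -
  have "measure_pmf.expectation (walk_pmf (Suc n)) h =
     (\<Sum>a\<in>{1, -1}. measure_pmf.expectation (map_pmf (\<lambda>i. i + a) (walk_pmf n)) h /\<^sub>R real (card {1::int, -1}))"
    unfolding walk_pmf.simps by (rule pmf_expectation_bind_pmf_of_set) (auto simp: finite_walk_pmf)
  then show ?thesis by (simp add: scaleR_add_right)
qed

lemma walk_mean_replicate:
  "walk_mean (replicate n b @ d) F =
     measure_pmf.expectation (walk_pmf n) (\<lambda>i. walk_mean d (displace_argument b i F))"
proof (induction n arbitrary: F)
  case 0
  have "displace_argument b 0 F = F" by (auto simp: displace_argument_def fun_eq_iff)
  then show ?case by simp
next
  case (Suc n)
  have sh: "displace_argument b i (displace_argument b 1 F) = displace_argument b (i + 1) F"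
    "displace_argument b i (displace_argument b (-1) F) = displace_argument b (i - 1) F" for i
    by (auto simp: displace_argument_def fun_eq_iff algebra_simps)
  show ?case by (simp only: replicate_Suc append_Cons walk_mean.simps Suc.IH sh expectation_walk_pmf_Suc) simp
qed

text \<open>With the horizontal and the vertical steps collected, the coordinates are independent
  one-dimensional walks.\<close>

lemma walk_mean_two_walks:
  "walk_mean (replicate n True @ replicate m False) F =
     measure_pmf.expectation (walk_pmf n) (\<lambda>i. measure_pmf.expectation (walk_pmf m) (\<lambda>j. F i j))"
proof -
  have "walk_mean (replicate m False) G = measure_pmf.expectation (walk_pmf m) (\<lambda>j. G 0 j)" for G
    using walk_mean_replicate[of m False "[]" G] by (simp add: displace_argument_def)
  then show ?thesis by (simp add: walk_mean_replicate) (simp add: displace_argument_def)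
qed

definition walk_distr :: "nat \<Rightarrow> real measure" where
  "walk_distr n = distr (measure_pmf (walk_pmf n)) borel (\<lambda>i. of_int i / sqrt (real n))"

lemma real_distribution_walk_distr: "real_distribution (walk_distr n)"
  unfolding walk_distr_def by (intro prob_space.real_distribution_distr) (auto intro: measure_pmf.prob_space_axioms)

lemma char_walk_distr: "char (walk_distr n) t = complex_of_real (cos (t / sqrt (real n)) ^ n)"
proof -
  have "measure_pmf.expectation (walk_pmf m) (\<lambda>i. iexp (c * of_int i)) = complex_of_real (cos c ^ m)" for m c
  proof (induction m)
    case (Suc m)
    have e: "iexp (c * of_int (i + 1)) = iexp c * iexp (c * of_int i)" "iexp (c * of_int (i - 1)) = iexp (-c) * iexp (c * of_int i)" for i :: int
      by (simp_all add: algebra_simps flip: exp_add)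
    have "measure_pmf.expectation (walk_pmf (Suc m)) (\<lambda>i. iexp (c * of_int i)) =
      (1/2) *\<^sub>R ((iexp c + iexp (-c)) * complex_of_real (cos c ^ m))"
      unfolding expectation_walk_pmf_Suc e using Suc.IH by (simp add: ring_distribs)
    also have "iexp c + iexp (-c) = 2 * complex_of_real (cos c)"
      by (simp add: cos_exp_eq cos_of_real[symmetric])
    finally show ?case by (simp add: scaleR_conv_of_real)
  qed simp
  from this[of n "t / sqrt (real n)"] show ?thesis
    unfolding char_def walk_distr_def by (subst integral_distr) (auto simp: field_simps)
qed

text \<open>The characteristic function at \<open>t\<close> is \<open>cos (t/\<surd>n) ^ n\<close>, which tends to \<open>exp (-t\<^sup>2/2)\<close>.\<close>

lemma weak_conv_walk_distr: "weak_conv_m walk_distr std_normal_distribution"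
proof (rule levy_continuity[OF real_distribution_walk_distr real_dist_normal_dist])
  fix t :: real
  have pos: "(\<lambda>n. cos (t / sqrt (real n)) ^ n) \<longlonglongrightarrow> exp (- t\<^sup>2 / 2)" if "t > 0" for t
  proof -
    have "(\<lambda>n. cos (t / sqrt (real n)) ^ n) \<longlonglongrightarrow> exp (- (t * t / 2))" using that by real_asymp
    then show ?thesis by (simp add: power2_eq_square)
  qed
  have "(\<lambda>n. cos (t / sqrt (real n)) ^ n) \<longlonglongrightarrow> exp (- t\<^sup>2 / 2)"
    using pos[of t] pos[of "-t"] by (cases t "0::real" rule: linorder_cases) auto
  then show "(\<lambda>n. char (walk_distr n) t) \<longlonglongrightarrow> char std_normal_distribution t"
    unfolding char_walk_distr char_std_normal_distribution by (intro tendsto_of_real) simp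
qed

text \<open>Skorohod's representation turns the convergence in law of each coordinate into pointwise
  convergence, and dominated convergence in both variables gives the claim.  The integrand may vary with
  \<open>n\<close>: besides fixed continuous functions, this covers oscillations over shrinking balls.\<close>

lemma planar_walk_limit:
  fixes g :: "nat \<Rightarrow> real \<times> real \<Rightarrow> real" and g' :: "real \<times> real \<Rightarrow> real"
  assumes meas: "\<And>n. g n \<in> borel_measurable borel" and bd: "\<And>n p. \<bar>g n p\<bar> \<le> B"
    and meas': "g' \<in> borel_measurable borel"
    and conv: "\<And>p p'. p \<longlonglongrightarrow> p' \<Longrightarrow> (\<lambda>n. g n (p n)) \<longlonglongrightarrow> g' p'"
  shows "(\<lambda>n. walk_mean (replicate n True @ replicate n False)
             (\<lambda>i j. g n (of_int i / sqrt (real n), of_int j / sqrt (real n))))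
     \<longlonglongrightarrow> (\<integral>x. (\<integral>y. g' (x, y) \<partial>std_normal_distribution) \<partial>std_normal_distribution)"
proof -
  obtain \<Omega> :: "real measure" and Z :: "nat \<Rightarrow> real \<Rightarrow> real" and Y :: "real \<Rightarrow> real" where
    \<Omega>: "prob_space \<Omega>" and Z: "\<And>n. Z n \<in> borel_measurable \<Omega>" "\<And>n. distr \<Omega> borel (Z n) = walk_distr n"
    and Y: "Y \<in> borel_measurable \<Omega>" "distr \<Omega> borel Y = std_normal_distribution"
    and lim: "\<And>x. x \<in> space \<Omega> \<Longrightarrow> (\<lambda>n. Z n x) \<longlonglongrightarrow> Y x"
    proof -
    from Skorohod[OF real_distribution_walk_distr real_dist_normal_dist weak_conv_walk_distr]
    obtain \<Omega> :: "real measure" and Z :: "nat \<Rightarrow> real \<Rightarrow> real" and Y :: "real \<Rightarrow> real" where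
      "prob_space \<Omega> \<and> (\<forall>n. Z n \<in> borel_measurable \<Omega>) \<and> (\<forall>n. distr \<Omega> borel (Z n) = walk_distr n) \<and>
       Y \<in> measurable \<Omega> lborel \<and> distr \<Omega> borel Y = std_normal_distribution \<and>
       (\<forall>x\<in>space \<Omega>. (\<lambda>n. Z n x) \<longlonglongrightarrow> Y x)" by blast
    then show thesis by (intro that[of \<Omega> Z Y]) simp_all
  qed
  interpret \<Omega>: prob_space \<Omega> by fact
  note [measurable] = meas meas' Z(1) Y(1)
  have gb[measurable]: "g n \<in> borel_measurable (borel \<Otimes>\<^sub>M borel)" "g' \<in> borel_measurable (borel \<Otimes>\<^sub>M borel)" for n
    by (simp_all add: borel_prod meas meas')
  have bd': "\<bar>g' p\<bar> \<le> B" for p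
  proof -
    have "(\<lambda>n. \<bar>g n p\<bar>) \<longlonglongrightarrow> \<bar>g' p\<bar>" by (intro tendsto_rabs conv) simp
    then show ?thesis by (rule LIMSEQ_le_const2) (use bd in auto)
  qed
  have tr: "measure_pmf.expectation (walk_pmf n) (\<lambda>i. h (of_int i / sqrt (real n))) = (\<integral>s. h (Z n s) \<partial>\<Omega>)"
    if h: "h \<in> borel_measurable borel" for h :: "real \<Rightarrow> real" and n
  proof -
    have "(\<integral>s. h (Z n s) \<partial>\<Omega>) = (\<integral>x. h x \<partial>walk_distr n)"
      unfolding Z(2)[symmetric] using h Z(1) by (subst integral_distr) auto
    also have "\<dots> = measure_pmf.expectation (walk_pmf n) (\<lambda>i. h (of_int i / sqrt (real n)))"
      unfolding walk_distr_def using h by (subst integral_distr) auto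
    finally show ?thesis by simp
  qed
  have Wn: "walk_mean (replicate n True @ replicate n False)
      (\<lambda>i j. g n (of_int i / sqrt (real n), of_int j / sqrt (real n))) = (\<integral>s. (\<integral>t. g n (Z n s, Z n t) \<partial>\<Omega>) \<partial>\<Omega>)" for n
  proof -
    have "walk_mean (replicate n True @ replicate n False)
      (\<lambda>i j. g n (of_int i / sqrt (real n), of_int j / sqrt (real n))) =
      measure_pmf.expectation (walk_pmf n) (\<lambda>i. (\<integral>t. g n (of_int i / sqrt (real n), Z n t) \<partial>\<Omega>))"
      unfolding walk_mean_two_walks by (subst tr) auto
    also have "\<dots> = (\<integral>s. (\<integral>t. g n (Z n s, Z n t) \<partial>\<Omega>) \<partial>\<Omega>)"
      by (rule tr[of "\<lambda>u. (\<integral>t. g n (u, Z n t) \<partial>\<Omega>)" n]) measurable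
    finally show ?thesis .
  qed
  have inner: "(\<lambda>n. (\<integral>t. g n (Z n s, Z n t) \<partial>\<Omega>)) \<longlonglongrightarrow> (\<integral>t. g' (Y s, Y t) \<partial>\<Omega>)" if s: "s \<in> space \<Omega>" for s
  proof (rule integral_dominated_convergence[where w = "\<lambda>_. B"])
    show "AE t in \<Omega>. (\<lambda>n. g n (Z n s, Z n t)) \<longlonglongrightarrow> g' (Y s, Y t)"
      using s lim by (intro AE_I2 conv tendsto_Pair) auto
  qed (use bd s in auto)
  have ib: "\<bar>\<integral>t. g n (u, Z n t) \<partial>\<Omega>\<bar> \<le> B" for n u
  proof -
    have "\<bar>\<integral>t. g n (u, Z n t) \<partial>\<Omega>\<bar> \<le> (\<integral>t. \<bar>g n (u, Z n t)\<bar> \<partial>\<Omega>)"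
      using integral_norm_bound[of \<Omega> "\<lambda>t. g n (u, Z n t)"] by simp
    also have "\<dots> \<le> (\<integral>t. B \<partial>\<Omega>)"
    proof (rule Bochner_Integration.integral_mono)
      show "integrable \<Omega> (\<lambda>t. \<bar>g n (u, Z n t)\<bar>)"
        by (rule \<Omega>.integrable_const_bound[where B = B]) (use bd in auto)
    qed (use bd in auto)
    finally show ?thesis by (simp add: \<Omega>.prob_space)
  qed
  have "(\<lambda>n. (\<integral>s. (\<integral>t. g n (Z n s, Z n t) \<partial>\<Omega>) \<partial>\<Omega>)) \<longlonglongrightarrow> (\<integral>s. (\<integral>t. g' (Y s, Y t) \<partial>\<Omega>) \<partial>\<Omega>)"
    by (rule integral_dominated_convergence[where w = "\<lambda>_. B"]) (use ib inner in auto)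
  also have "(\<integral>s. (\<integral>t. g' (Y s, Y t) \<partial>\<Omega>) \<partial>\<Omega>) =
     (\<integral>x. (\<integral>y. g' (x, y) \<partial>std_normal_distribution) \<partial>std_normal_distribution)"
  proof -
    have "(\<integral>t. g' (x, Y t) \<partial>\<Omega>) = (\<integral>y. g' (x, y) \<partial>distr \<Omega> borel Y)" for x
      by (subst integral_distr) auto
    moreover have "(\<integral>s. (\<integral>t. g' (Y s, Y t) \<partial>\<Omega>) \<partial>\<Omega>) = (\<integral>x. (\<integral>t. g' (x, Y t) \<partial>\<Omega>) \<partial>distr \<Omega> borel Y)"
      by (subst integral_distr) auto
    ultimately show ?thesis using Y(2) by simp
  qed
  finally show ?thesis unfolding Wn .
qed

definition to_vec2 :: "real \<times> real \<Rightarrow> real^2" where "to_vec2 p = vector [fst p, snd p]"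

lemma to_vec2_nth [simp]: "to_vec2 p $ 1 = fst p" "to_vec2 p $ 2 = snd p"
  by (simp_all add: to_vec2_def)

lemma continuous_on_to_vec2: "continuous_on UNIV to_vec2"
proof -
  have "to_vec2 = (\<lambda>p. \<chi> i. if i = 1 then fst p else snd p)"
    by (auto simp: fun_eq_iff vec_eq_iff forall_2)
  moreover have "continuous_on UNIV (\<lambda>p. \<chi> i. if i = (1::2) then fst p else (snd p :: real))"
  proof (rule continuous_on_vec_lambda)
    show "continuous_on UNIV (\<lambda>p. if i = (1::2) then fst p else (snd p :: real))" for i
      by (cases "i = 1") (auto intro!: continuous_intros)
  qed
  ultimately show ?thesis by (simp only:)
qed

lemma to_vec2_measurable [measurable]: "to_vec2 \<in> borel_measurable (borel \<Otimes>\<^sub>M borel)"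
  unfolding borel_prod by (intro borel_measurable_continuous_onI continuous_on_to_vec2)

text \<open>Transports product measures from \<open>real \<times> real\<close> to \<open>real^2\<close>, where normal laws live.\<close>

lemma lborel_vec2: "(lborel :: (real^2) measure) = distr (lborel \<Otimes>\<^sub>M lborel) borel to_vec2"
proof (rule lborel_eqI)
  fix l u :: "real^2" assume lu: "\<And>b. b \<in> Basis \<Longrightarrow> l \<bullet> b \<le> u \<bullet> b"
  have B: "(Basis :: (real^2) set) = {axis 1 1, axis 2 1}" by (auto simp: Basis_vec_def UNIV_2)
  have le: "l $ 1 \<le> u $ 1" "l $ 2 \<le> u $ 2"
    using lu[of "axis 1 1"] lu[of "axis 2 1"] by (auto simp: B inner_axis)
  have "to_vec2 -` box l u = {l $ 1<..<u $ 1} \<times> {l $ 2<..<u $ 2}"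
    by (auto simp: mem_box_cart forall_2)
  then have "emeasure (distr (lborel \<Otimes>\<^sub>M lborel) borel to_vec2) (box l u) =
     emeasure (lborel \<Otimes>\<^sub>M lborel) ({l $ 1<..<u $ 1} \<times> {l $ 2<..<u $ 2})"
    by (subst emeasure_distr) (auto simp: space_pair_measure)
  also have "\<dots> = ennreal (u $ 1 - l $ 1) * ennreal (u $ 2 - l $ 2)"
    using le by (subst lborel.emeasure_pair_measure_Times) auto
  also have "\<dots> = (\<Prod>b\<in>Basis. (u - l) \<bullet> b)"
    using le by (simp add: B inner_axis axis_eq_axis ennreal_mult)
  finally show "emeasure (distr (lborel \<Otimes>\<^sub>M lborel) borel to_vec2) (box l u) = (\<Prod>b\<in>Basis. (u - l) \<bullet> b)" .
qed simp

definition isotropic_normal :: "real \<Rightarrow> (real^2) measure" where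
  "isotropic_normal \<sigma> = density lborel (\<lambda>y. ennreal (normal_density2 0 (mat (\<sigma>\<^sup>2)) y))"

lemma mat_vector_mult: "mat k *v (y :: real^2) = k *\<^sub>R y"
  by (simp add: vec_eq_iff matrix_vector_mult_def mat_def forall_2 sum_2)

lemma matrix_inv_mat:
  assumes "k \<noteq> (0::real)" shows "matrix_inv (mat k :: real^2^2) = mat (1 / k)"
proof -
  have e: "mat k ** mat (1/k) = (mat 1 :: real^2^2)" "mat (1/k) ** mat k = (mat 1 :: real^2^2)"
    using assms by (simp_all add: vec_eq_iff matrix_matrix_mult_def mat_def forall_2 sum_2)
  have "mat k ** matrix_inv (mat k :: real^2^2) = mat 1 \<and> matrix_inv (mat k :: real^2^2) ** mat k = mat 1"
    unfolding matrix_inv_def by (rule someI[of _ "mat (1/k)"]) (use e in simp)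
  then have "mat (1/k) ** (mat k ** matrix_inv (mat k :: real^2^2)) = mat (1/k)" by simp
  then show ?thesis unfolding matrix_mul_assoc e(2) by simp
qed

lemma nondegenerate_isotropic_normal: "\<sigma> \<noteq> 0 \<Longrightarrow> nondegenerate_normal_law (isotropic_normal \<sigma>)"
  unfolding nondegenerate_normal_law_def isotropic_normal_def
  by (intro exI[of _ 0] exI[of _ "mat (\<sigma>\<^sup>2)"]) (auto simp: mat_vector_mult transpose_mat)

lemma normal_density2_isotropic:
  assumes "\<sigma> > 0"
  shows "normal_density2 0 (mat (\<sigma>\<^sup>2)) y = normal_density 0 \<sigma> (y $ 1) * normal_density 0 \<sigma> (y $ 2)"
proof -
  have d: "det (mat (\<sigma>\<^sup>2) :: real^2^2) = (\<sigma>\<^sup>2)\<^sup>2" by (simp add: det_2 mat_def power2_eq_square)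
  have i: "y \<bullet> (matrix_inv (mat (\<sigma>\<^sup>2)) *v y) = ((y $ 1)\<^sup>2 + (y $ 2)\<^sup>2) / \<sigma>\<^sup>2"
    using assms by (subst matrix_inv_mat) (simp_all add: mat_vector_mult inner_vec_def sum_2 power2_eq_square add_divide_distrib)
  have s: "sqrt (2 * pi * \<sigma>\<^sup>2) * sqrt (2 * pi * \<sigma>\<^sup>2) = 2 * pi * \<sigma>\<^sup>2" by simp
  have "normal_density2 0 (mat (\<sigma>\<^sup>2)) y = exp (- (((y $ 1)\<^sup>2 + (y $ 2)\<^sup>2) / \<sigma>\<^sup>2) / 2) / (2 * pi * \<sigma>\<^sup>2)"
    unfolding normal_density2_def using i d assms by (simp add: power2_eq_square)
  also have "- (((y $ 1)\<^sup>2 + (y $ 2)\<^sup>2) / \<sigma>\<^sup>2) / 2 = - (y $ 1)\<^sup>2 / (2 * \<sigma>\<^sup>2) + - (y $ 2)\<^sup>2 / (2 * \<sigma>\<^sup>2)"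
    using assms by (simp add: field_simps)
  finally have lhs: "normal_density2 0 (mat (\<sigma>\<^sup>2)) y =
      exp (- (y $ 1)\<^sup>2 / (2 * \<sigma>\<^sup>2)) * exp (- (y $ 2)\<^sup>2 / (2 * \<sigma>\<^sup>2)) / (2 * pi * \<sigma>\<^sup>2)"
    unfolding exp_add .
  have "normal_density 0 \<sigma> (y $ 1) * normal_density 0 \<sigma> (y $ 2) =
      exp (- (y $ 1)\<^sup>2 / (2 * \<sigma>\<^sup>2)) * exp (- (y $ 2)\<^sup>2 / (2 * \<sigma>\<^sup>2)) / (sqrt (2 * pi * \<sigma>\<^sup>2) * sqrt (2 * pi * \<sigma>\<^sup>2))"
  proof -
    have "1 / r * e * (1 / r * e') = e * e' / (r * r)" for r e e' :: real by simp
    then show ?thesis unfolding normal_density_def diff_0_right .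
  qed
  then show ?thesis unfolding s lhs by simp
qed

text \<open>The coordinates of an isotropic normal vector are independent; the signs of \<open>\<sigma>1\<close> and \<open>\<sigma>2\<close> are
  arbitrary because the standard normal law is symmetric.\<close>

lemma integral_isotropic_normal:
  fixes f :: "real^2 \<Rightarrow> real"
  assumes f: "f \<in> borel_measurable borel" "\<And>y. \<bar>f y\<bar> \<le> B" and \<sigma>: "\<sigma> > 0" "\<bar>\<sigma>1\<bar> = \<sigma>" "\<bar>\<sigma>2\<bar> = \<sigma>"
  shows "(\<integral>y. f y \<partial>isotropic_normal \<sigma>) =
    (\<integral>x. (\<integral>y. f (to_vec2 (\<sigma>1 * x, \<sigma>2 * y)) \<partial>std_normal_distribution) \<partial>std_normal_distribution)"
proof -
  have [measurable]: "f \<in> borel_measurable borel" by fact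
  define N where "N = density lborel (\<lambda>x. ennreal (normal_density 0 \<sigma> x))"
  interpret N: prob_space N unfolding N_def using \<sigma> by (intro prob_space_normal_density)
  interpret S: prob_space std_normal_distribution by (rule prob_space_normal_density) simp
  have sc: "distr std_normal_distribution borel (\<lambda>x. s * x) = N" if "\<bar>s\<bar> = \<sigma>" for s
  proof -
    have "distributed std_normal_distribution lborel (\<lambda>x. x) (normal_density 0 1)"
      unfolding distributed_def by (auto simp: distr_id2)
    then have "distributed std_normal_distribution lborel (\<lambda>x. 0 + s * x) (normal_density (0 + s * 0) (\<bar>s\<bar> * 1))"
      by (rule S.normal_density_affine) (use that \<sigma> in auto)
    then have "distr std_normal_distribution lborel (\<lambda>x. s * x) = N"
      using that unfolding N_def distributed_def by simp
    then show ?thesis by (metis distr_cong sets_lborel)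
  qed
  have NN: "isotropic_normal \<sigma> = distr (N \<Otimes>\<^sub>M N) borel to_vec2"
  proof -
    have "isotropic_normal \<sigma> = density (distr (lborel \<Otimes>\<^sub>M lborel) borel to_vec2) (\<lambda>y. ennreal (normal_density 0 \<sigma> (y $ 1) * normal_density 0 \<sigma> (y $ 2)))"
      unfolding isotropic_normal_def lborel_vec2[symmetric] using \<sigma>(1) by (simp add: normal_density2_isotropic)
    also have "\<dots> = distr (density (lborel \<Otimes>\<^sub>M lborel) (\<lambda>p. ennreal (normal_density 0 \<sigma> (fst p) * normal_density 0 \<sigma> (snd p)))) borel to_vec2"
      by (subst density_distr) auto
    also have "density (lborel \<Otimes>\<^sub>M lborel) (\<lambda>p. ennreal (normal_density 0 \<sigma> (fst p) * normal_density 0 \<sigma> (snd p))) = N \<Otimes>\<^sub>M N"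
      unfolding N_def
      by (subst pair_measure_density)
        (auto simp: case_prod_unfold ennreal_mult' N_def[symmetric] intro!: lborel.sigma_finite_measure_axioms N.sigma_finite_measure_axioms)
    finally show ?thesis .
  qed
  interpret P: pair_prob_space N N ..
  have sN[measurable_cong]: "sets N = sets borel" by (simp add: N_def)
  have tr: "(\<integral>x. h x \<partial>N) = (\<integral>x. h (s * x) \<partial>std_normal_distribution)"
    if "\<bar>s\<bar> = \<sigma>" "h \<in> borel_measurable borel" for s and h :: "real \<Rightarrow> real"
    unfolding sc[OF that(1), symmetric] using that(2) by (subst integral_distr) auto
  have [measurable]: "to_vec2 \<in> borel_measurable (N \<Otimes>\<^sub>M N)"
    using to_vec2_measurable by (simp cong: measurable_cong_sets add: sets_pair_measure_cong[OF sN sN])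
  have "(\<integral>y. f y \<partial>isotropic_normal \<sigma>) = (\<integral>p. f (to_vec2 p) \<partial>(N \<Otimes>\<^sub>M N))"
    unfolding NN by (subst integral_distr) auto
  also have "\<dots> = (\<integral>x. (\<integral>y. f (to_vec2 (x, y)) \<partial>N) \<partial>N)"
    by (rule P.integral_fst'[symmetric]) (use f in \<open>auto intro!: P.integrable_const_bound[where B = B]\<close>)
  also have "\<dots> = (\<integral>x. (\<integral>y. f (to_vec2 (\<sigma>1 * x, y)) \<partial>N) \<partial>std_normal_distribution)"
    by (rule tr[OF \<sigma>(2)]) measurable
  also have "\<dots> = (\<integral>x. (\<integral>y. f (to_vec2 (\<sigma>1 * x, \<sigma>2 * y)) \<partial>std_normal_distribution) \<partial>std_normal_distribution)"
    by (subst tr[OF \<sigma>(3)]) auto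
  finally show ?thesis .
qed

section \<open>The collision map\<close>

text \<open>In coordinates in which the ball moves in direction \<open>(1,1)\<close> from a point of the top or right side of
  the obstacle at the origin: the difference of the coordinates is constant along the ray and less than
  \<open>(a + b)/2\<close> in absolute value, and an obstacle \<open>(i, j)\<close> is seen under differences within \<open>(a + b)/2\<close> of
  \<open>j - i\<close>.  As \<open>a + b \<le> 1\<close> only obstacles with \<open>i = j\<close> can be met, and the first of them is \<open>(1,1)\<close>.\<close>

lemma diagonal_ray_meets_next_obstacle:
  fixes a b c1 c2 :: real
  assumes ab: "0 < a" "a < 1" "0 < b" "b < 1" "a + b \<le> 1"
    and c: "\<bar>c1\<bar> \<le> a/2" "\<bar>c2\<bar> \<le> b/2" "c1 = a/2 \<or> c2 = b/2" and u: "\<bar>c2 - c1\<bar> < (a + b)/2"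
  defines "T \<equiv> max (1 - a/2 - c1) (1 - b/2 - c2)"
  shows "0 < T" and "\<bar>c1 + T - 1\<bar> \<le> a/2" and "\<bar>c2 + T - 1\<bar> \<le> b/2"
    and "\<And>t i j. 0 < t \<Longrightarrow> \<bar>c1 + t - of_int i\<bar> \<le> a/2 \<Longrightarrow> \<bar>c2 + t - of_int j\<bar> \<le> b/2 \<Longrightarrow> T \<le> t"
proof -
  have T: "1 - a/2 - c1 \<le> T" "1 - b/2 - c2 \<le> T" "T = 1 - a/2 - c1 \<or> T = 1 - b/2 - c2"
    by (auto simp: T_def max_def)
  show "0 < T" using T(1) ab c(1) by linarith
  show "\<bar>c1 + T - 1\<bar> \<le> a/2" using T ab c(1,2) u by linarith
  show "\<bar>c2 + T - 1\<bar> \<le> b/2" using T ab c(1,2) u by linarith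
  fix t :: real and i j :: int
  assume t: "0 < t" "\<bar>c1 + t - of_int i\<bar> \<le> a/2" "\<bar>c2 + t - of_int j\<bar> \<le> b/2"
  have "\<bar>of_int (j - i)\<bar> < (1::real)" 
    proof -
      have "c1 + t - of_int i \<le> a/2" "- (c1 + t - of_int i) \<le> a/2" "c2 + t - of_int j \<le> b/2"
        "- (c2 + t - of_int j) \<le> b/2" "c2 - c1 < (a + b)/2" "- (c2 - c1) < (a + b)/2"
        using t(2,3) u unfolding abs_le_iff abs_less_iff by blast+
      then have "of_int j - of_int i < (1::real)" "- (of_int j - of_int i) < (1::real)" using ab(5) by (simp_all add: field_simps)
      then show ?thesis by (simp add: abs_less_iff)
    qed
  then have ij: "j = i" by linarith
  have "0 < real_of_int i"
    using c(3)
  proof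
    assume "c1 = a/2" then show ?thesis using t(1,2) by (auto simp: abs_le_iff)
  next
    assume "c2 = b/2" then show ?thesis using t(1,3) ij by (auto simp: abs_le_iff)
  qed
  then have "1 \<le> real_of_int i" by simp
  then show "T \<le> t" using t(2,3) ij T by linarith
qed

lemma unit_factor:
  fixes z s :: real
  assumes "s = 1 \<or> s = -1"
  shows "\<bar>s * z\<bar> = \<bar>z\<bar>" "s * s = 1"
  using assms by auto

text \<open>The general case arises from the direction \<open>(1,1)\<close> by reflections \<open>s1, s2\<close> in the axes and a
  translation, under which the family of obstacles is invariant.  The position relative to the obstacle
  that is hit is \<open>(s1 d1, s2 d2)\<close>; since obstacles are disjoint, the side that is hit can be read off
  from \<open>d1\<close> and \<open>d2\<close>.\<close>

lemma free_time_and_collision: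
  fixes a b c1 c2 s1 s2 :: real and m1 m2 :: int
  assumes ab: "0 < a" "a < 1" "0 < b" "b < 1" "a + b \<le> 1"
    and c: "\<bar>c1\<bar> \<le> a/2" "\<bar>c2\<bar> \<le> b/2" "c1 = a/2 \<or> c2 = b/2" and u: "\<bar>c2 - c1\<bar> < (a + b)/2"
    and s: "s1 = 1 \<or> s1 = -1" "s2 = 1 \<or> s2 = -1"
  defines "T \<equiv> max (1 - a/2 - c1) (1 - b/2 - c2)"
  defines "d1 \<equiv> c1 + T - 1" and "d2 \<equiv> c2 + T - 1"
  defines "st \<equiv> (vector [of_int m1 + s1 * c1, of_int m2 + s2 * c2], vector [s1 / sqrt 2, s2 / sqrt 2]) :: state"
  shows "free_time a b st = sqrt 2 * T"
    and "poincare_map a b st =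
      (vector [of_int m1 + s1 + s1 * d1, of_int m2 + s2 + s2 * d2],
       vector [(if \<bar>d1\<bar> = a/2 then - s1 else s1) / sqrt 2, (if \<bar>d2\<bar> = b/2 then - s2 else s2) / sqrt 2])"
proof -
  note meet = diagonal_ray_meets_next_obstacle[OF ab c u, folded T_def]
  obtain e1 e2 :: int where e: "s1 = of_int e1" "s2 = of_int e2" "e1 * e1 = 1" "e2 * e2 = 1"
    using s by (metis mult_minus_left mult_minus_right mult_1 minus_minus of_int_1 of_int_minus)
  have pos: "fst st + t *\<^sub>R snd st = vector [of_int m1 + s1 * (c1 + t / sqrt 2), of_int m2 + s2 * (c2 + t / sqrt 2)]" for t
    by (simp add: st_def vec_eq_iff forall_2 algebra_simps)
  \<comment> \<open>seen from the ball, obstacle \<open>k\<close> has the integer coordinates \<open>e1 (k $ 1 - m1)\<close>, \<open>e2 (k $ 2 - m2)\<close>\<close>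
  have crd: "\<bar>of_int m1 + s1 * z - of_int k\<bar> = \<bar>z - of_int (e1 * (k - m1))\<bar>"
    "\<bar>of_int m2 + s2 * z - of_int k\<bar> = \<bar>z - of_int (e2 * (k - m2))\<bar>" for z k
  proof -
    have "s1 * (z - of_int (e1 * (k - m1))) = s1 * z - (s1 * s1) * (of_int k - of_int m1)"
      "s2 * (z - of_int (e2 * (k - m2))) = s2 * z - (s2 * s2) * (of_int k - of_int m2)"
      by (simp_all add: e(1,2) algebra_simps)
    then have "of_int m1 + s1 * z - of_int k = s1 * (z - of_int (e1 * (k - m1)))"
      "of_int m2 + s2 * z - of_int k = s2 * (z - of_int (e2 * (k - m2)))"
      using unit_factor(2)[OF s(1)] unit_factor(2)[OF s(2)] by auto
    then show "\<bar>of_int m1 + s1 * z - of_int k\<bar> = \<bar>z - of_int (e1 * (k - m1))\<bar>"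
    "\<bar>of_int m2 + s2 * z - of_int k\<bar> = \<bar>z - of_int (e2 * (k - m2))\<bar>"
      using unit_factor(1)[OF s(1)] unit_factor(1)[OF s(2)] by metis+
  qed
  have inob: "vector [of_int m1 + s1 * z1, of_int m2 + s2 * z2] \<in> obstacle a b k \<longleftrightarrow>
      \<bar>z1 - of_int (e1 * (k $ 1 - m1))\<bar> \<le> a/2 \<and> \<bar>z2 - of_int (e2 * (k $ 2 - m2))\<bar> \<le> b/2" for z1 z2 k
    by (simp add: obstacle_def crd)
  define k0 :: "int^2" where "k0 = vector [m1 + e1, m2 + e2]"
  have k0: "e1 * (k0 $ 1 - m1) = 1" "e2 * (k0 $ 2 - m2) = 1" by (simp_all add: k0_def e)
  show ft: "free_time a b st = sqrt 2 * T"
    unfolding free_time_def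
  proof (rule cInf_eq_minimum)
    have "fst st + (sqrt 2 * T) *\<^sub>R snd st \<in> obstacle a b k0"
      unfolding pos inob k0 using meet(2,3) by simp
    then show "sqrt 2 * T \<in> {t. 0 < t \<and> fst st + t *\<^sub>R snd st \<in> (\<Union>m. obstacle a b m)}"
      using meet(1) by auto
    fix t assume "t \<in> {t. 0 < t \<and> fst st + t *\<^sub>R snd st \<in> (\<Union>m. obstacle a b m)}"
    then obtain k where t: "0 < t" "fst st + t *\<^sub>R snd st \<in> obstacle a b k" by auto
    have "\<bar>c1 + t / sqrt 2 - of_int (e1 * (k $ 1 - m1))\<bar> \<le> a/2" "\<bar>c2 + t / sqrt 2 - of_int (e2 * (k $ 2 - m2))\<bar> \<le> b/2"
      using t(2) unfolding pos inob by auto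
    from meet(4)[OF _ this] have "T \<le> t / sqrt 2" using t(1) by simp
    then show "sqrt 2 * T \<le> t" by (simp add: field_simps)
  qed
  define q :: "real^2" where "q = vector [of_int m1 + s1 * (c1 + T), of_int m2 + s2 * (c2 + T)]"
  have q: "fst st + free_time a b st *\<^sub>R snd st = q" by (simp add: pos ft q_def)
  have q': "q = vector [of_int m1 + s1 + s1 * d1, of_int m2 + s2 + s2 * d2]"
    by (simp add: q_def d1_def d2_def algebra_simps)
  have only: "k = k0" if "q \<in> obstacle a b k" for k
  proof -
    have "\<bar>c1 + T - of_int (e1 * (k $ 1 - m1))\<bar> \<le> a/2" "\<bar>c2 + T - of_int (e2 * (k $ 2 - m2))\<bar> \<le> b/2"
      using that unfolding q_def inob by auto
    then have "\<bar>of_int (e1 * (k $ 1 - m1) - 1)\<bar> < (1::real)" "\<bar>of_int (e2 * (k $ 2 - m2) - 1)\<bar> < (1::real)"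
      unfolding of_int_diff of_int_1 using meet(2,3) ab(2,4) by linarith+
    then have "e1 * (k $ 1 - m1) = 1" "e2 * (k $ 2 - m2) = 1" by linarith+
    then have "e1 * (e1 * (k $ 1 - m1)) = e1" "e2 * (e2 * (k $ 2 - m2)) = e2" by simp_all
    then have "k $ 1 = m1 + e1" "k $ 2 = m2 + e2" using e(3,4) by (simp_all add: mult.assoc[symmetric])
    then show ?thesis by (simp add: k0_def vec_eq_iff forall_2)
  qed
  have in0: "q \<in> obstacle a b k0" unfolding q_def inob k0 using meet(2,3) by simp
  have "\<bar>q $ 1 - of_int (k0 $ 1)\<bar> = \<bar>d1\<bar>" "\<bar>q $ 2 - of_int (k0 $ 2)\<bar> = \<bar>d2\<bar>"
    unfolding q_def using k0 by (simp_all add: crd d1_def d2_def)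
  then have "on_vertical_side a b q \<longleftrightarrow> \<bar>d1\<bar> = a/2" "on_horizontal_side a b q \<longleftrightarrow> \<bar>d2\<bar> = b/2"
    unfolding on_vertical_side_def on_horizontal_side_def using in0 only by metis+
  then show "poincare_map a b st =
      (vector [of_int m1 + s1 + s1 * d1, of_int m2 + s2 + s2 * d2],
       vector [(if \<bar>d1\<bar> = a/2 then - s1 else s1) / sqrt 2, (if \<bar>d2\<bar> = b/2 then - s2 else s2) / sqrt 2])"
    unfolding poincare_map_def Let_def q reflect_def q'[symmetric] by (simp add: st_def)
qed


fun other_copy :: "copy \<Rightarrow> copy" where "other_copy Main_Dirs = Mirror_Dirs" | "other_copy Mirror_Dirs = Main_Dirs"

text \<open>On the mirror copy the picture is reflected in the vertical axis.\<close>

fun chirality :: "copy \<Rightarrow> int" where "chirality Main_Dirs = 1" | "chirality Mirror_Dirs = -1"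

lemma chirality_other_copy [simp]: "chirality (other_copy \<kappa>) = - chirality \<kappa>" by (cases \<kappa>) auto

lemma chirality_values: "chirality \<kappa> = 1 \<or> chirality \<kappa> = -1" by (cases \<kappa>) auto

text \<open>Both halves of the circle parametrise a pair of adjacent sides of total length \<open>a + b\<close>; this is the
  arc length from the start of the pair.\<close>

definition arc_offset :: "real \<Rightarrow> real \<Rightarrow> real \<Rightarrow> real" where
  "arc_offset a b x = (a + b) * frac (2 * x)"

definition corner_x :: "real \<Rightarrow> real \<Rightarrow> real" where "corner_x a s = min (s - a/2) (a/2)"
definition corner_y :: "real \<Rightarrow> real \<Rightarrow> real \<Rightarrow> real" where "corner_y a b s = min (b/2) (b/2 + a - s)"

text \<open>The state of the ball at the point of the given copy with parameter \<open>x\<close>, on the boundary of the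
  obstacle \<open>(m1, m2)\<close>.  All signs are square waves, so the expression makes sense for every real \<open>x\<close> and
  is periodic.\<close>

definition orbit_state :: "real \<Rightarrow> real \<Rightarrow> copy \<Rightarrow> int \<Rightarrow> int \<Rightarrow> real \<Rightarrow> state" where
  "orbit_state a b \<kappa> m1 m2 x =
    (vector [of_int m1 + of_int (chirality \<kappa> * square_wave x) * corner_x a (arc_offset a b x),
             of_int m2 + of_int (square_wave x) * corner_y a b (arc_offset a b x)],
     vector [of_int (chirality \<kappa> * square_wave x) / sqrt 2, of_int (square_wave x) / sqrt 2])"

lemma square_wave_01: "0 \<le> x \<Longrightarrow> x < 1 \<Longrightarrow> square_wave x = (if x < 1/2 then 1 else -1)"
proof -
  assume x: "0 \<le> x" "x < 1"
  then have "\<lfloor>x\<rfloor> = 0" "\<lfloor>x - 1/2\<rfloor> = (if x < 1/2 then -1 else 0)" by (auto simp: floor_eq_iff)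
  then show ?thesis by (simp add: square_wave_def)
qed

lemma frac_double: "0 \<le> x \<Longrightarrow> x < 1 \<Longrightarrow> frac (2 * x) = (if x < 1/2 then 2 * x else 2 * x - 1)"
  by (auto simp: frac_eq frac_unique_iff)

lemma initial_state_eq_orbit_state:
  assumes ab: "0 < a" "0 < b" and x: "0 \<le> x" "x < 1"
  shows "initial_state a b \<kappa> x = orbit_state a b \<kappa> 0 0 x"
proof -
  define l where "l = a + b"
  have l: "l > 0" using ab by (simp add: l_def)
  define s where "s = arc_offset a b x"
  have s: "0 \<le> s" "s < l" using l by (auto simp: s_def arc_offset_def l_def frac_lt_1 frac_ge_0)
  have sx: "2 * (a + b) * x = (if x < 1/2 then s else s + l)"
    unfolding s_def arc_offset_def frac_double[OF x] by (auto simp: l_def algebra_simps)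
  have bp: "boundary_point a b x = (if x < 1/2 then vector [corner_x a s, corner_y a b s] else vector [- corner_x a s, - corner_y a b s])"
    using s ab unfolding boundary_point_def Let_def sx
    by (auto simp: corner_x_def corner_y_def l_def min_def vec_eq_iff forall_2)
  have dirs: "direction (pi/4) = vector [1 / sqrt 2, 1 / sqrt 2]"
    "direction (pi + pi/4) = vector [- 1 / sqrt 2, - 1 / sqrt 2]"
    "direction (pi - pi/4) = vector [- 1 / sqrt 2, 1 / sqrt 2]"
    "direction (2 * pi - pi/4) = vector [1 / sqrt 2, - 1 / sqrt 2]"
  proof -
    have h: "sqrt 2 / 2 = 1 / sqrt 2" by (simp add: field_simps)
    show "direction (pi/4) = vector [1 / sqrt 2, 1 / sqrt 2]"
      unfolding direction_def cos_45 sin_45 h ..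
    show "direction (pi + pi/4) = vector [- 1 / sqrt 2, - 1 / sqrt 2]"
      unfolding direction_def cos_add sin_add cos_45 sin_45 h by simp
    show "direction (pi - pi/4) = vector [- 1 / sqrt 2, 1 / sqrt 2]"
      unfolding direction_def cos_diff sin_diff cos_45 sin_45 h by simp
    show "direction (2 * pi - pi/4) = vector [1 / sqrt 2, - 1 / sqrt 2]"
      unfolding direction_def cos_diff sin_diff cos_45 sin_45 h by simp
  qed
  show ?thesis
    by (cases \<kappa>; cases "x < 1/2")
       (simp_all only: initial_state.simps if_True if_False dirs bp orbit_state_def s_def[symmetric] square_wave_01[OF x],
        simp_all add: vec_eq_iff forall_2)
qed

text \<open>The parameters of the corners are \<open>0\<close>, \<open>\<alpha>/2\<close>, \<open>1/2\<close> and \<open>1/2 + \<alpha>/2\<close>, and a collision adds \<open>\<alpha>/2\<close>;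
  such an orbit, continued in both directions, never meets a corner.\<close>

definition avoids_corners :: "real \<Rightarrow> real \<Rightarrow> bool" where
  "avoids_corners \<alpha> x \<longleftrightarrow> (\<forall>j i::int. x + of_int j * (\<alpha>/2) \<noteq> of_int i / 2)"

lemma avoids_corners_shift: "avoids_corners \<alpha> x \<Longrightarrow> avoids_corners \<alpha> (x + of_int j * (\<alpha>/2))"
  unfolding avoids_corners_def
proof (intro allI)
  fix j' i :: int
  assume "\<forall>j i. x + real_of_int j * (\<alpha> / 2) \<noteq> real_of_int i / 2"
  then have "x + real_of_int (j + j') * (\<alpha> / 2) \<noteq> real_of_int i / 2" by blast
  moreover have "x + real_of_int j * (\<alpha> / 2) + real_of_int j' * (\<alpha> / 2) = x + real_of_int (j + j') * (\<alpha> / 2)"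
    by (simp add: field_simps)
  ultimately show "x + real_of_int j * (\<alpha> / 2) + real_of_int j' * (\<alpha> / 2) \<noteq> real_of_int i / 2" by simp
qed

lemma countable_meets_corner: "countable {x. \<not> avoids_corners \<alpha> x}"
proof -
  have "{x. \<not> avoids_corners \<alpha> x} \<subseteq> (\<lambda>(j::int, i::int). of_int i / 2 - of_int j * (\<alpha>/2)) ` UNIV"
  proof
    fix x assume "x \<in> {x. \<not> avoids_corners \<alpha> x}"
    then obtain j i :: int where "x + of_int j * (\<alpha>/2) = of_int i / 2" by (auto simp: avoids_corners_def)
    then have "x = of_int i / 2 - of_int j * (\<alpha>/2)" by simp
    then show "x \<in> (\<lambda>(j::int, i::int). of_int i / 2 - of_int j * (\<alpha>/2)) ` UNIV" by (intro image_eqI[of _ _ "(j, i)"]) auto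
  qed
  then show ?thesis by (rule countable_subset) simp
qed

definition flight_time :: "real \<Rightarrow> real \<Rightarrow> real \<Rightarrow> real" where
  "flight_time a b x = sqrt 2 * (1 + a - min (arc_offset a b x) a - min a (a + b - arc_offset a b x))"

text \<open>Let \<open>s\<close> be the arc length offset of \<open>x\<close>.  If \<open>s < b\<close>, the ball hits a vertical side; the horizontal
  velocity is reversed, and in the reflected picture the new offset is \<open>s + a\<close>.  If \<open>s > b\<close>, it hits a
  horizontal side, and the new offset is \<open>s - b = s + a - (a + b)\<close>, on the other half of the circle.  Both
  amount to adding \<open>\<alpha>/2\<close> to the parameter and exchanging the copies.\<close>

lemma orbit_state_step:
  assumes ab: "0 < a" "a < 1" "0 < b" "b < 1" "a + b \<le> 1"
    and gen: "avoids_corners (a / (a + b)) x"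
  shows "free_time a b (orbit_state a b \<kappa> m1 m2 x) = flight_time a b x"
    and "poincare_map a b (orbit_state a b \<kappa> m1 m2 x) =
      orbit_state a b (other_copy \<kappa>) (m1 + chirality \<kappa> * square_wave x) (m2 + square_wave x) (x + (a / (a + b)) / 2)"
proof -
  define l \<alpha> where "l = a + b" and "\<alpha> = a / l"
  have l: "l > 0" "l * \<alpha> = a" using ab by (auto simp: l_def \<alpha>_def)
  have \<alpha>: "0 < \<alpha>" "\<alpha> < 1" using ab by (auto simp: \<alpha>_def l_def)
  have gen': "x + of_int j * (\<alpha>/2) \<noteq> of_int i / 2" for i j :: int using gen by (simp add: avoids_corners_def \<alpha>_def l_def)
  define y s where "y = frac (2 * x)" and "s = arc_offset a b x"
  have sy: "s = l * y" by (simp add: s_def arc_offset_def y_def l_def)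
  have y01: "0 < y" "y < 1"
  proof -
    have "2 * x \<notin> \<int>" 
    proof
      assume "2 * x \<in> \<int>"
      then obtain n :: int where "2 * x = of_int n" by (auto elim: Ints_cases)
      then show False using gen'[of 0 n] by simp
    qed
    then show "0 < y" "y < 1" by (auto simp: y_def frac_gt_0_iff frac_lt_1)
  qed
  have yne: "y + \<alpha> \<noteq> 1"
  proof
    assume "y + \<alpha> = 1"
    then have "2 * x + \<alpha> = of_int (\<lfloor>2 * x\<rfloor> + 1)" by (simp add: y_def frac_def)
    then have "x + of_int 1 * (\<alpha>/2) = of_int (\<lfloor>2 * x\<rfloor> + 1) / 2" by simp
    then show False using gen' by blast
  qed
  have s: "0 < s" "s < l" using y01 l by (auto simp: sy)
  have sb: "s < b \<longleftrightarrow> y + \<alpha> < 1" "s \<noteq> b"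
  proof -
    have "b = l * (1 - \<alpha>)" using l by (simp add: algebra_simps l_def)
    then show "s < b \<longleftrightarrow> y + \<alpha> < 1" "s \<noteq> b" using l yne by (auto simp: sy)
  qed
  define c1 c2 where "c1 = corner_x a s" and "c2 = corner_y a b s"
  have c: "\<bar>c1\<bar> \<le> a/2" "\<bar>c2\<bar> \<le> b/2" "c1 = a/2 \<or> c2 = b/2" "\<bar>c2 - c1\<bar> < (a + b)/2"
  proof -
    have "c1 = s - a/2 \<and> c2 = b/2 \<and> s \<le> a \<or> c1 = a/2 \<and> c2 = b/2 + a - s \<and> a \<le> s"
      by (auto simp: c1_def c2_def corner_x_def corner_y_def min_def)
    then show "\<bar>c1\<bar> \<le> a/2" "\<bar>c2\<bar> \<le> b/2" "c1 = a/2 \<or> c2 = b/2" "\<bar>c2 - c1\<bar> < (a + b)/2"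
      using s ab(1,3) unfolding l_def abs_le_iff abs_less_iff by (elim disjE conjE; simp; linarith)+
  qed
  define s1 s2 where "s1 = real_of_int (chirality \<kappa> * square_wave x)" and "s2 = real_of_int (square_wave x)"
  have s12: "s1 = 1 \<or> s1 = -1" "s2 = 1 \<or> s2 = -1"
    using square_wave_values[of x] chirality_values[of \<kappa>] by (auto simp: s1_def s2_def)
  note fc = free_time_and_collision[OF ab c s12, of m1 m2]
  have os: "orbit_state a b \<kappa> m1 m2 x = (vector [of_int m1 + s1 * c1, of_int m2 + s2 * c2], vector [s1 / sqrt 2, s2 / sqrt 2])"
    by (simp add: orbit_state_def s1_def s2_def c1_def c2_def s_def)
  define T where "T = max (1 - a/2 - c1) (1 - b/2 - c2)"
  have T: "T = 1 + a - min s a - min a (l - s)"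
    using s ab by (auto simp: T_def c1_def c2_def corner_x_def corner_y_def l_def min_def max_def)
  show "free_time a b (orbit_state a b \<kappa> m1 m2 x) = flight_time a b x"
    unfolding os fc(1) T_def[symmetric] T flight_time_def s_def l_def ..
  \<comment> \<open>hence the square wave changes sign whenever \<open>\<lfloor>2 x\<rfloor>\<close> increases by one\<close>
  have fl: "\<lfloor>2 * x\<rfloor> = \<lfloor>x\<rfloor> + \<lfloor>x - 1/2\<rfloor> + 1" for x :: real
  proof (cases "x < of_int \<lfloor>x\<rfloor> + 1/2")
    case True
    have "\<lfloor>x - 1/2\<rfloor> = \<lfloor>x\<rfloor> - 1" "\<lfloor>2 * x\<rfloor> = 2 * \<lfloor>x\<rfloor>"
      unfolding floor_eq_iff of_int_diff of_int_1 of_int_mult of_int_numeral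
      using True by (intro conjI; linarith)+
    then show ?thesis by simp
  next
    case False
    have "\<lfloor>x - 1/2\<rfloor> = \<lfloor>x\<rfloor>" "\<lfloor>2 * x\<rfloor> = 2 * \<lfloor>x\<rfloor> + 1"
      unfolding floor_eq_iff of_int_add of_int_1 of_int_mult of_int_numeral
      using False by (intro conjI; linarith)+
    then show ?thesis by simp
  qed
  have nxt: "arc_offset a b (x + \<alpha>/2) = (if s < b then s + a else s - b) \<and> square_wave (x + \<alpha>/2) = (if s < b then square_wave x else - square_wave x)"
  proof -
    have e2: "2 * (x + \<alpha>/2) = 2 * x + \<alpha>" by simp
    have "2 * (x + \<alpha>/2) = of_int \<lfloor>2 * x\<rfloor> + (y + \<alpha>)" by (simp add: y_def frac_def)
    then have fr: "frac (2 * (x + \<alpha>/2)) = frac (y + \<alpha>)" by (simp only: frac_add_of_int_left)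
    show ?thesis
    proof (cases "s < b")
      case True
      then have "frac (y + \<alpha>) = y + \<alpha>" using sb y01 \<alpha> by (simp add: frac_eq)
      moreover have "square_wave (x + \<alpha>/2) = square_wave x"
      proof -
        have "2 * x + \<alpha> < of_int \<lfloor>2 * x\<rfloor> + 1" using True sb by (simp add: y_def frac_def)
        then have f2: "\<lfloor>2 * (x + \<alpha>/2)\<rfloor> = \<lfloor>2 * x\<rfloor>"
          unfolding e2 using \<alpha>(1) of_int_floor_le[of "2 * x"] by (intro floor_unique) linarith+
        have "\<lfloor>x\<rfloor> \<le> \<lfloor>x + \<alpha>/2\<rfloor>" "\<lfloor>x - 1/2\<rfloor> \<le> \<lfloor>x + \<alpha>/2 - 1/2\<rfloor>" using \<alpha> by (auto intro!: floor_mono)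
        then have "\<lfloor>x + \<alpha>/2\<rfloor> = \<lfloor>x\<rfloor>" "\<lfloor>x + \<alpha>/2 - 1/2\<rfloor> = \<lfloor>x - 1/2\<rfloor>" using f2 unfolding fl by linarith+
        then show ?thesis by (simp add: square_wave_def)
      qed
      ultimately show ?thesis using True l unfolding arc_offset_def fr by (simp add: sy l_def algebra_simps)
    next
      case False
      then have y\<alpha>: "1 < y + \<alpha>" using sb yne by linarith
      then have F: "frac (y + \<alpha>) = y + \<alpha> - 1" using y01 \<alpha> by (simp add: frac_unique_iff)
      moreover have "square_wave (x + \<alpha>/2) = - square_wave x"
      proof -
        have "2 * x + \<alpha> > of_int \<lfloor>2 * x\<rfloor> + 1" using y\<alpha> by (simp add: y_def frac_def)
        moreover have "2 * x + \<alpha> < of_int \<lfloor>2 * x\<rfloor> + 2" using \<alpha> by linarith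
        ultimately have f2: "\<lfloor>2 * (x + \<alpha>/2)\<rfloor> = \<lfloor>2 * x\<rfloor> + 1"
          unfolding e2 by (intro floor_unique) simp_all
        have "\<lfloor>x\<rfloor> \<le> \<lfloor>x + \<alpha>/2\<rfloor>" "\<lfloor>x - 1/2\<rfloor> \<le> \<lfloor>x + \<alpha>/2 - 1/2\<rfloor>" using \<alpha> by (auto intro!: floor_mono)
        moreover have "\<lfloor>x - 1/2\<rfloor> = \<lfloor>x\<rfloor> \<or> \<lfloor>x - 1/2\<rfloor> = \<lfloor>x\<rfloor> - 1"
          "\<lfloor>x + \<alpha>/2 - 1/2\<rfloor> = \<lfloor>x + \<alpha>/2\<rfloor> \<or> \<lfloor>x + \<alpha>/2 - 1/2\<rfloor> = \<lfloor>x + \<alpha>/2\<rfloor> - 1" by linarith+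
        moreover have "2 * C - 2 * D - 1 = - (2 * A - 2 * B - 1)"
          if "A \<le> C" "B \<le> D" "B = A \<or> B = A - 1" "D = C \<or> D = C - 1" "C + D + 1 = A + B + 1 + 1" for A B C D :: int
          using that by presburger
        ultimately show ?thesis using f2 unfolding fl square_wave_def by blast
      qed
      ultimately show ?thesis using False l unfolding arc_offset_def fr F by (simp add: sy l_def algebra_simps)
    qed
  qed
  define d1 d2 where "d1 = c1 + T - 1" and "d2 = c2 + T - 1"
  have pm: "poincare_map a b (orbit_state a b \<kappa> m1 m2 x) = (vector [of_int m1 + s1 + s1 * d1, of_int m2 + s2 + s2 * d2],
       vector [(if \<bar>d1\<bar> = a/2 then - s1 else s1) / sqrt 2, (if \<bar>d2\<bar> = b/2 then - s2 else s2) / sqrt 2])"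
    unfolding os fc(2) d1_def d2_def T_def ..
  show "poincare_map a b (orbit_state a b \<kappa> m1 m2 x) =
      orbit_state a b (other_copy \<kappa>) (m1 + chirality \<kappa> * square_wave x) (m2 + square_wave x) (x + (a / (a + b)) / 2)"
  proof (cases "s < b")
    case True
    have d: "d1 = - a/2" "d2 = b/2 - s"
      using True s ab by (auto simp: d1_def d2_def T_def c1_def c2_def corner_x_def corner_y_def l_def min_def max_def)
    have d': "\<bar>d1\<bar> = a/2" "\<bar>d2\<bar> \<noteq> b/2" using d s ab True by (auto simp: abs_if)
    have cc: "corner_x a (s + a) = a/2" "corner_y a b (s + a) = b/2 - s"
      using s by (auto simp: corner_x_def corner_y_def min_def)
    show ?thesis
      unfolding pm unfolding orbit_state_def l_def[symmetric] \<alpha>_def[symmetric] using nxt True d' d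
      by (simp add: cc s1_def s2_def vec_eq_iff forall_2)
  next
    case False
    then have sb': "b < s" using sb by simp
    have d: "d1 = s - a/2 - b" "d2 = - b/2"
      using sb' s ab by (auto simp: d1_def d2_def T_def c1_def c2_def corner_x_def corner_y_def l_def min_def max_def)
    have d': "\<bar>d1\<bar> \<noteq> a/2" "\<bar>d2\<bar> = b/2" using d s ab sb' by (auto simp: abs_if l_def)
    have cc: "corner_x a (s - b) = s - b - a/2" "corner_y a b (s - b) = b/2"
      using s sb' by (auto simp: corner_x_def corner_y_def min_def l_def)
    show ?thesis
      unfolding pm unfolding orbit_state_def l_def[symmetric] \<alpha>_def[symmetric] using nxt False d' d
      by (simp add: cc s1_def s2_def vec_eq_iff forall_2) (simp add: field_simps)?
  qed
qed

definition cell_x :: "copy \<Rightarrow> real \<Rightarrow> nat \<Rightarrow> real \<Rightarrow> int" where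
  "cell_x \<kappa> \<alpha> k x = (\<Sum>j<k. chirality ((other_copy ^^ j) \<kappa>) * square_wave (x + real j * (\<alpha>/2)))"

definition cell_y :: "real \<Rightarrow> nat \<Rightarrow> real \<Rightarrow> int" where
  "cell_y \<alpha> k x = (\<Sum>j<k. square_wave (x + real j * (\<alpha>/2)))"

definition collision_state :: "real \<Rightarrow> real \<Rightarrow> copy \<Rightarrow> nat \<Rightarrow> real \<Rightarrow> state" where
  "collision_state a b \<kappa> k x = orbit_state a b ((other_copy ^^ k) \<kappa>)
     (cell_x \<kappa> (a / (a + b)) k x) (cell_y (a / (a + b)) k x) (x + real k * ((a / (a + b)) / 2))"

lemma avoids_corners_shift_nat: "avoids_corners \<alpha> x \<Longrightarrow> avoids_corners \<alpha> (x + real j * (\<alpha>/2))"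
  using avoids_corners_shift[of \<alpha> x "int j"] by simp

lemma iterate_poincare_map:
  assumes ab: "0 < a" "a < 1" "0 < b" "b < 1" "a + b \<le> 1" and gen: "avoids_corners (a / (a + b)) x"
  shows "(poincare_map a b ^^ k) (orbit_state a b \<kappa> 0 0 x) = collision_state a b \<kappa> k x"
proof (induction k)
  case (Suc k)
  show ?case
    using orbit_state_step(2)[OF ab avoids_corners_shift_nat[OF gen, of k]] Suc
    by (simp add: collision_state_def cell_x_def cell_y_def algebra_simps add_divide_distrib)
qed (simp add: collision_state_def cell_x_def cell_y_def)


section \<open>Collision times and positions\<close>

text \<open>The bounded periodic function with second derivative \<open>-1 + \<Sum> \<delta>\<^sub>n\<close> (unit masses at the integers).
  The flight time, as a periodic function of \<open>2 x\<close>, is piecewise linear, and its kinks at \<open>0\<close> and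
  \<open>\<plusminus>\<alpha>\<close> have weights in proportion \<open>-2 : 1 : 1\<close>; this makes it a second difference of \<open>parabola\<close>.\<close>

definition parabola :: "real \<Rightarrow> real" where
  "parabola y = (frac y - (frac y)\<^sup>2) / 2"

lemma parabola_periodic: "parabola (y + of_int n) = parabola y"
  by (simp add: parabola_def)

lemma parabola_bounds: "0 \<le> parabola y" "parabola y \<le> 1/8"
proof -
  have "0 \<le> frac y" "frac y < 1" by (auto simp: frac_lt_1)
  then show "0 \<le> parabola y" by (simp add: parabola_def power2_eq_square mult_left_le)
  have "0 \<le> (frac y - 1/2)\<^sup>2" by simp
  then show "parabola y \<le> 1/8" by (simp add: parabola_def power2_eq_square algebra_simps)
qed

lemma flight_time_second_difference:
  fixes a b x :: real
  assumes ab: "0 < a" "0 < b"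
  defines "\<alpha> \<equiv> a / (a + b)"
  shows "flight_time a b x = sqrt 2 * (1 - a * b / (a + b) +
    (a + b) * (parabola (2 * x + \<alpha>) + parabola (2 * x - \<alpha>) - 2 * parabola (2 * x)))"
proof -
  define l y where "l = a + b" and "y = frac (2 * x)"
  have l: "l > 0" "a = l * \<alpha>" "b = l * (1 - \<alpha>)" using ab by (auto simp: l_def \<alpha>_def field_simps)
  have \<alpha>: "0 < \<alpha>" "\<alpha> < 1" using ab by (auto simp: \<alpha>_def)
  have y: "0 \<le> y" "y < 1" by (auto simp: y_def frac_lt_1)
  have p0: "parabola (2 * x) = (y - y\<^sup>2) / 2" by (simp add: parabola_def y_def)
  \<comment> \<open>periodicity reduces the claim to \<open>0 \<le> y < 1\<close>, where both sides are piecewise quadratic in \<open>y\<close>\<close>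
  have xy: "2 * x = y + of_int \<lfloor>2 * x\<rfloor>" by (simp add: y_def frac_def)
  have "parabola (2 * x + \<alpha>) = parabola ((y + \<alpha>) + of_int \<lfloor>2 * x\<rfloor>)" using xy by (simp add: algebra_simps)
  also have "\<dots> = parabola (y + \<alpha>)" by (rule parabola_periodic)
  also have "frac (y + \<alpha>) = (if y + \<alpha> < 1 then y + \<alpha> else y + \<alpha> - 1)"
    using y \<alpha> by (auto simp: frac_unique_iff)
  then have "parabola (y + \<alpha>) = (if y + \<alpha> < 1 then (y + \<alpha> - (y + \<alpha>)\<^sup>2) / 2 else (y + \<alpha> - 1 - (y + \<alpha> - 1)\<^sup>2) / 2)"
    by (simp add: parabola_def)
  finally have p1: "parabola (2 * x + \<alpha>) = (if y + \<alpha> < 1 then (y + \<alpha> - (y + \<alpha>)\<^sup>2) / 2 else (y + \<alpha> - 1 - (y + \<alpha> - 1)\<^sup>2) / 2)" .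
  have "parabola (2 * x - \<alpha>) = parabola ((y - \<alpha>) + of_int \<lfloor>2 * x\<rfloor>)" using xy by (simp add: algebra_simps)
  also have "\<dots> = parabola (y - \<alpha>)" by (rule parabola_periodic)
  also have "frac (y - \<alpha>) = (if \<alpha> \<le> y then y - \<alpha> else y - \<alpha> + 1)"
    using y \<alpha> by (auto simp: frac_unique_iff)
  then have "parabola (y - \<alpha>) = (if \<alpha> \<le> y then (y - \<alpha> - (y - \<alpha>)\<^sup>2) / 2 else (y - \<alpha> + 1 - (y - \<alpha> + 1)\<^sup>2) / 2)"
    by (simp add: parabola_def)
  finally have p2: "parabola (2 * x - \<alpha>) = (if \<alpha> \<le> y then (y - \<alpha> - (y - \<alpha>)\<^sup>2) / 2 else (y - \<alpha> + 1 - (y - \<alpha> + 1)\<^sup>2) / 2)" .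
  have mins: "min (l * y) (l * \<alpha>) = l * min y \<alpha>" "min (l * \<alpha>) (l - l * y) = l * min \<alpha> (1 - y)"
    using l(1) by (simp_all add: min_mult_distrib_left algebra_simps)
  have abl: "a * b / l = l * (\<alpha> * (1 - \<alpha>))" using l by simp
  have key: "\<alpha> - min y \<alpha> - min \<alpha> (1 - y) = - (\<alpha> * (1 - \<alpha>)) + (parabola (2 * x + \<alpha>) + parabola (2 * x - \<alpha>) - 2 * parabola (2 * x))"
  proof -
    have "min y \<alpha> = (if \<alpha> \<le> y then \<alpha> else y)" "min \<alpha> (1 - y) = (if y + \<alpha> < 1 then \<alpha> else 1 - y)"
      by (auto simp: min_def)
    then show ?thesis unfolding p0 p1 p2 by (simp add: power2_eq_square field_simps)
  qed
  have "1 + l * \<alpha> - l * min y \<alpha> - l * min \<alpha> (1 - y) = 1 + l * (\<alpha> - min y \<alpha> - min \<alpha> (1 - y))"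
    by (simp add: algebra_simps)
  also have "\<dots> = 1 - l * (\<alpha> * (1 - \<alpha>)) + l * (parabola (2 * x + \<alpha>) + parabola (2 * x - \<alpha>) - 2 * parabola (2 * x))"
    unfolding key by (simp add: algebra_simps)
  finally show ?thesis
    unfolding flight_time_def arc_offset_def l_def[symmetric] y_def[symmetric] abl l(2)[symmetric] mins[folded l(2)] 
    using mins l(2) by simp
qed

text \<open>The sum of the first \<open>k\<close> flight times in closed form, after the second differences telescope.\<close>

definition collision_clock :: "real \<Rightarrow> real \<Rightarrow> nat \<Rightarrow> real \<Rightarrow> real" where
  "collision_clock a b k x = (let \<alpha> = a / (a + b) in
     sqrt 2 * (real k * (1 - a * b / (a + b)) + (a + b) *
       (parabola (2 * x + real k * \<alpha>) - parabola (2 * x + real k * \<alpha> - \<alpha>) - parabola (2 * x) + parabola (2 * x - \<alpha>))))"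

lemma collision_clock_Suc:
  assumes ab: "0 < a" "0 < b"
  shows "collision_clock a b (Suc k) x = collision_clock a b k x + flight_time a b (x + real k * ((a / (a + b)) / 2))"
proof -
  define \<alpha> c where "\<alpha> = a / (a + b)" and "c = 1 - a * b / (a + b)"
  have "2 * (x + real k * (\<alpha> / 2)) = 2 * x + real k * \<alpha>" "2 * x + real (Suc k) * \<alpha> = 2 * x + real k * \<alpha> + \<alpha>"
    by (simp_all add: algebra_simps)
  then show ?thesis
    unfolding flight_time_second_difference[OF ab] collision_clock_def Let_def \<alpha>_def[symmetric] c_def[symmetric]
    by (simp add: algebra_simps)
qed

text \<open>The bounded remainder left by telescoping is uniform in \<open>k\<close> and \<open>x\<close>.\<close>

lemma collision_clock_linear:
  assumes ab: "0 < a" "0 < b" "a + b \<le> 1"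
  shows "\<bar>collision_clock a b k x - real k * (sqrt 2 * (1 - a * b / (a + b)))\<bar> \<le> 1"
proof -
  define \<alpha> where "\<alpha> = a / (a + b)"
  define P where "P = parabola (2 * x + real k * \<alpha>) - parabola (2 * x + real k * \<alpha> - \<alpha>) - parabola (2 * x) + parabola (2 * x - \<alpha>)"
  have P: "\<bar>P\<bar> \<le> 1/4" unfolding P_def
    using parabola_bounds[of "2 * x + real k * \<alpha>"] parabola_bounds[of "2 * x + real k * \<alpha> - \<alpha>"]
      parabola_bounds[of "2 * x"] parabola_bounds[of "2 * x - \<alpha>"] by linarith
  have "collision_clock a b k x - real k * (sqrt 2 * (1 - a * b / (a + b))) = sqrt 2 * ((a + b) * P)"
    by (simp add: collision_clock_def Let_def \<alpha>_def[symmetric] P_def algebra_simps)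
  also have "\<bar>\<dots>\<bar> = sqrt 2 * ((a + b) * \<bar>P\<bar>)" using ab by (simp add: abs_mult)
  also have "\<dots> \<le> 2 * (1 * (1/4))"
    using ab P sqrt2_less_2 by (intro mult_mono) auto
  finally show ?thesis by simp
qed

lemma collision_time_eq_clock:
  assumes ab: "0 < a" "a < 1" "0 < b" "b < 1" "a + b \<le> 1" and gen: "avoids_corners (a / (a + b)) x"
  shows "collision_time a b (orbit_state a b \<kappa> 0 0 x) k = collision_clock a b k x"
proof (induction k)
  case (Suc k)
  have "free_time a b ((poincare_map a b ^^ k) (orbit_state a b \<kappa> 0 0 x)) = flight_time a b (x + real k * ((a / (a + b)) / 2))"
    unfolding iterate_poincare_map[OF ab gen] collision_state_def
    by (rule orbit_state_step(1)[OF ab avoids_corners_shift_nat[OF gen]])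
  then show ?case using Suc ab by (simp add: collision_time_def collision_clock_Suc)
qed (simp add: collision_time_def collision_clock_def Let_def)

lemma flight_time_bounds:
  assumes ab: "0 < a" "a < 1" "0 < b"
  shows "0 < flight_time a b x" "flight_time a b x \<le> 4"
proof -
  define s where "s = arc_offset a b x"
  have s: "0 \<le> s" "s < a + b" using ab by (auto simp: s_def arc_offset_def frac_lt_1)
  have f: "flight_time a b x = sqrt 2 * (1 + a - min s a - min a (a + b - s))" by (simp add: flight_time_def s_def)
  have "0 < 1 + a - min s a - min a (a + b - s)" using s ab by linarith
  then show "0 < flight_time a b x" unfolding f by simp
  have "1 + a - min s a - min a (a + b - s) \<le> 2" "0 \<le> 1 + a - min s a - min a (a + b - s)" using s ab by (auto simp: min_def)
  then show "flight_time a b x \<le> 4" unfolding f using sqrt2_less_2 mult_mono[of "sqrt 2" 2 "1 + a - min s a - min a (a + b - s)" 2] by simp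
qed


lemma norm_orbit_velocity: "norm (snd (orbit_state a b \<kappa> m1 m2 x)) = 1"
proof -
  have "(norm (snd (orbit_state a b \<kappa> m1 m2 x)))\<^sup>2 = 1"
    using square_wave_values[of x] chirality_values[of \<kappa>]
    by (auto simp: orbit_state_def power2_norm_eq_inner inner_vec_def sum_2)
  then show ?thesis by (metis norm_ge_zero power2_eq_1_iff not_less zero_less_one neg_less_0_iff_less less_le_trans order_refl less_irrefl)
qed

lemma norm_orbit_position:
  assumes ab: "0 < a" "a < 1" "0 < b" "b < 1"
  shows "norm (fst (orbit_state a b \<kappa> m1 m2 x) - vector [of_int m1, of_int m2]) \<le> 1"
proof -
  define s where "s = arc_offset a b x"
  have s: "0 \<le> s" "s < a + b" using ab by (auto simp: s_def arc_offset_def frac_lt_1)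
  have c: "\<bar>corner_x a s\<bar> \<le> 1/2" "\<bar>corner_y a b s\<bar> \<le> 1/2"
    using s ab by (auto simp: corner_x_def corner_y_def min_def abs_if)
  have "norm (fst (orbit_state a b \<kappa> m1 m2 x) - vector [of_int m1, of_int m2]) \<le>
     (\<Sum>i\<in>UNIV. \<bar>(fst (orbit_state a b \<kappa> m1 m2 x) - vector [of_int m1, of_int m2]) $ i\<bar>)"
    by (rule norm_le_l1_cart)
  also have "\<dots> = \<bar>corner_x a s\<bar> + \<bar>corner_y a b s\<bar>"
    using square_wave_values[of x] chirality_values[of \<kappa>]
    by (auto simp: sum_2 orbit_state_def s_def[symmetric])
  finally show ?thesis using c by linarith
qed

text \<open>The position at time \<open>t\<close> written with the closed forms of the collision times and states, which are
  Borel functions of the starting parameter on the whole line.\<close>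

definition position_at :: "real \<Rightarrow> real \<Rightarrow> copy \<Rightarrow> real \<Rightarrow> real \<Rightarrow> real^2" where
  "position_at a b \<kappa> t x =
    (let k = (LEAST k. t < collision_clock a b (Suc k) x); s = collision_state a b \<kappa> k x
     in fst s + (t - collision_clock a b k x) *\<^sub>R snd s)"

lemma billiard_position_eq:
  assumes ab: "0 < a" "a < 1" "0 < b" "b < 1" "a + b \<le> 1" and gen: "avoids_corners (a / (a + b)) x" and x: "0 \<le> x" "x < 1"
  shows "X a b \<kappa> t x = position_at a b \<kappa> t x"
  unfolding X_def initial_state_eq_orbit_state[OF ab(1,3) x] billiard_position_def Let_def
    collision_time_eq_clock[OF ab gen] iterate_poincare_map[OF ab gen] position_at_def ..

text \<open>Two collisions move the cell vertically by the sum and horizontally, up to the chirality, by the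
  difference of the values of the square wave at \<open>y\<close> and \<open>y + \<alpha>/2\<close>: these are twice the coordinates
  of \<open>\<Psi>\<close>.\<close>

lemma cell_even:
  shows "cell_x \<kappa> \<alpha> (2 * L) x = 2 * chirality \<kappa> * horizontal_sum \<alpha> L x"
    and "cell_y \<alpha> (2 * L) x = 2 * vertical_sum \<alpha> L x"
proof -
  have st: "square_wave y - square_wave (y + \<alpha>/2) = 2 * horizontal_step \<alpha> y"
    "square_wave y + square_wave (y + \<alpha>/2) = 2 * vertical_step \<alpha> y" for y
    by (simp_all add: square_wave_def horizontal_step_def vertical_step_def algebra_simps)
  have ev: "(other_copy ^^ (2 * L)) \<kappa> = \<kappa>" for L \<kappa>
  proof (induction L)
    case (Suc L)
    then show ?case by (cases \<kappa>) simp_all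
  qed simp
  have i: "x + real (2 * L) * (\<alpha>/2) = x + real L * \<alpha>"
    "x + real (Suc (2 * L)) * (\<alpha>/2) = x + real L * \<alpha> + \<alpha>/2" "2 * Suc L = Suc (Suc (2 * L))" for L
    by (simp_all add: field_simps)
  show "cell_x \<kappa> \<alpha> (2 * L) x = 2 * chirality \<kappa> * horizontal_sum \<alpha> L x"
  proof (induction L)
    case (Suc L)
    have "cell_x \<kappa> \<alpha> (2 * Suc L) x = cell_x \<kappa> \<alpha> (2 * L) x +
        chirality \<kappa> * (square_wave (x + real L * \<alpha>) - square_wave (x + real L * \<alpha> + \<alpha>/2))"
      unfolding i(3) cell_x_def sum.lessThan_Suc i(1,2) using ev[of L \<kappa>] by (simp add: right_diff_distrib)
    then show ?case unfolding st Suc horizontal_sum_def by (simp add: distrib_left)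
  qed (simp add: cell_x_def horizontal_sum_def)
  show "cell_y \<alpha> (2 * L) x = 2 * vertical_sum \<alpha> L x"
  proof (induction L)
    case (Suc L)
    have "cell_y \<alpha> (2 * Suc L) x = cell_y \<alpha> (2 * L) x +
        (square_wave (x + real L * \<alpha>) + square_wave (x + real L * \<alpha> + \<alpha>/2))"
      unfolding i(3) cell_y_def sum.lessThan_Suc i(1,2) by simp
    then show ?case unfolding st Suc vertical_sum_def by simp
  qed (simp add: cell_y_def vertical_sum_def)
qed

text \<open>The time in question differs from the time of the collision number \<open>2 L\<close> by at most \<open>1\<close>, and the
  ball moves with unit speed; at that collision it is on the boundary of the obstacle that the
  displacement sum of length \<open>L\<close> determines.\<close>

lemma position_follows_cocycle:
  assumes ab: "0 < a" "a < 1" "0 < b" "b < 1" "a + b \<le> 1" and gen: "avoids_corners (a / (a + b)) x"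
  shows "norm (position_at a b \<kappa> (2 * sqrt 2 * (1 - a * b / (a + b)) * real L) x -
    2 *\<^sub>R vector [of_int (chirality \<kappa> * horizontal_sum (a / (a + b)) L x), of_int (vertical_sum (a / (a + b)) L x)]) \<le> 10"
proof -
  define \<alpha> c0 where "\<alpha> = a / (a + b)" and "c0 = sqrt 2 * (1 - a * b / (a + b))"
  have "a * b < a + b" using ab mult_strict_left_mono[of b 1 a] by linarith
  then have c0: "c0 > 0" using ab by (simp add: c0_def)
  define t where "t = 2 * c0 * real L"
  have t: "t = 2 * sqrt 2 * (1 - a * b / (a + b)) * real L" "t \<ge> 0" using c0 by (simp_all add: t_def c0_def)
  define T where "T k = collision_clock a b k x" for k
  define s where "s k = collision_state a b \<kappa> k x" for k
  have TS: "T (Suc k) = T k + flight_time a b (x + real k * (\<alpha>/2))" for k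
    unfolding T_def \<alpha>_def by (rule collision_clock_Suc[OF ab(1,3)])
  have T0: "T 0 = 0" by (simp add: T_def collision_clock_def Let_def)
  have Tlin: "\<bar>T k - real k * c0\<bar> \<le> 1" for k unfolding T_def c0_def by (rule collision_clock_linear[OF ab(1,3,5)])
  have Tinc: "T k < T (Suc k)" "T (Suc k) \<le> T k + 4" for k
    using TS[of k] flight_time_bounds[OF ab(1,2,3), of "x + real k * (\<alpha>/2)"] by auto
  have Tmono: "i \<le> j \<Longrightarrow> T i \<le> T j" for i j by (rule lift_Suc_mono_le[of T]) (use Tinc in \<open>auto intro: less_imp_le\<close>)
  have step: "fst (s (Suc k)) = fst (s k) + (T (Suc k) - T k) *\<^sub>R snd (s k)" for k
  proof -
    have "s (Suc k) = poincare_map a b (s k)"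
      unfolding s_def iterate_poincare_map[OF ab gen, symmetric] by simp
    moreover have "free_time a b (s k) = T (Suc k) - T k"
      unfolding TS s_def collision_state_def \<alpha>_def[symmetric]
      using orbit_state_step(1)[OF ab avoids_corners_shift_nat[OF gen]] by (simp add: \<alpha>_def)
    ultimately show ?thesis by (simp add: poincare_map_def Let_def)
  qed
  have vel: "norm (snd (s k)) = 1" for k unfolding s_def collision_state_def by (rule norm_orbit_velocity)
  have lip: "norm (fst (s (i + d)) - fst (s i)) \<le> T (i + d) - T i" for i d
  proof (induction d)
    case (Suc d)
    have "fst (s (i + Suc d)) - fst (s i) = (fst (s (i + d)) - fst (s i)) + (T (Suc (i + d)) - T (i + d)) *\<^sub>R snd (s (i + d))"
      by (simp add: step)
    also have "norm \<dots> \<le> norm (fst (s (i + d)) - fst (s i)) + norm ((T (Suc (i + d)) - T (i + d)) *\<^sub>R snd (s (i + d)))"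
      by (rule norm_triangle_ineq)
    also have "norm ((T (Suc (i + d)) - T (i + d)) *\<^sub>R snd (s (i + d))) = T (Suc (i + d)) - T (i + d)"
      using Tinc(1)[of "i + d"] by (simp add: vel)
    finally show ?case using Suc by simp
  qed simp
  have lip': "norm (fst (s i) - fst (s j)) \<le> \<bar>T i - T j\<bar>" for i j
  proof (cases "i \<le> j")
    case True
    then show ?thesis using lip[of i "j - i"] Tmono[of i j] by (simp add: norm_minus_commute)
  next
    case False
    then show ?thesis using lip[of j "i - j"] Tmono[of j i] by simp
  qed
  define k where "k = (LEAST k. t < T (Suc k))"
  have "\<exists>k. t < T (Suc k)"
  proof -
    obtain n :: nat where "(t + 1) / c0 < real n" using reals_Archimedean2 by blast
    then have "t + 1 < real n * c0" using c0 by (simp add: field_simps)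
    then have "t < T n" using Tlin[of n] by linarith
    then show ?thesis using Tinc(1)[of n] by (intro exI[of _ n]) linarith
  qed
  then have k1: "t < T (Suc k)" unfolding k_def by (rule LeastI_ex)
  have k2: "T k \<le> t"
  proof (cases k)
    case (Suc k')
    then have "\<not> t < T (Suc k')" unfolding k_def using not_less_Least[of k' "\<lambda>k. t < T (Suc k)"] by (simp add: k_def)
    then show ?thesis using Suc by simp
  qed (use T0 t in simp)
  define p where "p = position_at a b \<kappa> t x"
  have p: "p = fst (s k) + (t - T k) *\<^sub>R snd (s k)"
    unfolding p_def position_at_def Let_def T_def[symmetric] k_def[symmetric] s_def ..
  have "norm (p - fst (s k)) = t - T k" using k2 by (simp add: p vel)
  moreover have "t - T k \<le> 4" using k1 Tinc(2)[of k] by linarith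
  moreover have "\<bar>T (2 * L) - t\<bar> \<le> 1" using Tlin[of "2 * L"] by (simp add: t_def mult.commute mult.left_commute)
  moreover have "norm (fst (s k) - fst (s (2 * L))) \<le> \<bar>T k - T (2 * L)\<bar>" by (rule lip')
  moreover have "norm (p - fst (s (2 * L))) \<le> norm (p - fst (s k)) + norm (fst (s k) - fst (s (2 * L)))"
    using norm_triangle_ineq[of "p - fst (s k)" "fst (s k) - fst (s (2 * L))"] by simp
  ultimately have d1: "norm (p - fst (s (2 * L))) \<le> 9" using k2 by linarith
  define v :: "real^2" where "v = 2 *\<^sub>R vector [of_int (chirality \<kappa> * horizontal_sum \<alpha> L x), of_int (vertical_sum \<alpha> L x)]"
  have "v = vector [of_int (cell_x \<kappa> \<alpha> (2 * L) x), of_int (cell_y \<alpha> (2 * L) x)]"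
    unfolding v_def cell_even by (simp add: vec_eq_iff forall_2)
  then have d2: "norm (fst (s (2 * L)) - v) \<le> 1"
    unfolding s_def collision_state_def \<alpha>_def[symmetric] using norm_orbit_position[OF ab(1-4)] by simp
  have "norm (p - v) \<le> norm (p - fst (s (2 * L))) + norm (fst (s (2 * L)) - v)"
    using norm_triangle_ineq[of "p - fst (s (2 * L))" "fst (s (2 * L)) - v"] by simp
  then have "norm (p - v) \<le> 10" using d1 d2 by linarith
  then show ?thesis by (simp add: p_def v_def t(1) \<alpha>_def)
qed

lemma step_eq_\<Psi>:
  assumes \<alpha>: "0 < \<alpha>" "\<alpha> < 1" and gen: "avoids_corners \<alpha> y"
  shows "\<Psi> \<alpha> y = vector [horizontal_step \<alpha> y, vertical_step \<alpha> y]"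
proof -
  define z where "z = frac y"
  have yz: "y = z + of_int \<lfloor>y\<rfloor>" by (simp add: z_def frac_def)
  have z: "0 \<le> z" "z < 1" by (auto simp: z_def frac_lt_1)
  have gy: "y + of_int j * (\<alpha>/2) \<noteq> of_int i / 2" for i j :: int using gen by (simp add: avoids_corners_def)
  have gz: "z + of_int j * (\<alpha>/2) \<noteq> of_int i / 2" for i j :: int
    using gy[of j "i + 2 * \<lfloor>y\<rfloor>"] yz by (simp add: field_simps)
  have ne: "z \<noteq> 0" "z \<noteq> 1/2" "z \<noteq> 1/2 - \<alpha>/2" "z \<noteq> 1 - \<alpha>/2"
    using gz[of 0 0] gz[of 0 1] gz[of 1 1] gz[of 1 2] by auto
  have hs: "horizontal_step \<alpha> y = horizontal_step \<alpha> z" "square_wave y = square_wave z"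
    using horizontal_step_periodic square_wave_periodic yz by metis+
  have fz: "\<lfloor>z\<rfloor> = 0" "\<lfloor>z - 1/2\<rfloor> = (if z < 1/2 then -1 else 0)" "\<lfloor>z + \<alpha>/2\<rfloor> = (if z < 1 - \<alpha>/2 then 0 else 1)"
    "\<lfloor>z - 1/2 + \<alpha>/2\<rfloor> = (if z < 1/2 - \<alpha>/2 then -1 else 0)"
    using z \<alpha> by (auto simp: floor_eq_iff)
  have h: "horizontal_step \<alpha> z = (if 1/2 - \<alpha>/2 < z \<and> z < 1/2 then 1 else if 1 - \<alpha>/2 < z then -1 else 0)"
    unfolding horizontal_step_def fz using ne \<alpha> by auto
  have w: "square_wave z = (if z < 1/2 then 1 else -1)"
    unfolding square_wave_def fz by simp
  show ?thesis
    unfolding \<Psi>_def Let_def z_def[symmetric] vertical_step_def hs h w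
    using z ne \<alpha> by (auto simp: vec_eq_iff forall_2)
qed

lemma ergodic_sum_eq:
  assumes \<alpha>: "0 < \<alpha>" "\<alpha> < 1" and gen: "avoids_corners \<alpha> x"
  shows "real_vec (ergodic_sum \<alpha> L (\<Psi> \<alpha>) x) = vector [of_int (horizontal_sum \<alpha> L x), of_int (vertical_sum \<alpha> L x)]"
proof -
  have g: "avoids_corners \<alpha> (x + real j * \<alpha>)" for j
    using avoids_corners_shift[OF gen, of "2 * int j"] by simp
  have "ergodic_sum \<alpha> L (\<Psi> \<alpha>) x = vector [horizontal_sum \<alpha> L x, vertical_sum \<alpha> L x]"
    unfolding ergodic_sum_def using step_eq_\<Psi>[OF \<alpha> g]
    by (simp add: vec_eq_iff forall_2 horizontal_sum_def vertical_sum_def sum_component)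
  then show ?thesis by (simp add: real_vec_def vec_eq_iff forall_2)
qed

section \<open>Convergence in distribution\<close>

lemma vector2_measurable [measurable]:
  assumes [measurable]: "f \<in> borel_measurable M" "g \<in> borel_measurable M"
  shows "(\<lambda>x. vector [f x, g x] :: real^2) \<in> borel_measurable M"
proof -
  have "(\<lambda>x. to_vec2 (f x, g x)) \<in> borel_measurable M" by measurable
  then show ?thesis by (simp add: to_vec2_def)
qed

lemma borel_measurable_floor_terms [measurable]:
  "square_wave \<in> measurable borel (count_space UNIV)"
  "frac \<in> borel_measurable (borel :: real measure)"
  "parabola \<in> borel_measurable borel"
  unfolding square_wave_def[abs_def] parabola_def[abs_def] frac_def[abs_def] by measurable

text \<open>The orbit formulas hold off a countable set of parameters, which affects neither measurability nor
  integrals.\<close>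

lemma circle_cong_off_corners:
  fixes f g :: "real \<Rightarrow> 'b::{banach, second_countable_topology}"
  assumes eq: "\<And>x. 0 \<le> x \<Longrightarrow> x < 1 \<Longrightarrow> avoids_corners \<alpha> x \<Longrightarrow> f x = g x" and g: "g \<in> borel_measurable borel"
  shows "f \<in> borel_measurable circle" and "integral\<^sup>L circle f = integral\<^sup>L circle g"
proof -
  have s: "{x} \<in> sets circle" if "x \<in> space circle" for x
    using that by (intro sets_circle_borel) (auto simp: space_circle)
  have gm: "g \<in> borel_measurable circle" by (intro borel_measurable_circle g)
  have cnt: "countable ({x. \<not> avoids_corners \<alpha> x} \<inter> space circle)"
    using countable_meets_corner by (rule countable_subset[rotated]) auto
  show f: "f \<in> borel_measurable circle"
  proof (rule measurable_discrete_difference[OF gm cnt])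
    show "{x} \<in> sets circle" if "x \<in> {x. \<not> avoids_corners \<alpha> x} \<inter> space circle" for x using that s by auto
    show "g x = f x" if "x \<in> space circle" "x \<notin> {x. \<not> avoids_corners \<alpha> x} \<inter> space circle" for x
      using that eq[of x] by (auto simp: space_circle)
  qed auto
  show "integral\<^sup>L circle f = integral\<^sup>L circle g"
  proof (rule integral_discrete_difference[OF cnt])
    show "emeasure circle {x} = 0" if "x \<in> {x. \<not> avoids_corners \<alpha> x} \<inter> space circle" for x
      using that s[of x] measure_circle[of "{x}"] by (simp add: circle.emeasure_eq_measure space_circle)
    show "{x} \<in> sets circle" if "x \<in> {x. \<not> avoids_corners \<alpha> x} \<inter> space circle" for x using that s by auto
    show "f x = g x" if "x \<in> space circle" "x \<notin> {x. \<not> avoids_corners \<alpha> x} \<inter> space circle" for x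
      using that eq[of x] by (auto simp: space_circle)
  qed
qed

lemma AE_avoids_corners: "AE x in circle. avoids_corners \<alpha> x"
proof -
  have "{x \<in> space circle. \<not> avoids_corners \<alpha> x} \<in> null_sets circle"
  proof -
    have eq: "{x \<in> space circle. \<not> avoids_corners \<alpha> x} = (\<Union>x\<in>{x \<in> space circle. \<not> avoids_corners \<alpha> x}. {x})" by auto
    show ?thesis
    proof (subst eq, rule null_sets_UN')
      show "countable {x \<in> space circle. \<not> avoids_corners \<alpha> x}"
        using countable_meets_corner by (rule countable_subset[rotated]) auto
      fix x assume "x \<in> {x \<in> space circle. \<not> avoids_corners \<alpha> x}"
      then show "{x} \<in> null_sets circle"
        using measure_circle[of "{x}"] by (intro null_setsI) (auto simp: circle.emeasure_eq_measure space_circle intro!: sets_circle_borel)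
    qed
  qed
  then show ?thesis by (rule AE_I') auto
qed

lemma collision_clock_measurable [measurable]: "collision_clock a b k \<in> borel_measurable borel"
  unfolding collision_clock_def[abs_def] Let_def by measurable

lemma collision_state_measurable [measurable]:
  "(\<lambda>x. fst (collision_state a b \<kappa> k x)) \<in> borel_measurable borel"
  "(\<lambda>x. snd (collision_state a b \<kappa> k x)) \<in> borel_measurable borel"
  unfolding collision_state_def orbit_state_def arc_offset_def corner_x_def corner_y_def cell_x_def cell_y_def
    fst_conv snd_conv of_int_sum of_int_mult
  by measurable

lemma position_at_measurable: "position_at a b \<kappa> t \<in> borel_measurable borel"
proof -
  have L: "(\<lambda>x. LEAST k. t < collision_clock a b (Suc k) x) \<in> measurable borel (count_space UNIV)"
    by (rule measurable_Least) measurable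
  show ?thesis unfolding position_at_def[abs_def] Let_def
    by (rule measurable_compose_countable[OF _ L]) measurable
qed

lemma integral_parabola_rotate: "(\<integral>x. parabola (2 * x + s) \<partial>circle) = (\<integral>x. parabola (2 * x) \<partial>circle)"
proof -
  define g where "g x = parabola (2 * x)" for x
  have "parabola (2 * x + s) = g (x + frac (s/2))" for x
  proof -
    have "2 * x + s = 2 * (x + frac (s/2)) + of_int (2 * \<lfloor>s/2\<rfloor>)" by (simp add: frac_def)
    then show ?thesis by (simp only: parabola_periodic g_def)
  qed
  moreover have "(\<integral>x. g (x + frac (s/2)) \<partial>circle) = (\<integral>x. g x \<partial>circle)"
  proof (rule integral_circle_rotate[where B = 1])
    show "g \<in> borel_measurable borel" unfolding g_def[abs_def] by measurable
    show "g (x + 1) = g x" for x using parabola_periodic[of "2 * x" 2] by (simp add: g_def algebra_simps)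
    show "\<bar>g x\<bar> \<le> 1" for x using parabola_bounds[of "2 * x"] by (simp add: g_def)
  qed (auto simp: frac_lt_1 less_imp_le)
  ultimately show ?thesis by (simp add: g_def)
qed

text \<open>The parabolas in the closed form of the time of the second collision have equal means, by rotation
  invariance, and cancel.\<close>

lemma mean_time_eq:
  assumes ab: "0 < a" "a < 1" "0 < b" "b < 1" "a + b \<le> 1"
  shows "mean_time a b \<kappa> = 2 * sqrt 2 * (1 - a * b / (a + b))"
proof -
  define \<alpha> where "\<alpha> = a / (a + b)"
  have "mean_time a b \<kappa> = (\<integral>x. collision_clock a b 2 x \<partial>circle)"
    unfolding mean_time_def
  proof (rule circle_cong_off_corners(2)[where \<alpha> = \<alpha>])
    show "\<psi> a b \<kappa> x = collision_clock a b 2 x" if "0 \<le> x" "x < 1" "avoids_corners \<alpha> x" for x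
      unfolding \<psi>_def initial_state_eq_orbit_state[OF ab(1,3) that(1,2)]
      by (rule collision_time_eq_clock[OF ab that(3)[unfolded \<alpha>_def]])
  qed simp
  also have "collision_clock a b 2 = (\<lambda>x. sqrt 2 * (2 * (1 - a * b / (a + b))) + sqrt 2 * (a + b) *
      (parabola (2 * x + 2 * \<alpha>) - parabola (2 * x + \<alpha>) - parabola (2 * x) + parabola (2 * x + - \<alpha>)))"
    by (rule ext) (simp add: collision_clock_def Let_def \<alpha>_def[symmetric] distrib_left algebra_simps)
  also have "(\<integral>x. \<dots> x \<partial>circle) = sqrt 2 * (2 * (1 - a * b / (a + b)))"
  proof -
    have int: "integrable circle (\<lambda>x. parabola (2 * x + s))" for s
    proof (rule integrable_circle_bounded[where B = 1])
      show "\<bar>parabola (2 * x + s)\<bar> \<le> 1" for x using parabola_bounds[of "2 * x + s"] by simp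
    qed measurable
    have int0: "integrable circle (\<lambda>x. parabola (2 * x))" using int[of 0] by simp
    show ?thesis using int int0 by (simp add: integral_parabola_rotate circle.prob_space del: add_uminus_conv_diff)
  qed
  finally show ?thesis by simp
qed

text \<open>Combines the comparison of the displacement sums with the walk, whose error tends to \<open>0\<close>, and the
  limit theorem for the walk.\<close>

lemma limit_along_blocks:
  fixes g :: "nat \<Rightarrow> real \<times> real \<Rightarrow> real"
  assumes L: "\<And>n F. n > 0 \<Longrightarrow> (\<And>u v. \<bar>F u v\<bar> \<le> 1) \<Longrightarrow>
      \<bar>sums_mean \<alpha> (L n) F - walk_mean (replicate n True @ replicate n False) F\<bar> \<le> 1 / real n"
    and meas: "\<And>n. g n \<in> borel_measurable borel" and bd: "\<And>n p. \<bar>g n p\<bar> \<le> B"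
    and meas': "g' \<in> borel_measurable borel"
    and conv: "\<And>p p'. p \<longlonglongrightarrow> p' \<Longrightarrow> (\<lambda>n. g n (p n)) \<longlonglongrightarrow> g' p'"
  shows "(\<lambda>n. sums_mean \<alpha> (L n) (\<lambda>u v. g n (of_int u / sqrt (real n), of_int v / sqrt (real n))))
    \<longlonglongrightarrow> (\<integral>x. (\<integral>y. g' (x, y) \<partial>std_normal_distribution) \<partial>std_normal_distribution)"
proof -
  \<comment> \<open>a positive bound, by which the test functions are divided\<close>
  define C where "C = B + 1"
  have "0 \<le> B" using bd[of 0 undefined] by linarith
  then have C: "C > 0" "\<bar>g n p\<bar> \<le> C" for n p using bd[of n p] by (auto simp: C_def)
  define G where "G n u v = g n (of_int u / sqrt (real n), of_int v / sqrt (real n))" for n u v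
  define W where "W n = walk_mean (replicate n True @ replicate n False) (G n)" for n
  have W: "W \<longlonglongrightarrow> (\<integral>x. (\<integral>y. g' (x, y) \<partial>std_normal_distribution) \<partial>std_normal_distribution)"
    unfolding W_def[abs_def] G_def by (rule planar_walk_limit[OF meas bd meas' conv])
  have lin: "walk_mean d (\<lambda>u v. F u v / C) = walk_mean d F / C" for d F
  proof (induction d arbitrary: F)
    case (Cons x d)
    have "displace_argument x s (\<lambda>u v. F u v / C) = (\<lambda>u v. displace_argument x s F u v / C)" for s by (auto simp: displace_argument_def fun_eq_iff)
    then show ?case by (simp add: Cons.IH add_divide_distrib)
  qed simp
  have err: "\<bar>sums_mean \<alpha> (L n) (G n) - W n\<bar> \<le> C * (1 / real n)" if "n > 0" for n
  proof -
    have "\<bar>sums_mean \<alpha> (L n) (\<lambda>u v. G n u v / C) - walk_mean (replicate n True @ replicate n False) (\<lambda>u v. G n u v / C)\<bar> \<le> 1 / real n"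
      using C by (intro L that) (auto simp: G_def)
    moreover have "sums_mean \<alpha> (L n) (\<lambda>u v. G n u v / C) = sums_mean \<alpha> (L n) (G n) / C"
      by (simp add: sums_mean_def)
    ultimately have "\<bar>(sums_mean \<alpha> (L n) (G n) - W n) / C\<bar> \<le> 1 / real n"
      by (simp add: lin W_def diff_divide_distrib)
    then show ?thesis using C(1) by (simp add: abs_divide pos_divide_le_eq mult.commute)
  qed
  have "(\<lambda>n. sums_mean \<alpha> (L n) (G n) - W n) \<longlonglongrightarrow> 0"
  proof (rule Lim_null_comparison)
    show "\<forall>\<^sub>F n in sequentially. norm (sums_mean \<alpha> (L n) (G n) - W n) \<le> C * (1 / real n)"
      using err by (intro eventually_sequentiallyI[of 1]) auto
    show "(\<lambda>n. C * (1 / real n)) \<longlonglongrightarrow> 0"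
      by (rule tendsto_mult_right_zero) (rule lim_1_over_n)
  qed
  from tendsto_add[OF this W] show ?thesis by (simp add: G_def[abs_def])
qed

text \<open>Bounds the effect on \<open>f\<close> of an error of size \<open>r\<close> in the argument.  As a supremum of continuous
  functions it is Borel, and so can be integrated.\<close>

definition oscillation :: "('a::real_normed_vector \<Rightarrow> real) \<Rightarrow> real \<Rightarrow> 'a \<Rightarrow> real" where
  "oscillation f r y = (SUP u\<in>cball 0 r. \<bar>f (y + u) - f y\<bar>)"

lemma oscillation_facts:
  fixes f :: "'a::real_normed_vector \<Rightarrow> real"
  assumes f: "continuous_on UNIV f" "\<And>y. \<bar>f y\<bar> \<le> B" and r: "r \<ge> 0"
  shows "\<bar>oscillation f r y\<bar> \<le> 2 * B"
    and "norm u \<le> r \<Longrightarrow> \<bar>f (y + u) - f y\<bar> \<le> oscillation f r y"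
    and "oscillation f r \<in> borel_measurable borel"
proof -
  have le: "\<bar>f (y + u) - f y\<bar> \<le> 2 * B" for y u using f(2)[of y] f(2)[of "y + u"] by linarith
  have bdd: "bdd_above ((\<lambda>u. \<bar>f (y + u) - f y\<bar>) ` cball 0 r)" for y by (rule bdd_aboveI2[OF le])
  have ne: "cball (0::'a) r \<noteq> {}" using r by simp
  show up: "\<bar>f (y + u) - f y\<bar> \<le> oscillation f r y" if "norm u \<le> r" for u y
    unfolding oscillation_def by (rule cSUP_upper[OF _ bdd]) (use that in simp)
  have "oscillation f r y \<le> 2 * B" unfolding oscillation_def by (rule cSUP_least[OF ne le])
  moreover have "0 \<le> oscillation f r y" using up[of 0 y] r by simp
  ultimately show "\<bar>oscillation f r y\<bar> \<le> 2 * B" by simp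
  show "oscillation f r \<in> borel_measurable borel"
  proof (rule borel_measurableI_greater)
    fix c :: real
    have "{y. c < oscillation f r y} = (\<Union>u\<in>cball 0 r. {y. c < \<bar>f (y + u) - f y\<bar>})"
      unfolding oscillation_def by (auto simp: less_cSUP_iff[OF ne bdd])
    moreover have "open {y. c < \<bar>f (y + u) - f y\<bar>}" for u
      using f(1) by (intro open_Collect_less continuous_intros continuous_on_compose2[OF f(1)]) auto
    ultimately have "open {y. c < oscillation f r y}" by auto
    then show "{x \<in> space borel. c < oscillation f r x} \<in> sets borel" by simp
  qed
qed

text \<open>Continuity at \<open>y'\<close> bounds the oscillation on all small balls close to \<open>y'\<close>.\<close>

lemma oscillation_tendsto_0:
  fixes f :: "'a::real_normed_vector \<Rightarrow> real"
  assumes f: "continuous_on UNIV f" and y: "y \<longlonglongrightarrow> y'" and r: "r \<longlonglongrightarrow> 0" "\<And>n. r n \<ge> 0"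
  shows "(\<lambda>n. oscillation f (r n) (y n)) \<longlonglongrightarrow> 0"
proof (rule LIMSEQ_I)
  fix e :: real assume e: "e > 0"
  have "isCont f y'" using f by (simp add: continuous_on_eq_continuous_at)
  then obtain d where d: "d > 0" "\<And>z. dist z y' < d \<Longrightarrow> dist (f z) (f y') < e/4"
    using e unfolding continuous_at_eps_delta by (metis divide_pos_pos zero_less_numeral)
  have "\<forall>\<^sub>F n in sequentially. dist (y n) y' < d/2" "\<forall>\<^sub>F n in sequentially. r n < d/2"
    using tendstoD[OF y, of "d/2"] order_tendstoD(2)[OF r(1), of "d/2"] d(1) by auto
  then have "\<forall>\<^sub>F n in sequentially. norm (oscillation f (r n) (y n) - 0) < e"
  proof eventually_elim
    case (elim n)
    have bnd: "\<bar>f (y n + u) - f (y n)\<bar> \<le> e/2" if "u \<in> cball 0 (r n)" for u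
    proof -
      have "dist (y n + u) y' \<le> norm u + dist (y n) y'"
        using norm_triangle_ineq[of u "y n - y'"] by (simp add: dist_norm algebra_simps)
      then have "dist (y n + u) y' < d" using elim that by simp
      then have "dist (f (y n + u)) (f y') < e/4" "dist (f (y n)) (f y') < e/4" using d elim by auto
      then show ?thesis unfolding dist_real_def by linarith
    qed
    then have "oscillation f (r n) (y n) \<le> e/2"
      unfolding oscillation_def using r(2)[of n] by (intro cSUP_least) auto
    moreover have "\<bar>f (y n + 0) - f (y n)\<bar> \<le> oscillation f (r n) (y n)"
      unfolding oscillation_def by (rule cSUP_upper[OF _ bdd_aboveI2[OF bnd]]) (use r(2)[of n] in auto)
    ultimately show ?case using e by simp
  qed
  then show "\<exists>N. \<forall>n\<ge>N. norm (oscillation f (r n) (y n) - 0) < e" by (simp add: eventually_sequentially)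
qed

lemma cocycle_limit:
  assumes L: "\<And>n F. n > 0 \<Longrightarrow> (\<And>u v. \<bar>F u v\<bar> \<le> 1) \<Longrightarrow>
      \<bar>sums_mean \<alpha> (L n) F - walk_mean (replicate n True @ replicate n False) F\<bar> \<le> 1 / real n"
    and \<alpha>: "0 < \<alpha>" "\<alpha> < 1"
  shows "converges_in_distribution circle
    (\<lambda>n x. (1 / sqrt (real n)) *\<^sub>R real_vec (ergodic_sum \<alpha> (L n) (\<Psi> \<alpha>) x)) (isotropic_normal 1)"
  unfolding converges_in_distribution_def
proof (intro conjI allI impI)
  define V where "V n x = to_vec2 (of_int (horizontal_sum \<alpha> (L n) x) / sqrt (real n), of_int (vertical_sum \<alpha> (L n) x) / sqrt (real n))" for n x
  have eq: "(1 / sqrt (real n)) *\<^sub>R real_vec (ergodic_sum \<alpha> (L n) (\<Psi> \<alpha>) x) = V n x" if "avoids_corners \<alpha> x" for n x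
    by (simp add: ergodic_sum_eq[OF \<alpha> that] V_def vec_eq_iff forall_2)
  have [measurable]: "V n \<in> borel_measurable borel" for n
    unfolding V_def[abs_def] to_vec2_def using measurable_horizontal_sum[measurable] measurable_vertical_sum[measurable] by measurable
  show "(\<lambda>x. (1 / sqrt (real n)) *\<^sub>R real_vec (ergodic_sum \<alpha> (L n) (\<Psi> \<alpha>) x)) \<in> borel_measurable circle" for n
    by (rule circle_cong_off_corners(1)[where g = "V n" and \<alpha> = \<alpha>]) (simp_all add: eq)
  fix f :: "real^2 \<Rightarrow> real" assume f: "continuous_on UNIV f \<and> bounded (range f)"
  then obtain B where B: "\<And>y. \<bar>f y\<bar> \<le> B" by (auto simp: bounded_iff)
  have fm[measurable]: "f \<in> borel_measurable borel" using f by (intro borel_measurable_continuous_onI) auto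
  have gm: "(\<lambda>p. f (to_vec2 p)) \<in> borel_measurable borel"
    using to_vec2_measurable[unfolded borel_prod] by measurable
  have "(\<integral>x. f ((1 / sqrt (real n)) *\<^sub>R real_vec (ergodic_sum \<alpha> (L n) (\<Psi> \<alpha>) x)) \<partial>circle) =
    sums_mean \<alpha> (L n) (\<lambda>u v. f (to_vec2 (of_int u / sqrt (real n), of_int v / sqrt (real n))))" for n
    unfolding sums_mean_def V_def[symmetric]
    by (rule circle_cong_off_corners(2)[where \<alpha> = \<alpha>]) (simp_all add: eq)
  moreover have "(\<lambda>n. sums_mean \<alpha> (L n) (\<lambda>u v. f (to_vec2 (of_int u / sqrt (real n), of_int v / sqrt (real n))))) \<longlonglongrightarrow>
     (\<integral>x. (\<integral>y. f (to_vec2 (x, y)) \<partial>std_normal_distribution) \<partial>std_normal_distribution)"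
  proof (rule limit_along_blocks[OF L, where g = "\<lambda>_ p. f (to_vec2 p)" and g' = "\<lambda>p. f (to_vec2 p)" and B = B])
    fix p p' assume "p \<longlonglongrightarrow> (p' :: real \<times> real)"
    then show "(\<lambda>n. f (to_vec2 (p n))) \<longlonglongrightarrow> f (to_vec2 p')"
      using f continuous_on_to_vec2 by (intro continuous_on_tendsto_compose[where s = UNIV and f = f] continuous_on_tendsto_compose[where s = UNIV and f = to_vec2]) auto
  qed (use B gm in auto)
  moreover have "(\<integral>y. f y \<partial>isotropic_normal 1) = (\<integral>x. (\<integral>y. f (to_vec2 (x, y)) \<partial>std_normal_distribution) \<partial>std_normal_distribution)"
    using integral_isotropic_normal[OF fm B, of 1 1 1] by simp
  ultimately show "(\<lambda>n. \<integral>x. f ((1 / sqrt (real n)) *\<^sub>R real_vec (ergodic_sum \<alpha> (L n) (\<Psi> \<alpha>) x)) \<partial>circle) \<longlonglongrightarrow> (\<integral>y. f y \<partial>isotropic_normal 1)"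
    by simp
qed

text \<open>The rescaled position \<open>Y n\<close> is within \<open>10/\<surd>n\<close> of the rescaled displacement \<open>P n\<close>, hence
  \<open>f (Y n)\<close> is within an oscillation of \<open>f\<close> at \<open>P n\<close> of \<open>f (P n)\<close>.  Both the mean of \<open>f (P n)\<close> and the mean of
  that oscillation are covered by the limit theorem for the displacement sums.\<close>

lemma billiard_limit:
  assumes ab: "0 < a" "a < 1" "0 < b" "b < 1" "a + b \<le> 1" and \<alpha>: "\<alpha> = a / (a + b)"
    and L: "\<And>n F. n > 0 \<Longrightarrow> (\<And>u v. \<bar>F u v\<bar> \<le> 1) \<Longrightarrow>
      \<bar>sums_mean \<alpha> (L n) F - walk_mean (replicate n True @ replicate n False) F\<bar> \<le> 1 / real n"
  shows "converges_in_distribution circle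
    (\<lambda>n x. (1 / sqrt (real n)) *\<^sub>R X a b \<kappa> (mean_time a b \<kappa> * real (L n)) x) (isotropic_normal 2)"
  unfolding converges_in_distribution_def
proof (intro conjI allI impI)
  define \<tau> where "\<tau> = real_of_int (chirality \<kappa>)"
  have \<tau>: "\<bar>2 * \<tau>\<bar> = 2" using chirality_values[of \<kappa>] by (auto simp: \<tau>_def)
  define t where "t n = mean_time a b \<kappa> * real (L n)" for n
  define S where "S p = to_vec2 (2 * \<tau> * fst p, 2 * snd p)" for p :: "real \<times> real"
  define Q where "Q n u v = (of_int u / sqrt (real n), of_int v / sqrt (real n))" for n and u v :: int
  define P where "P n x = S (Q n (horizontal_sum \<alpha> (L n) x) (vertical_sum \<alpha> (L n) x))" for n x
  define Y where "Y n x = (1 / sqrt (real n)) *\<^sub>R position_at a b \<kappa> (t n) x" for n x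
  define r where "r n = 10 / sqrt (real n)" for n
  have r: "r n \<ge> 0" "r \<longlonglongrightarrow> 0" for n unfolding r_def[abs_def] by (simp, real_asymp)
  have Scont: "continuous_on UNIV S"
    unfolding S_def[abs_def] by (rule continuous_on_compose2[OF continuous_on_to_vec2]) (auto intro!: continuous_intros)
  have Sm: "S \<in> borel_measurable borel" by (rule borel_measurable_continuous_onI[OF Scont])
  have Ym: "Y n \<in> borel_measurable borel" for n
    unfolding Y_def[abs_def] using position_at_measurable[measurable] by measurable
  have Pm: "P n \<in> borel_measurable borel" for n
    unfolding P_def[abs_def] S_def Q_def to_vec2_def using measurable_horizontal_sum[measurable] measurable_vertical_sum[measurable] by measurable
  have XY: "(1 / sqrt (real n)) *\<^sub>R X a b \<kappa> (mean_time a b \<kappa> * real (L n)) x = Y n x" if "0 \<le> x" "x < 1" "avoids_corners \<alpha> x" for n x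
    using billiard_position_eq[OF ab that(3)[unfolded \<alpha>] that(1,2)] by (simp add: Y_def t_def)
  show "(\<lambda>x. (1 / sqrt (real n)) *\<^sub>R X a b \<kappa> (mean_time a b \<kappa> * real (L n)) x) \<in> borel_measurable circle" for n
    by (rule circle_cong_off_corners(1)[where g = "Y n" and \<alpha> = \<alpha>]) (simp_all add: XY Ym)
  have close: "norm (Y n x - P n x) \<le> r n" if "avoids_corners \<alpha> x" for n x
  proof -
    define v :: "real^2" where "v = 2 *\<^sub>R vector [of_int (chirality \<kappa> * horizontal_sum \<alpha> (L n) x), of_int (vertical_sum \<alpha> (L n) x)]"
    have "norm (position_at a b \<kappa> (t n) x - v) \<le> 10"
      unfolding t_def v_def mean_time_eq[OF ab] \<alpha> using position_follows_cocycle[OF ab that[unfolded \<alpha>]] .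
    moreover have "P n x = (1 / sqrt (real n)) *\<^sub>R v"
      by (simp add: P_def S_def Q_def v_def vec_eq_iff forall_2 \<tau>_def)
    ultimately show ?thesis
      by (simp add: Y_def r_def scaleR_diff_right[symmetric] divide_right_mono)
  qed
  fix f :: "real^2 \<Rightarrow> real" assume f: "continuous_on UNIV f \<and> bounded (range f)"
  then obtain B where B: "\<And>y. \<bar>f y\<bar> \<le> B" by (auto simp: bounded_iff)
  have fm: "f \<in> borel_measurable borel" using f by (intro borel_measurable_continuous_onI) auto
  note osc = oscillation_facts[OF conjunct1[OF f] B r(1)]
  have fP: "(\<lambda>n. \<integral>x. f (P n x) \<partial>circle) \<longlonglongrightarrow> (\<integral>y. f y \<partial>isotropic_normal 2)"
  proof -
    have "(\<lambda>n. sums_mean \<alpha> (L n) (\<lambda>u v. f (S (of_int u / sqrt (real n), of_int v / sqrt (real n))))) \<longlonglongrightarrow>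
       (\<integral>x. (\<integral>y. f (S (x, y)) \<partial>std_normal_distribution) \<partial>std_normal_distribution)"
    proof (rule limit_along_blocks[OF L, where g = "\<lambda>_ p. f (S p)" and g' = "\<lambda>p. f (S p)" and B = B])
      fix p p' assume "p \<longlonglongrightarrow> (p' :: real \<times> real)"
      then show "(\<lambda>n. f (S (p n))) \<longlonglongrightarrow> f (S p')"
        using f Scont by (intro continuous_on_tendsto_compose[where s = UNIV and f = f] continuous_on_tendsto_compose[where s = UNIV and f = S]) auto
    qed (use B measurable_compose[OF Sm fm] in auto)
    then show ?thesis
      using integral_isotropic_normal[OF fm B, of 2 "2 * \<tau>" 2] \<tau> by (simp add: sums_mean_def P_def Q_def S_def)
  qed
  have oP: "(\<lambda>n. \<integral>x. oscillation f (r n) (P n x) \<partial>circle) \<longlonglongrightarrow> 0"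
  proof -
    have "(\<lambda>n. sums_mean \<alpha> (L n) (\<lambda>u v. oscillation f (r n) (S (of_int u / sqrt (real n), of_int v / sqrt (real n))))) \<longlonglongrightarrow>
       (\<integral>x. (\<integral>y. (\<lambda>_. 0) (x, y) \<partial>std_normal_distribution) \<partial>std_normal_distribution)"
    proof (rule limit_along_blocks[OF L, where g = "\<lambda>n p. oscillation f (r n) (S p)" and g' = "\<lambda>_. 0" and B = "2 * B"])
      fix p p' assume "p \<longlonglongrightarrow> (p' :: real \<times> real)"
      then have "(\<lambda>n. S (p n)) \<longlonglongrightarrow> S p'"
        using Scont by (intro continuous_on_tendsto_compose[where s = UNIV and f = S]) auto
      then show "(\<lambda>n. oscillation f (r n) (S (p n))) \<longlonglongrightarrow> 0"
        using f r by (intro oscillation_tendsto_0) auto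
    qed (use osc(1) measurable_compose[OF Sm osc(3)] in auto)
    then show ?thesis by (simp add: sums_mean_def P_def Q_def)
  qed
  have diff: "norm ((\<integral>x. f (Y n x) \<partial>circle) - (\<integral>x. f (P n x) \<partial>circle)) \<le> (\<integral>x. oscillation f (r n) (P n x) \<partial>circle)" for n
  proof -
    have int: "integrable circle (\<lambda>x. f (Y n x))" "integrable circle (\<lambda>x. f (P n x))" "integrable circle (\<lambda>x. oscillation f (r n) (P n x))"
      by (rule integrable_circle_bounded[OF measurable_compose[OF Ym fm] B]
          integrable_circle_bounded[OF measurable_compose[OF Pm fm] B]
          integrable_circle_bounded[OF measurable_compose[OF Pm osc(3)] osc(1)])+
    have "norm (\<integral>x. f (Y n x) - f (P n x) \<partial>circle) \<le> (\<integral>x. norm (f (Y n x) - f (P n x)) \<partial>circle)"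
      by (rule integral_norm_bound)
    also have "\<dots> \<le> (\<integral>x. oscillation f (r n) (P n x) \<partial>circle)"
    proof (rule integral_mono_AE)
      show "AE x in circle. norm (f (Y n x) - f (P n x)) \<le> oscillation f (r n) (P n x)"
        using AE_avoids_corners[of \<alpha>]
      proof (rule AE_mp, intro AE_I2 impI)
        fix x assume "avoids_corners \<alpha> x"
        from osc(2)[OF close[OF this, of n], of "P n x"] show "norm (f (Y n x) - f (P n x)) \<le> oscillation f (r n) (P n x)" by simp
      qed
    qed (use int in auto)
    finally show ?thesis using int by simp
  qed
  have "(\<lambda>n. (\<integral>x. f (Y n x) \<partial>circle) - (\<integral>x. f (P n x) \<partial>circle)) \<longlonglongrightarrow> 0"
    by (rule Lim_null_comparison[OF _ oP]) (use diff in auto)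
  from tendsto_add[OF this fP] have "(\<lambda>n. \<integral>x. f (Y n x) \<partial>circle) \<longlonglongrightarrow> (\<integral>y. f y \<partial>isotropic_normal 2)" by simp
  moreover have "(\<integral>x. f ((1 / sqrt (real n)) *\<^sub>R X a b \<kappa> (mean_time a b \<kappa> * real (L n)) x) \<partial>circle) = (\<integral>x. f (Y n x) \<partial>circle)" for n
    by (rule circle_cong_off_corners(2)[where \<alpha> = \<alpha>]) (simp_all add: XY measurable_compose[OF Ym fm])
  ultimately show "(\<lambda>n. \<integral>x. f ((1 / sqrt (real n)) *\<^sub>R X a b \<kappa> (mean_time a b \<kappa> * real (L n)) x) \<partial>circle) \<longlonglongrightarrow> (\<integral>y. f y \<partial>isotropic_normal 2)"
    by simp
qed

theorem theorem2p6:
  fixes \<kappa> :: copy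
  shows "AE r :: real in lborel. 0 < r \<longrightarrow>
    (\<exists>L :: nat \<Rightarrow> nat. (\<forall>n. 0 < L n) \<and>
      (\<forall>a b :: real. 0 < a \<and> a < 1 \<and> 0 < b \<and> b < 1 \<and> a + b \<le> 1 \<and> a / b = r \<longrightarrow>
        (let \<alpha> = a / (a + b) in
          (\<exists>N. nondegenerate_normal_law N \<and>
             converges_in_distribution circle
               (\<lambda>n x. (1 / sqrt (real n)) *\<^sub>R real_vec (ergodic_sum \<alpha> (L n) (\<Psi> \<alpha>) x)) N) \<and>
          ((\<lambda>n. (1 / sqrt (real n)) *
                  (\<Sum>j = 1..nat \<lfloor>ln (real n)\<rfloor>. real_of_int (partial_quotient \<alpha> (j + 1))))
              \<longlonglongrightarrow> 0 \<longrightarrow>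
           (\<exists>N. nondegenerate_normal_law N \<and>
              converges_in_distribution circle
                (\<lambda>n x. (1 / sqrt (real n)) *\<^sub>R X a b \<kappa> (mean_time a b \<kappa> * real (L n)) x) N)))))"
  using AE_very_well_approximable_ratio[of 1 1, simplified] AE_very_well_approximable_ratio[of 0 1, simplified]
proof eventually_elim
  case (elim r)
  show ?case
  proof
    assume r: "0 < r"
    define \<alpha> where "\<alpha> = r / (1 + r)"
    have \<alpha>: "0 < \<alpha>" "\<alpha> < 1" using r by (auto simp: \<alpha>_def)
    have vwa: "very_well_approximable (if b then 1 else 0) 1 \<alpha>" for b
      using elim r by (cases b) (auto simp: \<alpha>_def)
    \<comment> \<open>for \<open>n = 0\<close> any positive length will do\<close>
    have "\<exists>l. 0 < l \<and> (n > 0 \<longrightarrow> (\<forall>F. (\<forall>u v. \<bar>F u v\<bar> \<le> 1) \<longrightarrow>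
        \<bar>sums_mean \<alpha> l F - walk_mean (replicate n True @ replicate n False) F\<bar> \<le> 1 / real n))" for n :: nat
    proof (cases "n = 0")
      case False
      then show ?thesis
        using sums_mimic_walk[OF vwa, of "1 / real n" "replicate n True @ replicate n False"] by auto
    qed auto
    then obtain L where L0: "\<And>n. 0 < L n" and L: "\<And>n F. n > 0 \<Longrightarrow> (\<And>u v. \<bar>F u v\<bar> \<le> 1) \<Longrightarrow>
        \<bar>sums_mean \<alpha> (L n) F - walk_mean (replicate n True @ replicate n False) F\<bar> \<le> 1 / real n"
      by metis
    show "\<exists>L :: nat \<Rightarrow> nat. (\<forall>n. 0 < L n) \<and>
      (\<forall>a b :: real. 0 < a \<and> a < 1 \<and> 0 < b \<and> b < 1 \<and> a + b \<le> 1 \<and> a / b = r \<longrightarrow>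
        (let \<alpha> = a / (a + b) in
          (\<exists>N. nondegenerate_normal_law N \<and>
             converges_in_distribution circle
               (\<lambda>n x. (1 / sqrt (real n)) *\<^sub>R real_vec (ergodic_sum \<alpha> (L n) (\<Psi> \<alpha>) x)) N) \<and>
          ((\<lambda>n. (1 / sqrt (real n)) *
                  (\<Sum>j = 1..nat \<lfloor>ln (real n)\<rfloor>. real_of_int (partial_quotient \<alpha> (j + 1))))
              \<longlonglongrightarrow> 0 \<longrightarrow>
           (\<exists>N. nondegenerate_normal_law N \<and>
              converges_in_distribution circle
                (\<lambda>n x. (1 / sqrt (real n)) *\<^sub>R X a b \<kappa> (mean_time a b \<kappa> * real (L n)) x) N))))"
    proof (intro exI[of _ L] conjI allI impI L0)
      fix a b :: real
      assume ab: "0 < a \<and> a < 1 \<and> 0 < b \<and> b < 1 \<and> a + b \<le> 1 \<and> a / b = r"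
      then have "1 + r = (a + b) / b" by (auto simp: field_simps)
      then have \<alpha>': "\<alpha> = a / (a + b)" using ab by (auto simp: \<alpha>_def)
      have "0 < a" "a < 1" "0 < b" "b < 1" "a + b \<le> 1" using ab by auto
      from billiard_limit[OF this \<alpha>' L] cocycle_limit[OF L \<alpha>]
      show "let \<alpha> = a / (a + b) in
          (\<exists>N. nondegenerate_normal_law N \<and>
             converges_in_distribution circle
               (\<lambda>n x. (1 / sqrt (real n)) *\<^sub>R real_vec (ergodic_sum \<alpha> (L n) (\<Psi> \<alpha>) x)) N) \<and>
          ((\<lambda>n. (1 / sqrt (real n)) *
                  (\<Sum>j = 1..nat \<lfloor>ln (real n)\<rfloor>. real_of_int (partial_quotient \<alpha> (j + 1))))
              \<longlonglongrightarrow> 0 \<longrightarrow>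
           (\<exists>N. nondegenerate_normal_law N \<and>
              converges_in_distribution circle
                (\<lambda>n x. (1 / sqrt (real n)) *\<^sub>R X a b \<kappa> (mean_time a b \<kappa> * real (L n)) x) N))"
        unfolding Let_def \<alpha>'[symmetric]
        using nondegenerate_isotropic_normal[of 1] nondegenerate_isotropic_normal[of 2] by auto
    qed
  qed
qed

end
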